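(* There is an algorithm that, given an $n$-vertex hypergraph $H$ of rank at most $3$, enumerates (outputs) all minimal transversals of $H$ in time $O(1.6755^n)$.
   Context: A hypergraph $H=(V,E)$ consists of a finite vertex set $V$ and a set $E$ of subsets of $V$ called hyperedges; $n=|V|$. The rank of $H$ is the maximum size of a hyperedge. A transversal of $H$ is a set $S\subseteq V$ intersecting every hyperedge of $E$; it is minimal if no proper subset of $S$ is a transversal of $H$. *)

theory Defs
  imports Complex_Main
begin

definition hypergraph :: "'a set \<Rightarrow> 'a set set \<Rightarrow> bool" where
  "hypergraph V E \<longleftrightarrow> finite V \<and> E \<subseteq> Pow V"

definition hg_rank_le :: "'a set set \<Rightarrow> nat \<Rightarrow> bool" where
  "hg_rank_le E r \<longleftrightarrow> (\<forall>e\<in>E. card e \<le> r)"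

definition is_transversal :: "'a set set \<Rightarrow> 'a set \<Rightarrow> bool" where
  "is_transversal E S \<longleftrightarrow> (\<forall>e\<in>E. S \<inter> e \<noteq> {})"

definition minimal_transversal :: "'a set \<Rightarrow> 'a set set \<Rightarrow> 'a set \<Rightarrow> bool" where
  "minimal_transversal V E S \<longleftrightarrow>
     S \<subseteq> V \<and> is_transversal E S \<and> (\<forall>T. T \<subset> S \<longrightarrow> \<not> is_transversal E T)"

section \<open>Machine model: unit-cost RAM (naturals, +, truncated -, indirect addressing)\<close>

datatype instr =
    Const nat nat
  | Add nat nat nat
  | Sub nat nat nat
  | Load nat nat
  | Store nat nat
  | Jz nat nat
  | Out nat

record config =
  pc :: nat
  mem :: "nat \<Rightarrow> nat"
  out :: "nat list"

definition halted :: "instr list \<Rightarrow> config \<Rightarrow> bool" where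
  "halted P c \<longleftrightarrow> length P \<le> pc c"

fun exec_instr :: "instr \<Rightarrow> config \<Rightarrow> config" where
  "exec_instr (Const r k) c = c\<lparr>pc := Suc (pc c), mem := (mem c)(r := k)\<rparr>"
| "exec_instr (Add r a b) c = c\<lparr>pc := Suc (pc c), mem := (mem c)(r := mem c a + mem c b)\<rparr>"
| "exec_instr (Sub r a b) c = c\<lparr>pc := Suc (pc c), mem := (mem c)(r := mem c a - mem c b)\<rparr>"
| "exec_instr (Load r a) c = c\<lparr>pc := Suc (pc c), mem := (mem c)(r := mem c (mem c a))\<rparr>"
| "exec_instr (Store a b) c = c\<lparr>pc := Suc (pc c), mem := (mem c)(mem c a := mem c b)\<rparr>"
| "exec_instr (Jz r l) c = c\<lparr>pc := (if mem c r = 0 then l else Suc (pc c))\<rparr>"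
| "exec_instr (Out r) c = c\<lparr>pc := Suc (pc c), out := out c @ [mem c r]\<rparr>"

definition step :: "instr list \<Rightarrow> config \<Rightarrow> config" where
  "step P c = (if halted P c then c else exec_instr (P ! pc c) c)"

definition run :: "instr list \<Rightarrow> nat \<Rightarrow> config \<Rightarrow> config" where
  "run P k c = (step P ^^ k) c"

definition init_config :: "nat list \<Rightarrow> config" where
  "init_config inp = \<lparr>pc = 0, mem = (\<lambda>i. if i < length inp then inp ! i else 0), out = []\<rparr>"

text \<open>Encoding of a hypergraph on vertex set {0..<n} given as a list of hyperedges
  (each hyperedge a list of its vertices): n, number of edges, then for each edge its
  size followed by its vertices.\<close>
definition encode_hg :: "nat \<Rightarrow> nat list list \<Rightarrow> nat list" where
  "encode_hg n es = n # length es # concat (map (\<lambda>e. length e # e) es)"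

definition encode_sets :: "nat list list \<Rightarrow> nat list" where
  "encode_sets ts = concat (map (\<lambda>t. length t # t) ts)"

end

theory Submission
  imports Defs
begin

text \<open>
  The algorithm is a depth-first search over partial assignments (each vertex undecided, selected or
  discarded); a node is described by its residual family: the edges not yet hit by a selected vertex,
  with the discarded vertices removed. If a vertex is selected by a minimal transversal, it has a
  private edge, and this edge can be taken among the inclusion-minimal residual edges. This makes it
  possible to branch cheaply on vertices of degree at most two.

  The potential of a residual family is $x^{v}\rho$ with $x = 1.675$, where $v$ is the number of
  vertices that occur in it and the discount $\rho$ depends on the number of edges of size two,
  on whether some vertex has degree at most two, and on whether some edge is a singleton.
  Every branching rule splits the transversals into disjoint classes and does not increase the total
  potential, hence the search tree has at most polynomially many times $x^n$ nodes. Since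
  $x < 1.6755$, polynomial work per node is affordable. That work is uniform: the applicable rule is
  found by evaluating first-order formulas over the input by exhaustive loops.
\<close>

section \<open>Branching rules and the potential\<close>

text \<open>Branching on a single vertex with no further gain requires 2/x <= 1, that is, x at least
  2. The saving must come from what a branch leaves behind. Discarding a vertex turns its triples
  into pairs, and pairs are cheap because discarding one end forces the other. Selecting a vertex
  creates no pair, so in a 3-regular family that branch needs another credit: a neighbour drops to
  degree two, and a vertex with so few edges has few candidates for a private edge, which constrains
  the sets that select it. Dead branches are not pruned. An edge all of whose vertices are discarded
  simply leaves the residual family, and the exact test at the leaves rejects such nodes. The bound
  therefore counts all nodes, and no earlier output has to be remembered. Since branching merely
  does not increase the potential, counting nodes needs one more factor, supplied later by
  \<open>Phi\<close>.\<close>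

definition red :: "'a set \<Rightarrow> 'a set \<Rightarrow> 'a set set \<Rightarrow> 'a set set" where
  "red A B H = {f - B |f. f \<in> H \<and> f \<inter> A = {}} - {{}}"

definition two :: "'a set set \<Rightarrow> 'a set set" where
  "two H = {f \<in> H. card f = 2}"

definition inc :: "'a set set \<Rightarrow> 'a \<Rightarrow> 'a set set" where
  "inc H v = {f \<in> H. v \<in> f}"

definition low :: "'a set set \<Rightarrow> bool" where
  "low H \<longleftrightarrow> (\<exists>v\<in>\<Union>H. card (inc H v) \<le> 2)"

text \<open>The weights satisfy the branching recurrences for $x = 67/40$ and $p = 1/x = 40/67$. Tight are
  $p (1 + 27/40) = 1$ (a vertex of degree at least four) and $p (19/20 + 29/40) = 1$ (the 3-regular
  case, where selecting a vertex leaves a vertex of degree at most two).\<close>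

definition weight :: "nat \<Rightarrow> real" where
  "weight m = (if m = 0 then 1 else if m = 1 then 877/1000 else if m = 2 then 785/1000
     else if m = 3 then 29/40 else 27/40)"

text \<open>A singleton forces its vertex, so such a family is worth one vertex less, which is the
  factor 1/x. Low degree is credited only in the absence of pairs, since a single pair already gives
  877/1000, less than 19/20.\<close>

definition rho :: "'a set set \<Rightarrow> real" where
  "rho H = (if \<exists>v. {v} \<in> H then 40/67 else if two H = {} \<and> low H then 19/20
     else weight (card (two H)))"

definition pot :: "'a set set \<Rightarrow> real" where
  "pot H = (67/40) ^ card (\<Union>H) * rho H"

definition rank3 :: "'a set set \<Rightarrow> bool" where
  "rank3 H \<longleftrightarrow> finite H \<and> (\<forall>f\<in>H. f \<noteq> {} \<and> finite f \<and> card f \<le> 3)"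

text \<open>What remains of minimality inside a residual family: private edges are demanded only of
  vertices that still occur in it. This is a necessary condition, so it may rule out branches, but
  it cannot accept a leaf.\<close>

definition adm :: "'a set set \<Rightarrow> 'a set \<Rightarrow> bool" where
  "adm H S \<longleftrightarrow> (\<forall>f\<in>H. f \<inter> S \<noteq> {}) \<and> (\<forall>v\<in>S \<inter> \<Union>H. \<exists>f\<in>H. f \<inter> S = {v})"

text \<open>Nonempty branches give progress and conflicting ones rule out repeated outputs. Coverage
  is required only of sets with private edges, and this is where a rule gains over exhaustive
  branching.\<close>

definition good :: "'a set set \<Rightarrow> ('a set \<times> 'a set) list \<Rightarrow> bool" where
  "good H brs \<longleftrightarrow>
     (\<forall>(A, B)\<in>set brs. A \<union> B \<subseteq> \<Union>H \<and> A \<inter> B = {} \<and> A \<union> B \<noteq> {}) \<and>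
     sorted_wrt (\<lambda>(A, B) (A', B'). A \<inter> B' \<union> B \<inter> A' \<noteq> {}) brs \<and>
     (\<forall>S. adm H S \<longrightarrow> (\<exists>(A, B)\<in>set brs. A \<subseteq> S \<and> B \<inter> S = {})) \<and>
     (\<Sum>(A, B)\<leftarrow>brs. pot (red A B H)) \<le> pot H"

definition E2 :: "'a set set \<Rightarrow> 'a \<Rightarrow> 'a \<Rightarrow> bool" where
  "E2 H a b \<longleftrightarrow> {a, b} \<in> H \<and> a \<noteq> b"

definition E3 :: "'a set set \<Rightarrow> 'a \<Rightarrow> 'a \<Rightarrow> 'a \<Rightarrow> bool" where
  "E3 H a b c \<longleftrightarrow> {a, b, c} \<in> H \<and> a \<noteq> b \<and> a \<noteq> c \<and> b \<noteq> c"

text \<open>In a family without singletons these are the inclusion-minimal triples. They are the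
  only triples that have to be considered as private edges, and the pair left after discarding one
  of their vertices is always new.\<close>

definition P3 :: "'a set set \<Rightarrow> 'a \<Rightarrow> 'a \<Rightarrow> 'a \<Rightarrow> bool" where
  "P3 H a b c \<longleftrightarrow> E3 H a b c \<and> {a, b} \<notin> H \<and> {b, c} \<notin> H \<and> {a, c} \<notin> H"

section \<open>Residual families and numerical bounds for the potential\<close>

lemma Union_red: "\<Union>(red A B H) \<subseteq> \<Union>H - (A \<union> B)"
  by (auto simp: red_def)

lemma in_red: "f \<in> H \<Longrightarrow> f \<inter> A = {} \<Longrightarrow> f - B = g \<Longrightarrow> g \<noteq> {} \<Longrightarrow> g \<in> red A B H"
  by (auto simp: red_def)

lemma rank3_red: "rank3 H \<Longrightarrow> rank3 (red A B H)"
  unfolding rank3_def red_def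
  by (auto intro: le_trans[OF card_mono])

lemma finite_Union_rank3: "rank3 H \<Longrightarrow> finite (\<Union>H)"
  by (auto simp: rank3_def)

lemma weight_antimono: "k \<le> m \<Longrightarrow> weight m \<le> weight k"
  by (auto simp: weight_def)

lemma weight_ge: "27/40 \<le> weight k"
  by (auto simp: weight_def)

lemma rho_le_weight: "k \<le> card (two H) \<Longrightarrow> rho H \<le> weight k"
  using weight_antimono[of k "card (two H)"] weight_ge[of k]
  by (auto simp: rho_def weight_def)

lemma rho_le_1: "rho H \<le> 1"
  using rho_le_weight[of 0 H] by (simp add: weight_def)

lemma rho_ge: "40/67 \<le> rho H"
  using weight_ge[of "card (two H)"] by (auto simp: rho_def)

lemma rho_sing: "{v} \<in> H \<Longrightarrow> rho H \<le> 40/67"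
  by (auto simp: rho_def)

lemma pot_pos: "0 < pot H"
  using rho_ge[of H] by (auto simp: pot_def intro!: mult_pos_pos)

lemma pot_ge: "40/67 \<le> pot H"
proof -
  have "1 * (40/67) \<le> (67/40) ^ card (\<Union>H) * rho H"
    using rho_ge[of H] by (intro mult_mono) auto
  then show ?thesis by (simp add: pot_def)
qed

text \<open>Besides the k decided vertices, others may vanish because all their edges are hit. This
  only lowers the exponent, so an inequality suffices.\<close>

lemma pot_red:
  assumes "rank3 H" "A \<union> B \<subseteq> \<Union>H" "card (A \<union> B) = k" "rho (red A B H) \<le> y"
  shows "pot (red A B H) \<le> (67/40) ^ card (\<Union>H) * ((40/67) ^ k * y)"
proof -
  have fin: "finite (\<Union>H)" using assms(1) by (rule finite_Union_rank3)
  have kle: "k \<le> card (\<Union>H)" using assms fin card_mono by blast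
  have "card (\<Union>(red A B H)) \<le> card (\<Union>H - (A \<union> B))"
    using Union_red fin by (metis card_mono finite_Diff)
  also have "\<dots> = card (\<Union>H) - k"
    using assms fin by (metis card_Diff_subset finite_subset)
  finally have "(67/40::real) ^ card (\<Union>(red A B H)) \<le> (67/40) ^ (card (\<Union>H) - k)"
    by (intro power_increasing) auto
  also have "\<dots> = (67/40) ^ card (\<Union>H) * (40/67) ^ k"
    using kle by (simp add: power_diff field_simps power_divide)
  finally have *: "(67/40::real) ^ card (\<Union>(red A B H)) \<le> (67/40) ^ card (\<Union>H) * (40/67) ^ k" .
  have "0 \<le> rho (red A B H)" using rho_ge[of "red A B H"] by simp
  then have "pot (red A B H) \<le> ((67/40) ^ card (\<Union>H) * (40/67) ^ k) * y"
    unfolding pot_def using * assms(4) by (intro mult_mono) auto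
  then show ?thesis by (simp add: mult.assoc)
qed

text \<open>Dividing by x to the number of vertices of \<open>H\<close> turns a branching into a
  numerical inequality: \<open>ks\<close> records for each branch how many vertices it decides and a
  bound on its discount. Every rule except \<open>degree3_rule\<close> obtains its potential bound
  this way.\<close>

lemma sum_pot_le:
  assumes "rank3 H"
    and "list_all2 (\<lambda>(A, B) (k, y). A \<union> B \<subseteq> \<Union>H \<and> card (A \<union> B) = k \<and> rho (red A B H) \<le> y) brs ks"
    and "(\<Sum>(k, y)\<leftarrow>ks. (40/67) ^ k * y) \<le> rho H"
  shows "(\<Sum>(A, B)\<leftarrow>brs. pot (red A B H)) \<le> pot H"
proof -
  let ?X = "(67/40::real) ^ card (\<Union>H)"
  have "(\<Sum>(A, B)\<leftarrow>brs. pot (red A B H)) \<le> ?X * (\<Sum>(k, y)\<leftarrow>ks. (40/67) ^ k * y)"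
    using assms(2)
  proof (induction rule: list_all2_induct)
    case (Cons x xs y ys)
    then show ?case
      using pot_red[OF assms(1), of "fst x" "snd x" "fst y" "snd y"]
      by (auto simp: split_beta distrib_left)
  qed simp
  also have "\<dots> \<le> ?X * rho H"
    using assms(3) by (intro mult_left_mono) auto
  finally show ?thesis by (simp add: pot_def)
qed

lemma two_subset_red:
  assumes "T \<subseteq> two (red A B H)" "rank3 H" "card T = k"
  shows "rho (red A B H) \<le> weight k"
proof -
  have "finite (two (red A B H))"
    using rank3_red[OF assms(2)] by (auto simp: rank3_def two_def)
  then show ?thesis using assms card_mono rho_le_weight by metis
qed

section \<open>Pairs in residual families and private edges\<close>

lemma two_red_keep: "f \<in> two H \<Longrightarrow> f \<inter> A = {} \<Longrightarrow> f \<inter> B = {} \<Longrightarrow> f \<in> two (red A B H)"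
  by (auto simp: two_def intro!: in_red)

lemma finite_two: "rank3 H \<Longrightarrow> finite (two H)"
  by (auto simp: rank3_def two_def)

lemma finite_inc: "rank3 H \<Longrightarrow> finite (inc H v)"
  by (auto simp: rank3_def inc_def)

lemma two_iff: "f \<in> two H \<longleftrightarrow> (\<exists>a b. f = {a, b} \<and> E2 H a b)"
  by (auto simp: two_def E2_def card_2_iff)

lemma two_at_iff: "f \<in> two H \<and> a \<in> f \<longleftrightarrow> (\<exists>b. f = {a, b} \<and> E2 H a b)"
  by (auto simp: two_iff E2_def insert_commute)

lemma E2_sym: "E2 H a b \<longleftrightarrow> E2 H b a"
  by (auto simp: E2_def insert_commute)

lemma E2_two: "E2 H a b \<Longrightarrow> {a, b} \<in> two H"
  by (auto simp: two_iff)

lemma card_two_away: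
  assumes "rank3 H" "{f \<in> two H. a \<in> f} \<subseteq> D" "finite D" "card D \<le> d"
  shows "card (two H) - d \<le> card {f \<in> two H. a \<notin> f}"
proof -
  have "two H = {f \<in> two H. a \<in> f} \<union> {f \<in> two H. a \<notin> f}" by auto
  then have "card (two H) \<le> card {f \<in> two H. a \<in> f} + card {f \<in> two H. a \<notin> f}"
    by (metis card_Un_le)
  moreover have "card {f \<in> two H. a \<in> f} \<le> d"
    using assms card_mono le_trans by metis
  ultimately show ?thesis by linarith
qed

lemma rho_no_sing_two:
  assumes "\<And>v. {v} \<notin> H" "E2 H a b" "rank3 H"
  shows "rho H = weight (card (two H))" "0 < card (two H)"
proof -
  have "{a, b} \<in> two H" using assms by (auto simp: two_iff)
  then show "rho H = weight (card (two H))" using assms by (auto simp: rho_def)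
  show "0 < card (two H)" using \<open>{a, b} \<in> two H\<close> finite_two[OF assms(3)] card_gt_0_iff by blast
qed

text \<open>Take a private edge of \<open>a\<close>. If it is a triple {a, e, f}, then {e, f} is no
  edge, because \<open>S\<close> would miss it. If {a, e} or {a, f} is an edge, it is private too
  and replaces the triple; otherwise the triple is minimal.\<close>

lemma private_cases:
  assumes "rank3 H" "adm H S" "\<And>v. {v} \<notin> H" "a \<in> S" "a \<in> \<Union>H"
  shows "(\<exists>b. E2 H a b \<and> b \<notin> S) \<or> (\<exists>e f. P3 H a e f \<and> e \<notin> S \<and> f \<notin> S)"
proof -
  obtain g where g: "g \<in> H" "g \<inter> S = {a}"
    using assms(2,4,5) unfolding adm_def by (meson IntI)
  have hit: "\<And>h. h \<in> H \<Longrightarrow> h \<inter> S \<noteq> {}" using assms by (auto simp: adm_def)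
  have "g \<noteq> {}" "finite g" "card g \<le> 3" using assms g by (auto simp: rank3_def)
  then have "card g = 1 \<or> card g = 2 \<or> card g = 3"
    by (metis One_nat_def Suc_leI antisym card_gt_0_iff le_SucE numeral_2_eq_2 numeral_3_eq_3)
  moreover have "card g \<noteq> 1" using assms(3) g(1) by (metis card_1_singletonE)
  moreover have ?thesis if "card g = 2"
  proof -
    have "g \<in> two H \<and> a \<in> g" using that g by (auto simp: two_def)
    then obtain b where "g = {a, b}" "E2 H a b" using two_at_iff by metis
    then show ?thesis using g by (auto simp: E2_def)
  qed
  moreover have ?thesis if c3: "card g = 3"
  proof -
    obtain e f where ef: "g = {a, e, f}" "a \<noteq> e" "a \<noteq> f" "e \<noteq> f"
    proof -
      obtain x y z where "g = {x, y, z}" "x \<noteq> y" "x \<noteq> z" "y \<noteq> z"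
        using c3 by (auto simp: card_3_iff)
      moreover have "a \<in> g" using g by auto
      ultimately show ?thesis using that by (metis insert_commute insert_iff singletonD)
    qed
    have n: "e \<notin> S" "f \<notin> S" "a \<in> S" using g ef by auto
    have "{e, f} \<notin> H" using hit[of "{e, f}"] n by auto
    show ?thesis
    proof (cases "P3 H a e f")
      case False
      then have "E2 H a e \<or> E2 H a f"
        using \<open>{e, f} \<notin> H\<close> ef g(1) by (auto simp: P3_def E3_def E2_def)
      then show ?thesis using n by auto
    qed (use n in auto)
  qed
  ultimately show ?thesis by blast
qed

section \<open>Rules for families with an edge of size one or two\<close>

lemma sing_rule:
  assumes "rank3 H" "{a} \<in> H"
  shows "good H [({a}, {})]"
proof -
  have "(\<Sum>(A, B)\<leftarrow>[({a}, {})]. pot (red A B H)) \<le> pot H"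
    by (rule sum_pot_le[OF assms(1), where ks = "[(1, 1)]"])
       (use assms rho_le_1 rho_ge in auto)
  then show ?thesis using assms by (auto simp: good_def adm_def)
qed

text \<open>Discarding \<open>a\<close> forces its four neighbours, so the branches decide one and
  five vertices. Even with the trivial discount 1 in both, 1/x + 1/x^5 is about 0.6729, below the
  smallest weight 0.675.\<close>

lemma two_nbrs4_rule:
  assumes "rank3 H" "\<And>v. {v} \<notin> H" "E2 H a b" "E2 H a c" "E2 H a d" "E2 H a e"
    "distinct [b, c, d, e]"
  shows "good H [({a}, {}), ({b, c, d, e}, {a})]"
proof -
  have "rho H = weight (card (two H))" by (rule rho_no_sing_two) (use assms in auto)
  then have rho: "27/40 \<le> rho H" using weight_ge by auto
  have "(\<Sum>(A, B)\<leftarrow>[({a}, {}), ({b, c, d, e}, {a})]. pot (red A B H)) \<le> pot H"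
    by (rule sum_pot_le[OF assms(1), where ks = "[(1, 1), (5, 1)]"])
       (use assms rho_le_1 rho in \<open>auto simp: E2_def card_insert_if eval_nat_numeral\<close>)
  then show ?thesis using assms by (auto simp: good_def adm_def E2_def)
qed

text \<open>Since no vertex lies in four pairs, selecting \<open>a\<close> destroys exactly three,
  and the others keep earning a discount. The tightest case is three pairs in total, where 1/x +
  1/x^4 is about 0.7241 against \<open>weight 3\<close> = 0.725.\<close>

lemma two_nbrs3_rule:
  assumes H: "rank3 H" "\<And>v. {v} \<notin> H" and E: "E2 H a b" "E2 H a c" "E2 H a d"
    and dist: "distinct [b, c, d]"
    and max: "\<And>a b c d e. E2 H a b \<Longrightarrow> E2 H a c \<Longrightarrow> E2 H a d \<Longrightarrow> E2 H a e \<Longrightarrow> \<not> distinct [b, c, d, e]"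
  shows "good H [({a}, {}), ({b, c, d}, {a})]"
proof -
  let ?m = "card (two H)"
  have rho: "rho H = weight ?m" by (rule rho_no_sing_two) (use H E dist in auto)
  have "{f \<in> two H. a \<in> f} \<subseteq> {{a, b}, {a, c}, {a, d}}"
    using max[OF E] dist two_at_iff[of _ H a] by auto
  then have "?m - 3 \<le> card {f \<in> two H. a \<notin> f}"
    by (intro card_two_away[OF H(1)]) (auto simp: card_insert_if)
  moreover have "rho (red {a} {} H) \<le> weight (card {f \<in> two H. a \<notin> f})"
    by (rule two_subset_red[OF _ H(1) refl]) (auto intro: two_red_keep)
  ultimately have c1: "rho (red {a} {} H) \<le> weight (?m - 3)"
    using weight_antimono order_trans by blast
  have "{{a, b}, {a, c}, {a, d}} \<subseteq> two H" using E E2_two by auto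
  moreover have "card {{a, b}, {a, c}, {a, d}} = 3"
    using dist E by (auto simp: doubleton_eq_iff card_insert_if E2_def)
  ultimately have m: "3 \<le> ?m" using card_mono[OF finite_two[OF H(1)]] by metis
  have num: "(40/67) * weight (?m - 3) + (40/67)^4 \<le> weight ?m"
    using m by (auto simp: weight_def power_divide)
  have "(\<Sum>(A, B)\<leftarrow>[({a}, {}), ({b, c, d}, {a})]. pot (red A B H)) \<le> pot H"
    by (rule sum_pot_le[OF H(1), where ks = "[(1, weight (?m - 3)), (4, 1)]"])
       (use H E dist rho_le_1 rho c1 num in \<open>auto simp: E2_def card_insert_if\<close>)
  then show ?thesis using H E dist by (auto simp: good_def adm_def E2_def)
qed


lemma card_two_ge:
  assumes "rank3 H" "E2 H a b" "E2 H a c" "b \<noteq> c"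
  shows "2 \<le> card (two H)"
proof -
  have "card {{a, b}, {a, c}} \<le> card (two H)"
    using assms E2_two by (intro card_mono finite_two) auto
  then show ?thesis using assms by (auto simp: doubleton_eq_iff card_insert_if E2_def)
qed

lemma rho_red_away:
  assumes "rank3 H" "{f \<in> two H. a \<in> f} \<subseteq> D" "finite D" "card D \<le> d"
    and "\<And>f. f \<in> two H \<Longrightarrow> a \<notin> f \<Longrightarrow> f \<inter> A = {} \<and> f \<inter> B = {}"
  shows "rho (red A B H) \<le> weight (card (two H) - d)"
proof -
  have "rho (red A B H) \<le> weight (card {f \<in> two H. a \<notin> f})"
    by (rule two_subset_red[OF _ assms(1) refl]) (use assms(5) in \<open>auto intro: two_red_keep\<close>)
  also have "\<dots> \<le> weight (card (two H) - d)"
    by (rule weight_antimono, rule card_two_away) (use assms in auto)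
  finally show ?thesis .
qed

lemma P3_two_red:
  assumes "P3 H a e f" "e \<notin> A" "f \<notin> A" "a \<notin> A" "e \<notin> B" "f \<notin> B" "a \<in> B"
  shows "{e, f} \<in> two (red A B H)"
  using assms by (auto simp: two_def P3_def E3_def intro!: in_red[of "{a, e, f}"])

text \<open>Discarding \<open>a\<close> selects \<open>b\<close> and \<open>c\<close> and shrinks
  the triple at \<open>a\<close> to the pair {e, f}. This pair is not hit: a minimal triple at
  \<open>a\<close> contains neither \<open>b\<close> nor \<open>c\<close>, as it would otherwise
  contain a pair.\<close>

lemma path_P3_rule:
  assumes H: "rank3 H" "\<And>v. {v} \<notin> H" and E: "E2 H a b" "E2 H a c" "b \<noteq> c"
    and P: "P3 H a e f"
    and max: "\<And>a b c d. E2 H a b \<Longrightarrow> E2 H a c \<Longrightarrow> E2 H a d \<Longrightarrow> \<not> distinct [b, c, d]"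
  shows "good H [({a}, {}), ({b, c}, {a})]"
proof -
  let ?m = "card (two H)"
  have rho: "rho H = weight ?m" by (rule rho_no_sing_two) (use H E P in auto)
  have m: "2 \<le> ?m" using H(1) E by (rule card_two_ge)
  have "{f \<in> two H. a \<in> f} \<subseteq> {{a, b}, {a, c}}"
    using max[OF E(1,2)] E two_at_iff[of _ H a] by auto
  then have c1: "rho (red {a} {} H) \<le> weight (?m - 2)"
    by (rule rho_red_away[OF H(1)]) (auto simp: card_insert_if)
  have "{e, f} \<in> two (red {b, c} {a} H)"
    by (rule P3_two_red[OF P]) (use P E in \<open>auto simp: P3_def E3_def E2_def insert_commute\<close>)
  then have c2: "rho (red {b, c} {a} H) \<le> weight 1"
    by (intro two_subset_red[OF _ H(1), of "{{e, f}}"]) auto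
  \<comment> \<open>For two pairs the left side is about 0.7836, close to \<open>weight 2\<close> =
    0.785.\<close>
  have num: "(40/67) * weight (?m - 2) + (40/67)^3 * weight 1 \<le> weight ?m"
    using m by (auto simp: weight_def power_divide)
  have "(\<Sum>(A, B)\<leftarrow>[({a}, {}), ({b, c}, {a})]. pot (red A B H)) \<le> pot H"
    by (rule sum_pot_le[OF H(1), where ks = "[(1, weight (?m - 2)), (3, weight 1)]"])
       (use H E P rho c1 c2 num in \<open>auto simp: E2_def card_insert_if\<close>)
  then show ?thesis using H E P by (auto simp: good_def adm_def E2_def)
qed

text \<open>With no minimal triple at \<open>a\<close>, a selected \<open>a\<close> must have {a, b}
  or {a, c} as private edge. So \<open>a\<close>, \<open>b\<close> and \<open>c\<close> are never
  all selected, and the three branches exhaust the remaining possibilities.\<close>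

lemma path_rule:
  assumes H: "rank3 H" "\<And>v. {v} \<notin> H" and E: "E2 H a b" "E2 H a c" "b \<noteq> c"
    and max: "\<And>a b c d. E2 H a b \<Longrightarrow> E2 H a c \<Longrightarrow> E2 H a d \<Longrightarrow> \<not> distinct [b, c, d]"
    and noP: "\<And>a b c e f. E2 H a b \<Longrightarrow> E2 H a c \<Longrightarrow> b \<noteq> c \<Longrightarrow> \<not> P3 H a e f"
  shows "good H [({a}, {b}), ({a, b}, {c}), ({b, c}, {a})]"
proof -
  let ?m = "card (two H)" and ?brs = "[({a}, {b}), ({a, b}, {c}), ({b, c}, {a})]"
  have rho: "rho H = weight ?m" by (rule rho_no_sing_two) (use H E in auto)
  have m: "2 \<le> ?m" using H(1) E by (rule card_two_ge)
  have at_a: "{f \<in> two H. a \<in> f} \<subseteq> {{a, b}, {a, c}}"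
    using max[OF E(1,2)] E two_at_iff[of _ H a] by auto
  have adm: "\<exists>(A, B)\<in>set ?brs. A \<subseteq> S \<and> B \<inter> S = {}" if "adm H S" for S
  proof -
    have "a \<in> \<Union>H" using E by (auto simp: E2_def)
    then have "a \<notin> S \<or> b \<notin> S \<or> c \<notin> S"
      using private_cases[OF H(1) that H(2), of a] max[OF E(1,2)] noP[OF E] E(3) by auto
    moreover have "a \<in> S \<or> b \<in> S" "a \<in> S \<or> c \<in> S"
      using that E by (auto simp: adm_def E2_def)
    ultimately show ?thesis by auto
  qed
  have "(\<Sum>(A, B)\<leftarrow>?brs. pot (red A B H)) \<le> pot H"
  \<comment> \<open>A further pair {b, d} becomes the singleton {d} in the first branch, which
    improves its share from 1/x^2 to 1/x^3. Without one, the first branch loses only the two pairs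
    at \<open>a\<close>.\<close>
  proof (cases "\<exists>d. E2 H b d \<and> d \<noteq> a")
    case True
    then obtain d where d: "E2 H b d" "d \<noteq> a" by auto
    have "{d} \<in> red {a} {b} H"
      by (rule in_red[of "{b, d}"]) (use d E in \<open>auto simp: E2_def\<close>)
    then have c1: "rho (red {a} {b} H) \<le> 40/67" by (rule rho_sing)
    have "card {{a, b}, {a, c}, {b, d}} \<le> ?m"
      by (intro card_mono finite_two[OF H(1)]) (use E d E2_two in auto)
    moreover have "card {{a, b}, {a, c}, {b, d}} = 3"
      using d E by (auto simp: doubleton_eq_iff card_insert_if E2_def)
    ultimately have num: "3 * (40/67)^3 \<le> weight ?m"
      by (auto simp: weight_def power_divide)
    show ?thesis
      by (rule sum_pot_le[OF H(1), where ks = "[(2, 40/67), (3, 1), (3, 1)]"])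
         (use H E rho_le_1 rho c1 num in \<open>auto simp: E2_def card_insert_if power_divide\<close>)
  next
    case False
    have b: "b \<notin> f" if "f \<in> two H" "a \<notin> f" for f
      using that False two_at_iff[of f H b] by auto
    have c1: "rho (red {a} {b} H) \<le> weight (?m - 2)"
      by (rule rho_red_away[OF H(1) at_a]) (use b in \<open>auto simp: card_insert_if\<close>)
    \<comment> \<open>The same dichotomy at \<open>c\<close>. A singleton is better than any number
      of pairs, as 40/67 is below every weight.\<close>
    have c2: "rho (red {a, b} {c} H) \<le> weight (?m - 2)"
    proof (cases "\<exists>d. E2 H c d \<and> d \<noteq> a")
      case True
      then obtain d where d: "E2 H c d" "d \<noteq> a" by auto
      have "c \<noteq> a" using E(2) by (auto simp: E2_def)
      then have "d \<noteq> b" using d(1) False E2_sym by metis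
      then have "{d} \<in> red {a, b} {c} H"
        by (intro in_red[of "{c, d}"]) (use d E in \<open>auto simp: E2_def\<close>)
      then have "rho (red {a, b} {c} H) \<le> 40/67" by (rule rho_sing)
      then show ?thesis using weight_ge[of "?m - 2"] by linarith
    next
      case False
      have "c \<notin> f" if "f \<in> two H" "a \<notin> f" for f
        using that False two_at_iff[of f H c] by auto
      then show ?thesis
        by (intro rho_red_away[OF H(1) at_a]) (use b in \<open>auto simp: card_insert_if\<close>)
    qed
    have num: "(40/67)^2 * weight (?m - 2) + (40/67)^3 * weight (?m - 2) + (40/67)^3 \<le> weight ?m"
      using m by (auto simp: weight_def power_divide)
    show ?thesis
      by (rule sum_pot_le[OF H(1), where ks = "[(2, weight (?m - 2)), (3, weight (?m - 2)), (3, 1)]"])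
         (use H E rho_le_1 rho c1 c2 num in \<open>auto simp: E2_def card_insert_if\<close>)
  qed
  then show ?thesis using adm E by (auto simp: good_def E2_def)
qed

section \<open>Rules for pairs that form a matching\<close>

lemma matching_other_end:
  assumes E: "E2 H a b" and match: "\<And>a b c. E2 H a b \<Longrightarrow> E2 H a c \<Longrightarrow> b = c"
    and f: "f \<in> two H" "a \<notin> f"
  shows "b \<notin> f"
proof
  assume "b \<in> f"
  then obtain d where d: "f = {b, d}" "E2 H b d" using f two_at_iff by metis
  have "E2 H b a" using E E2_sym by metis
  then show False using match[OF d(2)] d(1) f(2) by auto
qed

lemma matching_away:
  assumes "rank3 H" "E2 H a b"
    and match: "\<And>a b c. E2 H a b \<Longrightarrow> E2 H a c \<Longrightarrow> b = c"
    and "A \<union> B \<subseteq> {a, b}"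
  shows "rho (red A B H) \<le> weight (card (two H) - 1)"
proof (rule rho_red_away[OF assms(1), where D = "{{a, b}}"])
  show "{f \<in> two H. a \<in> f} \<subseteq> {{a, b}}"
    using match[OF assms(2)] two_at_iff[of _ H a] by auto
  fix f assume f: "f \<in> two H" "a \<notin> f"
  have "b \<notin> f" by (rule matching_other_end[OF assms(2) match f])
  then show "f \<inter> A = {} \<and> f \<inter> B = {}" using f assms(4) by auto
qed auto

text \<open>Discarding \<open>a\<close> selects \<open>b\<close>, which loses the pair {a, b} but
  creates the pairs {e, f} and {e', f'}. Neither contains \<open>b\<close>, so both survive, and the
  number of pairs grows by one.\<close>

lemma matching_P3_P3_rule:
  assumes H: "rank3 H" "\<And>v. {v} \<notin> H" and E: "E2 H a b"
    and P: "P3 H a e f" "P3 H a e' f'" "{e, f} \<noteq> {e', f'}"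
    and match: "\<And>a b c. E2 H a b \<Longrightarrow> E2 H a c \<Longrightarrow> b = c"
  shows "good H [({a}, {}), ({b}, {a})]"
proof -
  let ?m = "card (two H)"
  have rho: "rho H = weight ?m" "0 < ?m" by (rule rho_no_sing_two; use H E P in auto)+
  have c1: "rho (red {a} {} H) \<le> weight (?m - 1)"
    by (rule matching_away[OF H(1) E match]) auto
  let ?T = "{f \<in> two H. a \<notin> f}"
  have b: "b \<notin> g" if "g \<in> ?T" for g
    by (rule matching_other_end[OF E match]) (use that in auto)
  \<comment> \<open>Residual families are sets, in which equal edges merge. The new pairs count only
    because minimality of the triples excludes them from the old family.\<close>
  have new: "{x, y} \<in> two (red {b} {a} H)" "{x, y} \<notin> ?T" if "P3 H a x y" for x y
  proof -
    show "{x, y} \<in> two (red {b} {a} H)"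
      by (rule P3_two_red[OF that]) (use that E in \<open>auto simp: P3_def E3_def E2_def insert_commute\<close>)
    show "{x, y} \<notin> ?T" using that by (auto simp: P3_def two_def)
  qed
  let ?U = "{{e, f}, {e', f'}} \<union> ?T"
  have "?m - 1 \<le> card ?T"
    by (rule card_two_away[OF H(1), where D = "{{a, b}}"])
       (use match[OF E] two_at_iff[of _ H a] in auto)
  moreover have "card ?U = 2 + card ?T"
    using new[OF P(1)] new[OF P(2)] P(3) finite_two[OF H(1)]
    by (subst card_Un_disjoint) (auto simp: card_insert_if)
  ultimately have "?m + 1 \<le> card ?U" by linarith
  then have "weight (card ?U) \<le> weight (?m + 1)" by (rule weight_antimono)
  moreover have "rho (red {b} {a} H) \<le> weight (card ?U)"
    by (rule two_subset_red[OF _ H(1) refl])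
       (use new[OF P(1)] new[OF P(2)] b in \<open>auto intro!: two_red_keep\<close>)
  ultimately have c2: "rho (red {b} {a} H) \<le> weight (?m + 1)" by (rule order_trans[rotated])
  \<comment> \<open>For one pair this is 1/x + 0.785/x^2, about 0.8768, a constraint that
    \<open>weight 1\<close> = 0.877 just meets.\<close>
  have num: "(40/67) * weight (?m - 1) + (40/67)^2 * weight (?m + 1) \<le> weight ?m"
    using rho(2) by (auto simp: weight_def power_divide)
  have "(\<Sum>(A, B)\<leftarrow>[({a}, {}), ({b}, {a})]. pot (red A B H)) \<le> pot H"
    by (rule sum_pot_le[OF H(1), where ks = "[(1, weight (?m - 1)), (2, weight (?m + 1))]"])
       (use H E P rho c1 c2 num in \<open>auto simp: E2_def card_insert_if\<close>)
  then show ?thesis using H E P by (auto simp: good_def adm_def E2_def)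
qed

text \<open>The private edge of a selected \<open>a\<close> is {a, b} or the only minimal triple {a,
  e, f}. If \<open>b\<close> is selected as well, it must be the triple, so \<open>e\<close> and
  \<open>f\<close> are discarded and the branch decides four vertices at once.\<close>

lemma matching_P3_rule:
  assumes H: "rank3 H" "\<And>v. {v} \<notin> H" and E: "E2 H a b"
    and P: "P3 H a e f"
    and match: "\<And>a b c. E2 H a b \<Longrightarrow> E2 H a c \<Longrightarrow> b = c"
    and uniq: "\<And>a b e f e' f'. E2 H a b \<Longrightarrow> P3 H a e f \<Longrightarrow> P3 H a e' f' \<Longrightarrow> {e, f} = {e', f'}"
  shows "good H [({a}, {b}), ({a, b}, {e, f}), ({b}, {a})]"
proof -
  let ?m = "card (two H)" and ?brs = "[({a}, {b}), ({a, b}, {e, f}), ({b}, {a})]"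
  have rho: "rho H = weight ?m" "0 < ?m" by (rule rho_no_sing_two; use H E P in auto)+
  have c1: "rho (red {a} {b} H) \<le> weight (?m - 1)" "rho (red {b} {a} H) \<le> weight (?m - 1)"
    by (rule matching_away[OF H(1) E match]; auto)+
  have d: "e \<noteq> b" "f \<noteq> b" using P E by (auto simp: P3_def E3_def E2_def)
  have sub: "e \<in> \<Union>H" "f \<in> \<Union>H" "a \<in> \<Union>H" "b \<in> \<Union>H"
    using P E unfolding P3_def E3_def E2_def by blast+
  have "a \<noteq> b" "e \<noteq> f" "a \<noteq> e" "a \<noteq> f" using P E by (auto simp: P3_def E3_def E2_def)
  note d = d this
  have num: "2 * (40/67)^2 * weight (?m - 1) + (40/67)^4 \<le> weight ?m"
    using rho(2) by (auto simp: weight_def power_divide)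
  have adm: "\<exists>(A, B)\<in>set ?brs. A \<subseteq> S \<and> B \<inter> S = {}" if S: "adm H S" for S
  proof -
    have "a \<in> \<Union>H" using E by (auto simp: E2_def)
    have "b \<notin> S \<or> (e \<notin> S \<and> f \<notin> S)" if aS: "a \<in> S"
    proof -
      consider x where "E2 H a x" "x \<notin> S" | x y where "P3 H a x y" "x \<notin> S" "y \<notin> S"
        using private_cases[OF H(1) S H(2) aS \<open>a \<in> \<Union>H\<close>] by blast
      then show ?thesis
      proof cases
        case 1
        then show ?thesis using match[OF E] by blast
      next
        case 2
        then have "{e, f} = {x, y}" using uniq[OF E P] by blast
        then show ?thesis using 2 by (auto simp: doubleton_eq_iff)
      qed
    qed
    moreover have "a \<in> S \<or> b \<in> S"
      using S E by (auto simp: adm_def E2_def)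
    ultimately show ?thesis by auto
  qed
  have "(\<Sum>(A, B)\<leftarrow>?brs. pot (red A B H)) \<le> pot H"
    by (rule sum_pot_le[OF H(1), where ks = "[(2, weight (?m - 1)), (4, 1), (2, weight (?m - 1))]"])
       (use sub d rho_le_1 rho c1 num in \<open>auto simp: card_insert_if algebra_simps simp del: Union_iff\<close>)
  then show ?thesis using adm sub d by (simp add: good_def del: Union_iff)
qed

text \<open>With no minimal triple at \<open>a\<close>, the only available private edge of a
  selected \<open>a\<close> is {a, b}. So exactly one end of the pair is selected.\<close>

lemma matching_rule:
  assumes H: "rank3 H" "\<And>v. {v} \<notin> H" and E: "E2 H a b"
    and match: "\<And>a b c. E2 H a b \<Longrightarrow> E2 H a c \<Longrightarrow> b = c"
    and noP: "\<And>a b e f. E2 H a b \<Longrightarrow> \<not> P3 H a e f"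
  shows "good H [({a}, {b}), ({b}, {a})]"
proof -
  let ?m = "card (two H)" and ?brs = "[({a}, {b}), ({b}, {a})]"
  have rho: "rho H = weight ?m" "0 < ?m" by (rule rho_no_sing_two; use H E in auto)+
  have c1: "rho (red {a} {b} H) \<le> weight (?m - 1)" "rho (red {b} {a} H) \<le> weight (?m - 1)"
    by (rule matching_away[OF H(1) E match]; auto)+
  have num: "2 * (40/67)^2 * weight (?m - 1) \<le> weight ?m"
    using rho(2) by (auto simp: weight_def power_divide)
  have adm: "\<exists>(A, B)\<in>set ?brs. A \<subseteq> S \<and> B \<inter> S = {}" if S: "adm H S" for S
  proof -
    have "a \<in> \<Union>H" using E by (auto simp: E2_def)
    then have "b \<notin> S" if "a \<in> S"
      using private_cases[OF H(1) S H(2) that] match[OF E] noP[OF E] by blast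
    moreover have "a \<in> S \<or> b \<in> S"
      using S E by (auto simp: adm_def E2_def)
    ultimately show ?thesis by auto
  qed
  have "(\<Sum>(A, B)\<leftarrow>?brs. pot (red A B H)) \<le> pot H"
    by (rule sum_pot_le[OF H(1), where ks = "[(2, weight (?m - 1)), (2, weight (?m - 1))]"])
       (use H E rho c1 num in \<open>auto simp: E2_def card_insert_if algebra_simps\<close>)
  then show ?thesis using adm E by (auto simp: good_def E2_def)
qed

section \<open>Rules for 3-uniform families\<close>

definition D3 :: "'a set set \<Rightarrow> 'a \<Rightarrow> bool" where
  "D3 H v \<longleftrightarrow> (\<exists>a b c d e f. E3 H v a b \<and> E3 H v c d \<and> E3 H v e f \<and>
     distinct [{a, b}, {c, d}, {e, f}])"

lemma distinct3: "x \<noteq> y \<Longrightarrow> x \<noteq> z \<Longrightarrow> y \<noteq> z \<Longrightarrow> distinct [x, y, z]"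
  by simp

lemma card_distinct3: "distinct [x, y, z] \<Longrightarrow> card {x, y, z} = 3"
  by (metis distinct_card length_Cons list.set(1,2) list.size(3) numeral_3_eq_3)

lemma card_distinct4: "distinct [x, y, z, w] \<Longrightarrow> card {x, y, z, w} = 4"
  by (simp add: card_insert_if)

lemma uniform3:
  assumes "rank3 H" "\<And>v. {v} \<notin> H" "\<And>a b. \<not> E2 H a b" "f \<in> H"
  shows "card f = 3"
proof -
  have "f \<noteq> {}" "finite f" "card f \<le> 3" using assms by (auto simp: rank3_def)
  then have "card f = 1 \<or> card f = 2 \<or> card f = 3"
    by (metis One_nat_def Suc_leI antisym card_gt_0_iff le_SucE numeral_2_eq_2 numeral_3_eq_3)
  moreover have "card f \<noteq> 1" using assms by (metis card_1_singletonE)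
  moreover have "card f \<noteq> 2" using assms by (auto simp: card_2_iff E2_def)
  ultimately show ?thesis by blast
qed

lemma in_inc_iff:
  assumes "rank3 H" "\<And>v. {v} \<notin> H" "\<And>a b. \<not> E2 H a b"
  shows "g \<in> inc H v \<longleftrightarrow> (\<exists>x y. g = {v, x, y} \<and> E3 H v x y)"
proof
  assume g: "g \<in> inc H v"
  then have "card g = 3" using uniform3[OF assms] by (auto simp: inc_def)
  then obtain x y z where "g = {x, y, z}" "x \<noteq> y" "x \<noteq> z" "y \<noteq> z"
    by (auto simp: card_3_iff)
  moreover have "v \<in> g" "g \<in> H" using g by (auto simp: inc_def)
  ultimately show "\<exists>x y. g = {v, x, y} \<and> E3 H v x y"
    unfolding E3_def by (metis insert_commute insert_iff singletonD)
qed (auto simp: inc_def E3_def)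

lemma E3_Union: "E3 H v a b \<Longrightarrow> v \<in> \<Union>H \<and> a \<in> \<Union>H \<and> b \<in> \<Union>H"
  unfolding E3_def by blast

lemma E3_neq: "E3 H v a b \<Longrightarrow> v \<noteq> a \<and> v \<noteq> b \<and> a \<noteq> b"
  by (simp add: E3_def)

lemma pair_triple_eq:
  assumes "E3 H v a b" "E3 H v c d"
  shows "{v, a, b} = {v, c, d} \<longleftrightarrow> {a, b} = {c, d}"
  using assms unfolding E3_def by (metis insert_ident insertE singletonD)

text \<open>In a 3-uniform family an edge at \<open>v\<close> is determined by its other two
  vertices. This links the cardinality in \<open>low\<close> to the first-order condition
  \<open>D3\<close>, which the program can evaluate by looping over vertices.\<close>

lemma card_inc_D3:
  assumes "rank3 H" "\<And>v. {v} \<notin> H" "\<And>a b. \<not> E2 H a b"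
  shows "card (inc H v) \<le> 2 \<longleftrightarrow> \<not> D3 H v"
proof
  assume c: "card (inc H v) \<le> 2"
  show "\<not> D3 H v"
  proof
    assume "D3 H v"
    then obtain a b c d e f where E: "E3 H v a b" "E3 H v c d" "E3 H v e f"
      and dist: "distinct [{a, b}, {c, d}, {e, f}]"
      unfolding D3_def by (elim exE conjE) (rule that)
    then have "card {{v, a, b}, {v, c, d}, {v, e, f}} = 3"
      unfolding pair_triple_eq[OF E(1,2), symmetric] pair_triple_eq[OF E(1,3), symmetric]
        pair_triple_eq[OF E(2,3), symmetric] distinct.simps list.set insert_iff empty_iff
      by (intro card_3_iff[THEN iffD2] exI conjI) blast+
    moreover have "{{v, a, b}, {v, c, d}, {v, e, f}} \<subseteq> inc H v"
      using E unfolding E3_def inc_def by blast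
    then have "card {{v, a, b}, {v, c, d}, {v, e, f}} \<le> card (inc H v)"
      by (rule card_mono[OF finite_inc[OF assms(1)]])
    ultimately show False using c by linarith
  qed
next
  assume D: "\<not> D3 H v"
  show "card (inc H v) \<le> 2"
  proof (rule ccontr)
    assume "\<not> ?thesis"
    then have "3 \<le> card (inc H v)" by simp
    then obtain T where T: "T \<subseteq> inc H v" "card T = 3" by (rule obtain_subset_with_card_n)
    then obtain x y z where xyz: "T = {x, y, z}" "x \<noteq> y" "x \<noteq> z" "y \<noteq> z" by (auto simp: card_3_iff)
    then have "x \<in> inc H v" "y \<in> inc H v" "z \<in> inc H v" using T by auto
    obtain a b where x: "x = {v, a, b}" "E3 H v a b"
      using in_inc_iff[OF assms, of x v] \<open>x \<in> inc H v\<close> by blast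
    obtain c d where y: "y = {v, c, d}" "E3 H v c d"
      using in_inc_iff[OF assms, of y v] \<open>y \<in> inc H v\<close> by blast
    obtain e f where z: "z = {v, e, f}" "E3 H v e f"
      using in_inc_iff[OF assms, of z v] \<open>z \<in> inc H v\<close> by blast
    have "distinct [{a, b}, {c, d}, {e, f}]" using xyz(2-4) unfolding x(1) y(1) z(1) by (intro distinct3) metis+
    then show False using D x(2) y(2) z(2) unfolding D3_def by metis
  qed
qed

lemma no_two_empty: "(\<And>a b. \<not> E2 H a b) \<Longrightarrow> two H = {}"
  by (auto simp: two_iff)

lemma rho_low:
  assumes "rank3 H" "\<And>v. {v} \<notin> H" "\<And>a b. \<not> E2 H a b" "E3 H v a b" "\<not> D3 H v"
  shows "rho H = 19/20"
proof -
  have "v \<in> \<Union>H" using assms by (auto simp: E3_def)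
  then have "low H" using card_inc_D3[OF assms(1-3)] assms(5) by (auto simp: low_def)
  then show ?thesis using assms no_two_empty[OF assms(3)] by (auto simp: rho_def)
qed

lemma private_cases3:
  assumes "rank3 H" "adm H S" "\<And>v. {v} \<notin> H" "\<And>a b. \<not> E2 H a b" "E3 H v a b" "v \<in> S"
  shows "\<exists>e f. E3 H v e f \<and> e \<notin> S \<and> f \<notin> S"
  using private_cases[OF assms(1-3,6)] assms(4,5) by (auto simp: P3_def E3_def)

lemma E3_two_red:
  "E3 H v a b \<Longrightarrow> {a, b} \<in> two (red {} {v} H)"
  by (auto simp: two_def E3_def intro!: in_red[of "{v, a, b}"])

text \<open>One of the two triples is private to a selected \<open>v\<close>. The first branch takes
  the sets that avoid \<open>a\<close> and \<open>b\<close>. The next two take the sets that avoid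
  \<open>c\<close> and \<open>d\<close> but contain \<open>a\<close>, or contain \<open>b\<close>
  and not \<open>a\<close>. Discarding \<open>v\<close> leaves two pairs.\<close>

lemma degree2_disjoint_rule:
  assumes H: "rank3 H" "\<And>v. {v} \<notin> H" "\<And>a b. \<not> E2 H a b"
    and E: "E3 H v a b" "E3 H v c d" "distinct [a, b, c, d]" and deg: "\<not> D3 H v"
  shows "good H [({v}, {a, b}), ({v, a}, {c, d}), ({v, b}, {a, c, d}), ({}, {v})]"
proof -
  let ?brs = "[({v}, {a, b}), ({v, a}, {c, d}), ({v, b}, {a, c, d}), ({}, {v})]"
  have rho: "rho H = 19/20" using rho_low[OF H E(1) deg] .
  have sub: "v \<in> \<Union>H" "a \<in> \<Union>H" "b \<in> \<Union>H" "c \<in> \<Union>H" "d \<in> \<Union>H"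
    "v \<noteq> a" "v \<noteq> b" "v \<noteq> c" "v \<noteq> d" "distinct [a, b, c, d]"
    using E(1,2)[THEN E3_Union] E(1,2)[THEN E3_neq] E(3) by blast+
  have D: "{e, f} = {a, b} \<or> {e, f} = {c, d}" if "E3 H v e f" for e f
  proof (rule ccontr)
    assume *: "\<not> ?thesis"
    have "{a, b} \<noteq> {c, d}" using E(3) by (auto simp: doubleton_eq_iff)
    then have "distinct [{a, b}, {c, d}, {e, f}]" using * by (intro distinct3) metis+
    then show False using deg E(1,2) that unfolding D3_def by metis
  qed
  have adm: "\<exists>(A, B)\<in>set ?brs. A \<subseteq> S \<and> B \<inter> S = {}" if S: "adm H S" for S
  proof (cases "v \<in> S")
    case True
    then obtain e f where evf: "E3 H v e f" and ef: "e \<notin> S" "f \<notin> S"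
      using private_cases3[OF H(1) S H(2,3) E(1)] by blast
    have "{e, f} = {a, b} \<or> {e, f} = {c, d}" by (rule D[OF evf])
    then have "a \<notin> S \<and> b \<notin> S \<or> c \<notin> S \<and> d \<notin> S" using ef by (auto simp: doubleton_eq_iff)
    then show ?thesis using True by auto
  qed auto
  have "rho (red {} {v} H) \<le> weight 2"
    by (rule two_subset_red[OF _ H(1), of "{{a, b}, {c, d}}"])
       (use E3_two_red[OF E(1)] E3_two_red[OF E(2)] E(3) in \<open>auto simp: doubleton_eq_iff card_insert_if\<close>)
  then have "(\<Sum>(A, B)\<leftarrow>?brs. pot (red A B H)) \<le> pot H"
    by (intro sum_pot_le[OF H(1), where ks = "[(3, 1), (4, 1), (5, 1), (1, weight 2)]"])
       (use sub rho rho_le_1 in \<open>auto simp: card_insert_if weight_def power_divide simp del: Union_iff\<close>)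
  then show ?thesis using adm sub by (auto simp: good_def simp del: Union_iff)
qed

text \<open>Both triples contain \<open>a\<close>, so a selected \<open>v\<close> always excludes
  \<open>a\<close>. The only question left is which of \<open>b\<close> and \<open>d\<close> is
  excluded too.\<close>

lemma degree2_overlap_rule:
  assumes H: "rank3 H" "\<And>v. {v} \<notin> H" "\<And>a b. \<not> E2 H a b"
    and E: "E3 H v a b" "E3 H v a d" "b \<noteq> d" and deg: "\<not> D3 H v"
  shows "good H [({v}, {a, b}), ({v, b}, {a, d}), ({}, {v})]"
proof -
  let ?brs = "[({v}, {a, b}), ({v, b}, {a, d}), ({}, {v})]"
  have rho: "rho H = 19/20" using rho_low[OF H E(1) deg] .
  have sub: "v \<in> \<Union>H" "a \<in> \<Union>H" "b \<in> \<Union>H" "d \<in> \<Union>H"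
    "v \<noteq> a" "v \<noteq> b" "v \<noteq> d" "a \<noteq> b" "a \<noteq> d" "b \<noteq> d"
    using E(1,2)[THEN E3_Union] E(1,2)[THEN E3_neq] E(3) by blast+
  have D: "{e, f} = {a, b} \<or> {e, f} = {a, d}" if "E3 H v e f" for e f
  proof (rule ccontr)
    assume *: "\<not> ?thesis"
    have "{a, b} \<noteq> {a, d}" using E(3) by (auto simp: doubleton_eq_iff)
    then have "distinct [{a, b}, {a, d}, {e, f}]" using * by (intro distinct3) metis+
    then show False using deg E(1,2) that unfolding D3_def by metis
  qed
  have adm: "\<exists>(A, B)\<in>set ?brs. A \<subseteq> S \<and> B \<inter> S = {}" if S: "adm H S" for S
  proof (cases "v \<in> S")
    case True
    then obtain e f where evf: "E3 H v e f" and ef: "e \<notin> S" "f \<notin> S"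
      using private_cases3[OF H(1) S H(2,3) E(1)] by blast
    have "{e, f} = {a, b} \<or> {e, f} = {a, d}" by (rule D[OF evf])
    then have "a \<notin> S \<and> b \<notin> S \<or> a \<notin> S \<and> d \<notin> S" using ef by (auto simp: doubleton_eq_iff)
    then show ?thesis using True by auto
  qed auto
  have "rho (red {} {v} H) \<le> weight 2"
    by (rule two_subset_red[OF _ H(1), of "{{a, b}, {a, d}}"])
       (use E3_two_red[OF E(1)] E3_two_red[OF E(2)] E(3) in \<open>auto simp: doubleton_eq_iff card_insert_if\<close>)
  then have "(\<Sum>(A, B)\<leftarrow>?brs. pot (red A B H)) \<le> pot H"
    by (intro sum_pot_le[OF H(1), where ks = "[(3, 1), (4, 1), (1, weight 2)]"])
       (use sub rho rho_le_1 in \<open>auto simp: card_insert_if weight_def power_divide simp del: Union_iff\<close>)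
  then show ?thesis using adm sub by (auto simp: good_def simp del: Union_iff)
qed

text \<open>A second triple at \<open>v\<close> would complete \<open>v\<close> by a pair that is
  disjoint from {a, b} or shares one vertex with it. Both are excluded, so {v, a, b} is the only
  edge at \<open>v\<close>, and it is private whenever \<open>v\<close> is selected.\<close>

lemma degree1_rule:
  assumes H: "rank3 H" "\<And>v. {v} \<notin> H" "\<And>a b. \<not> E2 H a b"
    and E: "E3 H v a b" and deg: "\<not> D3 H v"
    and no_disj: "\<And>a b c d. E3 H v a b \<Longrightarrow> E3 H v c d \<Longrightarrow> \<not> distinct [a, b, c, d]"
    and no_overlap: "\<And>a b d. E3 H v a b \<Longrightarrow> E3 H v a d \<Longrightarrow> b = d"
  shows "good H [({v}, {a, b}), ({}, {v})]"
proof -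
  let ?brs = "[({v}, {a, b}), ({}, {v})]"
  have rho: "rho H = 19/20" using rho_low[OF H E(1) deg] .
  have sub: "v \<in> \<Union>H" "a \<in> \<Union>H" "b \<in> \<Union>H" "v \<noteq> a" "v \<noteq> b" "a \<noteq> b"
    using E3_Union[OF E(1)] E3_neq[OF E(1)] by blast+
  have sym: "E3 H v x y \<Longrightarrow> E3 H v y x" for x y by (auto simp: E3_def insert_commute)
  have D: "{e, f} = {a, b}" if e: "E3 H v e f" for e f
  proof -
    have "a \<noteq> b" "e \<noteq> f" using E e by (auto simp: E3_def)
    then have "a = e \<or> a = f \<or> b = e \<or> b = f" using no_disj[OF E e] by auto
    then show ?thesis
      using no_overlap E e sym by (metis doubleton_eq_iff)
  qed
  have adm: "\<exists>(A, B)\<in>set ?brs. A \<subseteq> S \<and> B \<inter> S = {}" if S: "adm H S" for S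
  proof (cases "v \<in> S")
    case True
    then obtain e f where evf: "E3 H v e f" and ef: "e \<notin> S" "f \<notin> S"
      using private_cases3[OF H(1) S H(2,3) E(1)] by blast
    have "{e, f} = {a, b}" by (rule D[OF evf])
    then have "a \<notin> S \<and> b \<notin> S" using ef by (auto simp: doubleton_eq_iff)
    then show ?thesis using True by auto
  qed auto
  have "rho (red {} {v} H) \<le> weight 1"
    by (rule two_subset_red[OF _ H(1), of "{{a, b}}"])
       (use E3_two_red[OF E(1)] in auto)
  then have "(\<Sum>(A, B)\<leftarrow>?brs. pot (red A B H)) \<le> pot H"
    by (intro sum_pot_le[OF H(1), where ks = "[(3, 1), (1, weight 1)]"])
       (use sub rho rho_le_1 in \<open>auto simp: card_insert_if weight_def power_divide simp del: Union_iff\<close>)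
  then show ?thesis using adm sub by (auto simp: good_def simp del: Union_iff)
qed

lemma rho_not_low:
  assumes "rank3 H" "\<And>v. {v} \<notin> H" "\<And>a b. \<not> E2 H a b" "\<And>v a b. E3 H v a b \<Longrightarrow> D3 H v"
  shows "rho H = 1"
proof -
  have "\<not> low H"
  proof
    assume "low H"
    then obtain v g where "v \<in> g" "g \<in> H" and c: "card (inc H v) \<le> 2" by (auto simp: low_def)
    then have "g \<in> inc H v" by (auto simp: inc_def)
    then obtain a b where "E3 H v a b" using in_inc_iff[OF assms(1-3)] by blast
    then show False using c assms(4) card_inc_D3[OF assms(1-3)] by blast
  qed
  then show ?thesis using assms no_two_empty[OF assms(3)] by (auto simp: rho_def weight_def)
qed

lemma degree4_rule:
  assumes H: "rank3 H" "\<And>v. {v} \<notin> H" "\<And>a b. \<not> E2 H a b" "\<And>v a b. E3 H v a b \<Longrightarrow> D3 H v"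
    and E: "E3 H v a1 b1" "E3 H v a2 b2" "E3 H v a3 b3" "E3 H v a4 b4"
      "distinct [{a1, b1}, {a2, b2}, {a3, b3}, {a4, b4}]"
  shows "good H [({v}, {}), ({}, {v})]"
proof -
  let ?brs = "[({v}, {}), ({}, {v})]"
  have rho: "rho H = 1" using rho_not_low[OF H] .
  have "card {{a1, b1}, {a2, b2}, {a3, b3}, {a4, b4}} = 4" using E(5) by (rule card_distinct4)
  then have "rho (red {} {v} H) \<le> weight 4"
    by (intro two_subset_red[OF _ H(1)]) (use E(1-4)[THEN E3_two_red] in auto)
  then have "(\<Sum>(A, B)\<leftarrow>?brs. pot (red A B H)) \<le> pot H"
    by (intro sum_pot_le[OF H(1), where ks = "[(1, 1), (1, weight 4)]"])
       (use E(1) rho rho_le_1 in \<open>auto simp: E3_def weight_def\<close>)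
  then show ?thesis using E(1) by (auto simp: good_def E3_def)
qed

text \<open>Every vertex has exactly three triples here. Selecting \<open>v\<close> hits {v, a, b},
  so \<open>a\<close> keeps at most two triples and the family earns the discount 19/20. If
  \<open>a\<close> vanishes altogether, a whole factor 1/x is saved, which is better still.\<close>

lemma degree3_rule:
  assumes H: "rank3 H" "\<And>v. {v} \<notin> H" "\<And>a b. \<not> E2 H a b" "\<And>v a b. E3 H v a b \<Longrightarrow> D3 H v"
    and max: "\<And>v a1 b1 a2 b2 a3 b3 a4 b4. E3 H v a1 b1 \<Longrightarrow> E3 H v a2 b2 \<Longrightarrow> E3 H v a3 b3 \<Longrightarrow>
      E3 H v a4 b4 \<Longrightarrow> \<not> distinct [{a1, b1}, {a2, b2}, {a3, b3}, {a4, b4}]"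
    and E: "E3 H v a b"
  shows "good H [({v}, {}), ({}, {v})]"
proof -
  let ?brs = "[({v}, {}), ({}, {v})]" and ?R = "red {v} {} H" and ?X = "(67/40::real) ^ card (\<Union>H)"
  have rho: "rho H = 1" using rho_not_low[OF H] .
  obtain a1 b1 a2 b2 a3 b3 where D: "E3 H v a1 b1" "E3 H v a2 b2" "E3 H v a3 b3"
    "distinct [{a1, b1}, {a2, b2}, {a3, b3}]"
    using H(4)[OF E] unfolding D3_def by (elim exE conjE) (rule that)
  have "card {{a1, b1}, {a2, b2}, {a3, b3}} = 3" using D(4) by (rule card_distinct3)
  then have "rho (red {} {v} H) \<le> weight 3"
    by (intro two_subset_red[OF _ H(1)]) (use D(1-3)[THEN E3_two_red] in auto)
  then have out: "pot (red {} {v} H) \<le> ?X * ((40/67)^1 * weight 3)"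
    by (intro pot_red[OF H(1)]) (use E in \<open>auto simp: E3_def\<close>)
  \<comment> \<open>Selecting a vertex only deletes edges and shrinks none, so the family stays
    3-uniform.\<close>
  have R: "?R \<subseteq> H" by (auto simp: red_def)
  have R_rank: "rank3 ?R" using H(1) by (rule rank3_red)
  have incv: "a \<in> \<Union>H" "a \<noteq> v" "v \<in> \<Union>H" "{v, a, b} \<in> inc H a"
    using E E3_Union[OF E] by (auto simp: E3_def inc_def)
  have "pot ?R \<le> ?X * ((40/67)^1 * (19/20))"
  proof (cases "a \<in> \<Union>?R")
    case True
    have "card (inc H a) \<le> 3"
    proof (rule ccontr)
      assume "\<not> ?thesis"
      then have "4 \<le> card (inc H a)" by simp
      then obtain T where T: "T \<subseteq> inc H a" "card T = 4" by (rule obtain_subset_with_card_n)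
      then obtain w T' where "T = insert w T'" "w \<notin> T'" "card T' = 3"
        by (metis card_Suc_eq eval_nat_numeral(2) semiring_norm(26,27))
      then obtain w x y z where xyz: "T = {w, x, y, z}" "distinct [w, x, y, z]"
        by (auto simp: card_3_iff)
      then have inc: "w \<in> inc H a" "x \<in> inc H a" "y \<in> inc H a" "z \<in> inc H a" using T by auto
      obtain a1 b1 where w: "w = {a, a1, b1}" "E3 H a a1 b1"
        using in_inc_iff[OF H(1-3), of w a] inc(1) by blast
      obtain a2 b2 where x: "x = {a, a2, b2}" "E3 H a a2 b2"
        using in_inc_iff[OF H(1-3), of x a] inc(2) by blast
      obtain a3 b3 where y: "y = {a, a3, b3}" "E3 H a a3 b3"
        using in_inc_iff[OF H(1-3), of y a] inc(3) by blast
      obtain a4 b4 where z: "z = {a, a4, b4}" "E3 H a a4 b4"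
        using in_inc_iff[OF H(1-3), of z a] inc(4) by blast
      have "distinct [{a1, b1}, {a2, b2}, {a3, b3}, {a4, b4}]"
        using xyz(2) unfolding w(1) x(1) y(1) z(1) distinct.simps list.set insert_iff empty_iff
        by (intro conjI notI) metis+
      then show False using max[OF w(2) x(2) y(2) z(2)] by blast
    qed
    moreover have "inc ?R a \<subseteq> inc H a - {{v, a, b}}" by (auto simp: inc_def red_def)
    then have "card (inc ?R a) \<le> card (inc H a) - 1"
      using incv(4) finite_inc[OF H(1), of a] by (metis card_Diff_singleton card_mono finite_Diff)
    ultimately have "low ?R" using True unfolding low_def by force
    moreover have "two ?R = {}" using no_two_empty[OF H(3)] R by (auto simp: two_def)
    ultimately have "rho ?R \<le> 19/20" using H(2) R by (auto simp: rho_def)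
    then show ?thesis
      by (intro pot_red[OF H(1)]) (use incv in auto)
  next
    case False
    have fin: "finite (\<Union>H)" using H(1) by (rule finite_Union_rank3)
    have "\<Union>?R \<subseteq> \<Union>H - {v, a}" using False Union_red[of "{v}" "{}" H] by auto
    then have "card (\<Union>?R) \<le> card (\<Union>H - {v, a})" using fin by (intro card_mono) auto
    also have "\<dots> = card (\<Union>H) - 2" using incv fin by (subst card_Diff_subset) (auto simp: card_insert_if)
    finally have "(67/40::real) ^ card (\<Union>?R) \<le> (67/40) ^ (card (\<Union>H) - 2)"
      by (intro power_increasing) auto
    moreover have "2 \<le> card (\<Union>H)"
      using incv fin card_mono[OF fin, of "{v, a}"] by (auto simp: card_insert_if)
    then have "(67/40::real) ^ (card (\<Union>H) - 2) = ?X * (40/67)^2"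
      by (simp add: power_diff field_simps power_divide)
    ultimately have "(67/40::real) ^ card (\<Union>?R) \<le> ?X * (40/67)^2" by simp
    then have "(67/40::real) ^ card (\<Union>?R) * rho ?R \<le> (?X * (40/67)^2) * 1"
      using rho_le_1 rho_ge[of ?R] by (intro mult_mono) auto
    also have "\<dots> \<le> ?X * ((40/67)^1 * (19/20))"
      unfolding mult.assoc by (intro mult_left_mono) (auto simp: power2_eq_square)
    finally show ?thesis by (simp add: pot_def)
  qed
  with out have "pot ?R + pot (red {} {v} H) \<le> ?X * ((40/67)^1 * (19/20) + (40/67)^1 * weight 3)"
    by (simp add: distrib_left)
  also have "\<dots> = pot H" using rho by (simp add: pot_def weight_def)
  finally show ?thesis using E by (auto simp: good_def E3_def)
qed

section \<open>A structured language for the RAM\<close>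

datatype com = Skip | Ins instr | Seq com com (infixr ";;" 60) | If nat com com | While nat com

fun jump_free :: "instr \<Rightarrow> bool" where
  "jump_free (Jz _ _) = False"
| "jump_free _ = True"

fun clen :: "com \<Rightarrow> nat" where
  "clen Skip = 0"
| "clen (Ins i) = 1"
| "clen (a ;; b) = clen a + clen b"
| "clen (If r a b) = clen a + clen b + 3"
| "clen (While r a) = clen a + 3"

text \<open>The machine has no unconditional jump, so one is built by clearing register 2 and
  testing it. No data may stay in register 2 across an \<open>If\<close> or \<open>While\<close>.
  Jump targets are absolute, whence the start address \<open>l\<close>.\<close>

fun compile :: "nat \<Rightarrow> com \<Rightarrow> instr list" where
  "compile l Skip = []"
| "compile l (Ins i) = [i]"
| "compile l (a ;; b) = compile l a @ compile (l + clen a) b"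
| "compile l (If r a b) = Jz r (l + clen a + 3) # compile (l + 1) a @
     [Const 2 0, Jz 2 (l + clen a + clen b + 3)] @ compile (l + clen a + 3) b"
| "compile l (While r a) = Jz r (l + clen a + 3) # compile (l + 1) a @ [Const 2 0, Jz 2 l]"

type_synonym memory = "nat \<Rightarrow> nat"

text \<open>The program counter 0 is arbitrary: what a jump-free instruction does to memory and
  output does not depend on it.\<close>

definition effect :: "instr \<Rightarrow> memory \<Rightarrow> nat list \<Rightarrow> memory \<times> nat list" where
  "effect i M os = (let c = exec_instr i \<lparr>pc = 0, mem = M, out = os\<rparr> in (mem c, out c))"

text \<open>The counts are those of the compiled code. A taken branch or a loop round pays one test
  plus the two instructions of its closing jump, which are also the reason for resetting register
  2.\<close>

inductive exec :: "com \<Rightarrow> memory \<Rightarrow> nat list \<Rightarrow> nat \<Rightarrow> memory \<Rightarrow> nat list \<Rightarrow> bool" where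
  Skip: "exec Skip M os 0 M os"
| Ins: "jump_free i \<Longrightarrow> effect i M os = (M', os') \<Longrightarrow> exec (Ins i) M os 1 M' os'"
| Seq: "exec a M os k M' os' \<Longrightarrow> exec b M' os' k' M'' os'' \<Longrightarrow> exec (a ;; b) M os (k + k') M'' os''"
| IfTrue: "M r \<noteq> 0 \<Longrightarrow> exec a M os k M' os' \<Longrightarrow> exec (If r a b) M os (k + 3) (M'(2 := 0)) os'"
| IfFalse: "M r = 0 \<Longrightarrow> exec b M os k M' os' \<Longrightarrow> exec (If r a b) M os (k + 1) M' os'"
| WhileFalse: "M r = 0 \<Longrightarrow> exec (While r a) M os 1 M os"
| WhileTrue: "M r \<noteq> 0 \<Longrightarrow> exec a M os k M' os' \<Longrightarrow>
    exec (While r a) (M'(2 := 0)) os' k' M'' os'' \<Longrightarrow> exec (While r a) M os (k + k' + 3) M'' os''"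

section \<open>Correctness of the compiler\<close>

lemma length_compile [simp]: "length (compile l c) = clen c"
  by (induction c arbitrary: l) auto

lemma run_0 [simp]: "run P 0 c = c"
  by (simp add: run_def)

lemma run_add: "run P (j + k) c = run P k (run P j c)"
  by (metis add.commute comp_apply funpow_add run_def)

lemma run_Suc: "run P (Suc k) c = run P k (step P c)"
  by (simp add: run_def funpow_swap1)

lemma run_1: "run P 1 c = step P c"
  by (simp add: run_def)

abbreviation "conf p M os \<equiv> \<lparr>pc = p, mem = M, out = os\<rparr>"

lemma step_at: "P = pre @ i # post \<Longrightarrow> length pre = p \<Longrightarrow> step P (conf p M os) = exec_instr i (conf p M os)"
  by (auto simp: step_def halted_def nth_append)

lemma exec_instr_jump_free:
  "jump_free i \<Longrightarrow> effect i M os = (M', os') \<Longrightarrow> exec_instr i (conf p M os) = conf (Suc p) M' os'"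
  by (cases i) (auto simp: effect_def)

lemma run_jump:
  assumes "P = pre @ Const 2 0 # Jz 2 l # post" "length pre = p"
  shows "run P 2 (conf p M os) = conf l (M(2 := 0)) os"
proof -
  have "step P (conf p M os) = conf (Suc p) (M(2 := 0)) os"
    by (subst step_at[OF assms]) simp
  moreover have "step P (conf (Suc p) (M(2 := 0)) os) = conf l (M(2 := 0)) os"
    by (subst step_at[of P "pre @ [Const 2 0]"]) (use assms in auto)
  ultimately show ?thesis by (simp add: numeral_2_eq_2 run_Suc)
qed

text \<open>The surrounding code is arbitrary so that the induction hypotheses apply to the pieces
  of a compound command at their own addresses.\<close>

lemma compile_correct:
  assumes "exec c M os k M' os'"
  shows "P = pre @ compile l c @ post \<Longrightarrow> length pre = l \<Longrightarrow>
    run P k (conf l M os) = conf (l + clen c) M' os'"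
  using assms
proof (induction arbitrary: l pre post)
  case (Skip M os)
  then show ?case by simp
next
  case (Ins i M os M' os')
  then show ?case
    unfolding run_1 by (subst step_at[of P pre]) (auto simp: exec_instr_jump_free)
next
  case (Seq a M os k M' os' b k' M'' os'')
  have "run P k (conf l M os) = conf (l + clen a) M' os'"
    by (rule Seq.IH(1)) (use Seq.prems in auto)
  moreover have "run P k' (conf (l + clen a) M' os') = conf (l + clen a + clen b) M'' os''"
    by (rule Seq.IH(2)[of "pre @ compile l a"]) (use Seq.prems in auto)
  ultimately show ?case by (simp add: run_add add.assoc)
next
  case (IfTrue M r a os k M' os' b)
  have "step P (conf l M os) = conf (Suc l) M os"
    by (subst step_at[of P pre]) (use IfTrue in auto)
  moreover have "run P k (conf (Suc l) M os) = conf (Suc l + clen a) M' os'"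
    by (rule IfTrue.IH[of "pre @ [Jz r (l + clen a + 3)]"]) (use IfTrue.prems in auto)
  moreover have "run P 2 (conf (Suc l + clen a) M' os') = conf (l + clen a + clen b + 3) (M'(2 := 0)) os'"
    by (rule run_jump[of P "pre @ Jz r (l + clen a + 3) # compile (l + 1) a"]) (use IfTrue.prems in auto)
  moreover have "k + 3 = Suc (k + 2)" by simp
  ultimately show ?case by (simp only: run_Suc run_add clen.simps add.assoc)
next
  case (IfFalse M r b os k M' os' a)
  have "step P (conf l M os) = conf (l + clen a + 3) M os"
    by (subst step_at[of P pre]) (use IfFalse in auto)
  moreover have "run P k (conf (l + clen a + 3) M os) = conf (l + clen a + 3 + clen b) M' os'"
    by (rule IfFalse.IH[of "pre @ Jz r (l + clen a + 3) # compile (l + 1) a @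
        [Const 2 0, Jz 2 (l + clen a + clen b + 3)]"]) (use IfFalse.prems in auto)
  ultimately show ?case by (simp add: run_Suc ac_simps)
next
  case (WhileFalse M r a os)
  then show ?case
    unfolding run_1 by (subst step_at[of P pre]) auto
next
  case (WhileTrue M r a os k M' os' k' M'' os'')
  have "step P (conf l M os) = conf (Suc l) M os"
    by (subst step_at[of P pre]) (use WhileTrue in auto)
  moreover have "run P k (conf (Suc l) M os) = conf (Suc l + clen a) M' os'"
    by (rule WhileTrue.IH(1)[of "pre @ [Jz r (l + clen a + 3)]"]) (use WhileTrue.prems in auto)
  moreover have "run P 2 (conf (Suc l + clen a) M' os') = conf l (M'(2 := 0)) os'"
    by (rule run_jump[of P "pre @ Jz r (l + clen a + 3) # compile (l + 1) a"]) (use WhileTrue.prems in auto)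
  moreover have "run P k' (conf l (M'(2 := 0)) os') = conf (l + clen (While r a)) M'' os''"
    by (rule WhileTrue.IH(2)) (use WhileTrue.prems in auto)
  moreover have "k + k' + 3 = Suc (k + (2 + k'))" by simp
  ultimately show ?case by (simp only: run_Suc run_add)
qed

text \<open>Total correctness with running time: termination is part of the claim. Exhibiting one
  execution is enough, as the machine is deterministic and \<open>compile_correct\<close> transfers
  that execution to it.\<close>

definition wp :: "com \<Rightarrow> (nat \<Rightarrow> memory \<Rightarrow> nat list \<Rightarrow> bool) \<Rightarrow> memory \<Rightarrow> nat list \<Rightarrow> bool" where
  "wp c Q M os \<longleftrightarrow> (\<exists>k M' os'. exec c M os k M' os' \<and> Q k M' os')"

lemma wp_mono: "wp c Q M os \<Longrightarrow> (\<And>k M' os'. Q k M' os' \<Longrightarrow> Q' k M' os') \<Longrightarrow> wp c Q' M os"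
  unfolding wp_def by blast

inductive_cases exec_SkipE: "exec Skip M os k M' os'"
inductive_cases exec_InsE: "exec (Ins i) M os k M' os'"
inductive_cases exec_SeqE: "exec (a ;; b) M os k M' os'"
inductive_cases exec_IfE: "exec (If r a b) M os k M' os'"
inductive_cases exec_WhileE: "exec (While r a) M os k M' os'"

lemma wp_Skip [simp]: "wp Skip Q M os = Q 0 M os"
  by (auto simp: wp_def intro: exec.Skip elim: exec_SkipE)

lemma wp_Ins: "jump_free i \<Longrightarrow> wp (Ins i) Q M os = Q 1 (fst (effect i M os)) (snd (effect i M os))"
  unfolding wp_def by (metis exec.Ins exec_InsE prod.collapse fst_conv snd_conv)

lemma wp_instr [simp]:
  "wp (Ins (Const r k)) Q M os = Q 1 (M(r := k)) os"
  "wp (Ins (Add r a b)) Q M os = Q 1 (M(r := M a + M b)) os"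
  "wp (Ins (Sub r a b)) Q M os = Q 1 (M(r := M a - M b)) os"
  "wp (Ins (Load r a)) Q M os = Q 1 (M(r := M (M a))) os"
  "wp (Ins (Store a b)) Q M os = Q 1 (M(M a := M b)) os"
  "wp (Ins (Out r)) Q M os = Q 1 M (os @ [M r])"
  by (simp_all add: wp_Ins effect_def)

lemma wp_Seq [simp]: "wp (a ;; b) Q M os = wp a (\<lambda>k M' os'. wp b (\<lambda>k'. Q (k + k')) M' os') M os"
  unfolding wp_def by (fast intro: exec.Seq elim: exec_SeqE)

lemma exec_If_iff:
  "exec (If r a b) M os k M' os' \<longleftrightarrow>
    (if M r \<noteq> 0 then \<exists>j M0. exec a M os j M0 os' \<and> k = j + 3 \<and> M' = M0(2 := 0)
     else \<exists>j. exec b M os j M' os' \<and> k = j + 1)"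
proof
  show "if M r \<noteq> 0 then \<exists>j M0. exec a M os j M0 os' \<and> k = j + 3 \<and> M' = M0(2 := 0)
     else \<exists>j. exec b M os j M' os' \<and> k = j + 1" if "exec (If r a b) M os k M' os'"
    using that by (rule exec_IfE) (simp_all, blast)
  show "exec (If r a b) M os k M' os'" if "if M r \<noteq> 0
     then \<exists>j M0. exec a M os j M0 os' \<and> k = j + 3 \<and> M' = M0(2 := 0)
     else \<exists>j. exec b M os j M' os' \<and> k = j + 1"
    using that exec.IfTrue exec.IfFalse by (cases "M r = 0") (simp_all only: if_True if_False simp_thms, blast+)
qed

lemma wp_If [simp]:
  "wp (If r a b) Q M os =
    (if M r \<noteq> 0 then wp a (\<lambda>k M'. Q (k + 3) (M'(2 := 0))) M os else wp b (\<lambda>k. Q (k + 1)) M os)"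
  unfolding wp_def exec_If_iff by (cases "M r = 0") (simp_all, blast+)

lemma wp_While_False: "M r = 0 \<Longrightarrow> Q 1 M os \<Longrightarrow> wp (While r a) Q M os"
  unfolding wp_def by (blast intro: exec.WhileFalse)

lemma wp_While_True:
  "M r \<noteq> 0 \<Longrightarrow> wp a (\<lambda>k M' os'. wp (While r a) (\<lambda>k'. Q (k + k' + 3)) (M'(2 := 0)) os') M os \<Longrightarrow>
    wp (While r a) Q M os"
  unfolding wp_def by (blast intro: exec.WhileTrue)

lemma wp_loop_aux:
  assumes step: "\<And>j M os. I j M os \<Longrightarrow> M r \<noteq> 0 \<Longrightarrow>
      j < N \<and> wp a (\<lambda>k M' os'. k \<le> t \<and> I (Suc j) (M'(2 := 0)) os') M os"
  shows "I j M os \<Longrightarrow> j \<le> N \<Longrightarrow>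
    wp (While r a) (\<lambda>k M' os'. k \<le> (N - j) * (t + 3) + 1 \<and> M' r = 0 \<and> (\<exists>j'\<le>N. I j' M' os')) M os"
proof (induction "N - j" arbitrary: j M os)
  case 0
  then have "M r = 0" using step by force
  then show ?case using 0 by (intro wp_While_False) auto
next
  case (Suc d)
  show ?case
  proof (cases "M r = 0")
    case True
    then show ?thesis using Suc by (intro wp_While_False) auto
  next
    case False
    have jN: "j < N" and b: "wp a (\<lambda>k M' os'. k \<le> t \<and> I (Suc j) (M'(2 := 0)) os') M os"
      using step[OF Suc.prems(1) False] by auto
    have d: "N - j = Suc (N - Suc j)" using jN by simp
    show ?thesis
    proof (rule wp_While_True[where M = M and r = r and a = a and os = os and Q = "\<lambda>k M' os'. k \<le> (N - j) * (t + 3) + 1 \<and> M' r = 0 \<and>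
        (\<exists>j'\<le>N. I j' M' os')", OF False], rule wp_mono[OF b])
      fix k M' os' assume k: "k \<le> t \<and> I (Suc j) (M'(2 := 0)) os'"
      show "wp (While r a) (\<lambda>k' M'' os''. k + k' + 3 \<le> (N - j) * (t + 3) + 1 \<and> M'' r = 0 \<and>
          (\<exists>j'\<le>N. I j' M'' os'')) (M'(2 := 0)) os'"
        by (rule wp_mono[OF Suc.hyps(1)[of "Suc j"]]) (use k jN Suc.hyps(2) in \<open>auto simp: d\<close>)
    qed
  qed
qed

text \<open>\<open>N\<close> only bounds the number of rounds, and the loop may stop at any earlier
  \<open>j\<close>, as a quantifier loop does once it has found a witness. The invariant is restored
  after the closing jump has cleared register 2.\<close>

lemma wp_loop:
  assumes "I 0 M os"
    and "\<And>j M os. I j M os \<Longrightarrow> M r \<noteq> 0 \<Longrightarrow>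
      j < N \<and> wp a (\<lambda>k M' os'. k \<le> t \<and> I (Suc j) (M'(2 := 0)) os') M os"
    and "\<And>j k M os. I j M os \<Longrightarrow> j \<le> N \<Longrightarrow> M r = 0 \<Longrightarrow> k \<le> N * (t + 3) + 1 \<Longrightarrow> Q k M os"
  shows "wp (While r a) Q M os"
  by (rule wp_mono[OF wp_loop_aux[where I = I and j = 0 and N = N and t = t]])
     (use assms in auto)

section \<open>Evaluation of first-order formulas\<close>

text \<open>The flag in \<open>Ex\<close> chooses between vertices and edge indices as range. The
  array lookup \<open>Let\<close> is the only function symbol; chaining it leads from an edge index
  to an entry of the edge and on to the status of that vertex.\<close>

datatype fm = EqV nat nat | EqC nat nat | Neg fm | And fm fm | Ex nat nat fm | Let nat nat nat fm

fun bound :: "nat \<Rightarrow> nat \<Rightarrow> nat \<Rightarrow> nat" where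
  "bound n m b = (if b = 0 then n else m)"

fun sat :: "nat \<Rightarrow> nat \<Rightarrow> (nat \<Rightarrow> nat \<Rightarrow> nat) \<Rightarrow> fm \<Rightarrow> (nat \<Rightarrow> nat) \<Rightarrow> bool" where
  "sat n m arr (EqV u v) e = (e u = e v)"
| "sat n m arr (EqC u k) e = (e u = k)"
| "sat n m arr (Neg p) e = (\<not> sat n m arr p e)"
| "sat n m arr (And p q) e = (sat n m arr p e \<and> sat n m arr q e)"
| "sat n m arr (Ex v b p) e = (\<exists>x<bound n m b. sat n m arr p (e(v := x)))"
| "sat n m arr (Let v a u p) e = sat n m arr p (e(v := arr a (e u)))"

text \<open>Truth of the body with the leading existential variables taken from \<open>e\<close>
  itself. A successful evaluation leaves such values in the registers, and the branches of a rule
  read their vertices from there.\<close>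

fun wit :: "nat \<Rightarrow> nat \<Rightarrow> (nat \<Rightarrow> nat \<Rightarrow> nat) \<Rightarrow> fm \<Rightarrow> (nat \<Rightarrow> nat) \<Rightarrow> bool" where
  "wit n m arr (Ex v b p) e = (e v < bound n m b \<and> wit n m arr p e)"
| "wit n m arr p e = sat n m arr p e"

fun fv :: "fm \<Rightarrow> nat set" where
  "fv (EqV u v) = {u, v}"
| "fv (EqC u k) = {u}"
| "fv (Neg p) = fv p"
| "fv (And p q) = fv p \<union> fv q"
| "fv (Ex v b p) = fv p - {v}"
| "fv (Let v a u p) = insert u (fv p - {v})"

fun bv :: "fm \<Rightarrow> nat set" where
  "bv (EqV u v) = {}"
| "bv (EqC u k) = {}"
| "bv (Neg p) = bv p"
| "bv (And p q) = bv p \<union> bv q"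
| "bv (Ex v b p) = insert v (bv p)"
| "bv (Let v a u p) = insert v (bv p)"

text \<open>Variables are fixed registers, so binding one overwrites its old value. The conditions
  keep each conjunct from destroying free variables of the other; both directions matter, as the
  witness must still be valid when the evaluation has finished.\<close>

fun wf_fm :: "fm \<Rightarrow> bool" where
  "wf_fm (EqV u v) = (u < 28 \<and> v < 28)"
| "wf_fm (EqC u k) = (u < 28)"
| "wf_fm (Neg p) = wf_fm p"
| "wf_fm (And p q) = (wf_fm p \<and> wf_fm q \<and> bv p \<inter> fv q = {} \<and> bv q \<inter> fv p = {})"
| "wf_fm (Ex v b p) = (wf_fm p \<and> v < 28 \<and> v \<notin> bv p)"
| "wf_fm (Let v a u p) = (wf_fm p \<and> v < 28 \<and> v \<notin> bv p \<and> u < 28 \<and> u \<noteq> v \<and> u \<notin> bv p \<and> a < 4)"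

lemma wf_fv_bv: "wf_fm p \<Longrightarrow> fv p \<inter> bv p = {}"
  by (induction p) auto

lemma wf_vars: "wf_fm p \<Longrightarrow> fv p \<subseteq> {..<28} \<and> bv p \<subseteq> {..<28}"
  by (induction p) auto

lemma sat_cong: "(\<And>v. v \<in> fv p \<Longrightarrow> e v = e' v) \<Longrightarrow> sat n m arr p e = sat n m arr p e'"
proof (induction p arbitrary: e e')
  case (Ex v b p)
  have "sat n m arr p (e(v := x)) = sat n m arr p (e'(v := x))" for x
    by (rule Ex.IH) (use Ex.prems in auto)
  then show ?case by simp
next
  case (Let v a u p)
  have "sat n m arr p (e(v := arr a (e u))) = sat n m arr p (e'(v := arr a (e' u)))"
    by (rule Let.IH) (use Let.prems in auto)
  then show ?case by simp
next
  case (And p q)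
  then show ?case by (metis UnCI fv.simps(4) sat.simps(4))
next
  case (Neg p)
  then show ?case by (metis fv.simps(3) sat.simps(3))
qed simp_all

text \<open>Registers: 0 and 18 hold the two quantifier bounds, 2 is clobbered by jumps, 3 holds 1,
  4 is the truth value, 5 and 6 are scratch, 20 to 23 hold the base addresses of the arrays and
  24 to 51 the variables of a formula.\<close>

definition ctx :: "nat \<Rightarrow> nat \<Rightarrow> (nat \<Rightarrow> nat \<Rightarrow> nat) \<Rightarrow> memory \<Rightarrow> bool" where
  "ctx n m arr M \<longleftrightarrow> M 0 = n \<and> M 18 = m \<and> M 3 = 1 \<and>
     (\<forall>a<4. 52 \<le> M (20 + a) \<and> (\<forall>i. M (M (20 + a) + i) = arr a i))"

definition env :: "memory \<Rightarrow> nat \<Rightarrow> nat" where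
  "env M v = M (24 + v)"

text \<open>Two numbers are equal iff both truncated differences vanish. In the loop for
  \<open>Ex\<close>, register 6 is the number of candidates left; a success sets it to 0 without
  advancing the variable, so the loop ends with the witness in place.\<close>

fun eval_fm :: "fm \<Rightarrow> com" where
  "eval_fm (EqV u v) = Ins (Sub 5 (24 + u) (24 + v)) ;; Ins (Sub 6 (24 + v) (24 + u)) ;;
     Ins (Add 5 5 6) ;; If 5 (Ins (Const 4 0)) (Ins (Const 4 1))"
| "eval_fm (EqC u k) = Ins (Const 4 k) ;; Ins (Sub 5 (24 + u) 4) ;; Ins (Sub 6 4 (24 + u)) ;;
     Ins (Add 5 5 6) ;; If 5 (Ins (Const 4 0)) (Ins (Const 4 1))"
| "eval_fm (Neg p) = eval_fm p ;; If 4 (Ins (Const 4 0)) (Ins (Const 4 1))"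
| "eval_fm (And p q) = eval_fm p ;; If 4 (eval_fm q) Skip"
| "eval_fm (Let v a u p) = Ins (Add 5 (20 + a) (24 + u)) ;; Ins (Load (24 + v) 5) ;; eval_fm p"
| "eval_fm (Ex v b p) = Ins (Const (24 + v) 0) ;; Ins (Const 4 0) ;;
     Ins (Sub 6 (if b = 0 then 0 else 18) (24 + v)) ;;
     While 6 (eval_fm p ;; If 4 (Ins (Const 6 0))
       (Ins (Add (24 + v) (24 + v) 3) ;; Ins (Sub 6 (if b = 0 then 0 else 18) (24 + v))))"

fun cost :: "nat \<Rightarrow> fm \<Rightarrow> nat" where
  "cost N (EqV u v) = 7"
| "cost N (EqC u k) = 8"
| "cost N (Neg p) = cost N p + 4"
| "cost N (And p q) = cost N p + cost N q + 3"
| "cost N (Let v a u p) = cost N p + 2"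
| "cost N (Ex v b p) = N * (cost N p + 8) + 4"

definition agree :: "nat set \<Rightarrow> memory \<Rightarrow> memory \<Rightarrow> bool" where
  "agree W M M' \<longleftrightarrow> (\<forall>x. x \<notin> {2, 4, 5, 6} \<and> (24 \<le> x \<longrightarrow> x - 24 \<notin> W) \<longrightarrow> M' x = M x)"

lemma agree_trans: "agree W M M' \<Longrightarrow> agree W' M' M'' \<Longrightarrow> agree (W \<union> W') M M''"
  unfolding agree_def by (metis UnCI)

lemma agree_mono: "agree W M M' \<Longrightarrow> W \<subseteq> W' \<Longrightarrow> agree W' M M'"
  by (auto simp: agree_def)

lemma agree_upd: "agree W M M' \<Longrightarrow> x \<in> {2, 4, 5, 6} \<or> 24 \<le> x \<and> x - 24 \<in> W \<Longrightarrow> agree W M (M'(x := y))"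
  by (auto simp: agree_def)

lemma agree_refl: "agree W M M" by (auto simp: agree_def)

lemma ctx_agree:
  assumes "ctx n m arr M" "agree W M M'" "W \<subseteq> {..<28}"
  shows "ctx n m arr M'"
proof -
  have same: "M' x = M x" if "x \<in> {0, 3, 18, 20, 21, 22, 23} \<or> 52 \<le> x" for x
  proof -
    have "x - 24 \<notin> W" if "24 \<le> x" using \<open>_ \<or> 52 \<le> x\<close> that assms(3) by auto
    then show ?thesis using that assms(2) unfolding agree_def by auto
  qed
  have arr: "52 \<le> M' (20 + a) \<and> (\<forall>i. M' (M' (20 + a) + i) = arr a i)" if "a < 4" for a
  proof -
    have "a = 0 \<or> a = 1 \<or> a = 2 \<or> a = 3" using that by linarith
    then have base: "M' (20 + a) = M (20 + a)" by (intro same) auto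
    have M: "52 \<le> M (20 + a)" "M (M (20 + a) + i) = arr a i" for i
      using assms(1) that by (auto simp: ctx_def)
    then have "M' (M (20 + a) + i) = arr a i" for i
      by (subst same) (auto simp: trans_le_add1)
    then show ?thesis using base M by simp
  qed
  have "M' 0 = M 0" "M' 18 = M 18" "M' 3 = M 3" by (rule same; simp)+
  then show ?thesis using assms(1) arr by (simp add: ctx_def)
qed

lemma env_agree: "agree W M M' \<Longrightarrow> v \<notin> W \<Longrightarrow> env M' v = env M v"
  by (auto simp: agree_def env_def)

lemma env_upd_low: "x < 24 \<Longrightarrow> env (M(x := y)) = env M"
  by (auto simp: env_def)

text \<open>Besides the truth value, the frame condition \<open>agree\<close> matters: subformulas
  share one register file, and it is what lets them be evaluated one after another.\<close>

lemma eval_fm_correct: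
  assumes "wf_fm p" "ctx n m arr M" "n \<le> N" "m \<le> N"
  shows "wp (eval_fm p) (\<lambda>k M' os'. os' = os \<and> k \<le> cost N p \<and> agree (bv p) M M' \<and>
     (M' 4 = 1 \<and> sat n m arr p (env M) \<and> wit n m arr p (env M') \<or>
      M' 4 = 0 \<and> \<not> sat n m arr p (env M))) M os"
  using assms(1,2)
proof (induction p arbitrary: M os)
  case (EqV u v)
  then show ?case by (auto simp: agree_def env_def)
next
  case (EqC u k)
  then show ?case by (auto simp: agree_def env_def)
next
  case (Neg p)
  show ?case
    unfolding eval_fm.simps wp_Seq
  proof (rule wp_mono[OF Neg.IH], goal_cases)
    case (3 k M' os')
    then have "sat n m arr p (env M') = sat n m arr p (env M)"
      using Neg.prems wf_fv_bv[of p] by (intro sat_cong env_agree) auto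
    then show ?case
      using 3 by (auto simp: agree_def env_upd_low)
  qed (use Neg in auto)
next
  case (And p q)
  show ?case
    unfolding eval_fm.simps wp_Seq
  proof (rule wp_mono[OF And.IH(1)], goal_cases)
    case (3 k M' os')
    have q: "sat n m arr q (env M') = sat n m arr q (env M)"
      using 3 And.prems by (intro sat_cong env_agree) auto
    have "ctx n m arr M'"
      using ctx_agree[OF And.prems(2)] 3 wf_vars[of p] And.prems by auto
    then have w: "wp (eval_fm q) (\<lambda>k M'' os''. os'' = os' \<and> k \<le> cost N q \<and> agree (bv q) M' M'' \<and>
     (M'' 4 = 1 \<and> sat n m arr q (env M') \<and> wit n m arr q (env M'') \<or>
      M'' 4 = 0 \<and> \<not> sat n m arr q (env M'))) M' os'"
      using And by auto
    show ?case
    proof (cases "M' 4 = 0")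
      case True
      then show ?thesis using 3 by (auto intro: agree_mono)
    next
      case False
      then have p: "sat n m arr p (env M)" using 3 by auto
      show ?thesis using False
        apply simp
      proof (rule wp_mono[OF w], goal_cases)
        case (1 k' M'' os'')
        have "agree (bv p \<union> bv q) M M''" using 3 1 agree_trans by blast
        moreover have "sat n m arr p (env M'') = sat n m arr p (env M)"
          using wf_fv_bv[of p] And.prems by (intro sat_cong env_agree[OF calculation]) auto
        moreover have "sat n m arr q (env M'') = sat n m arr q (env M)"
          using wf_fv_bv[of q] And.prems by (intro sat_cong env_agree[OF calculation(1)]) auto
        ultimately show ?case using 1 3 p q
          by (auto simp: env_upd_low agree_upd)
      qed
    qed
  qed (use And in auto)
next
  case (Let v a u p)
  have a4: "52 \<le> M (20 + a)" "M (M (20 + a) + env M u) = arr a (env M u)"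
    using Let.prems by (auto simp: ctx_def)
  let ?M = "M(5 := M (20 + a) + M (24 + u), 24 + v := arr a (env M u))"
  have ag: "agree {v} M ?M" by (auto simp: agree_def)
  have ctx: "ctx n m arr ?M" using ctx_agree[OF Let.prems(2) ag] Let.prems(1) by auto
  have load: "(M(5 := M (20 + a) + M (24 + u))) (M (20 + a) + M (24 + u)) = arr a (env M u)"
    using a4 by (simp add: env_def)
  have envM: "env ?M = (env M)(v := arr a (env M u))" by (auto simp: env_def)
  have "wp (eval_fm p) (\<lambda>k M' os'. os' = os \<and> k \<le> cost N p \<and> agree (bv p) ?M M' \<and>
     (M' 4 = 1 \<and> sat n m arr p (env ?M) \<and> wit n m arr p (env M') \<or>
      M' 4 = 0 \<and> \<not> sat n m arr p (env ?M))) ?M os"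
    using Let ctx by auto
  then show ?case
    unfolding eval_fm.simps wp_Seq wp_instr fun_upd_same load
  proof (rule wp_mono, goal_cases)
    case (1 k M' os')
    have ag': "agree (insert v (bv p)) M M'" using agree_trans[OF ag, of "bv p" M'] 1 by auto
    have "sat n m arr (Let v a u p) (env M')" if "sat n m arr (Let v a u p) (env M)"
    proof -
      have "env M' x = env M x" if "x \<in> fv (Let v a u p)" for x
        by (rule env_agree[OF ag']) (use that Let.prems wf_fv_bv[of p] in auto)
      then show ?thesis using that sat_cong by metis
    qed
    then show ?case using 1 ag' unfolding envM by auto
  qed
next
  case (Ex v b p)
  define B where "B = bound n m b"
  define br where "br = (if b = 0 then 0 else 18::nat)"
  define W where "W = insert v (bv p)"
  have W: "W \<subseteq> {..<28}" using wf_vars[of p] Ex.prems by (auto simp: W_def)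
  have v: "v < 28" "v \<notin> bv p" "wf_fm p" using Ex.prems by auto
  have BN: "B \<le> N" using assms by (simp add: B_def)
  have br: "M' br = B" if "agree W M M'" for M'
    using ctx_agree[OF Ex.prems(2) that W] by (auto simp: ctx_def br_def B_def)
  have br_ne: "br \<noteq> 6" "br \<noteq> 4" "br \<noteq> 24 + v" by (auto simp: br_def)
  let ?a = "eval_fm p ;; If 4 (Ins (Const 6 0)) (Ins (Add (24 + v) (24 + v) 3) ;; Ins (Sub 6 br (24 + v)))"
  \<comment> \<open>Two modes: while searching, all candidates below \<open>j\<close> have failed;
    after a success, register 6 is 0 and the registers already hold the witness.\<close>
  define I where "I = (\<lambda>j M' os'. os' = os \<and> agree W M M' \<and> j \<le> B \<and>
     (M' 4 = 0 \<and> M' (24 + v) = j \<and> M' 6 = B - j \<and> (\<forall>i<j. \<not> sat n m arr p ((env M)(v := i))) \<or>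
      M' 4 = 1 \<and> M' 6 = 0 \<and> env M' v < B \<and> sat n m arr p ((env M)(v := env M' v)) \<and>
      wit n m arr p (env M')))"
  let ?M = "M(24 + v := 0, 4 := 0, 6 := B)"
  have "wp (While 6 ?a) (\<lambda>k M' os'. os' = os \<and> 3 + k \<le> cost N (Ex v b p) \<and> agree W M M' \<and>
     (M' 4 = 1 \<and> sat n m arr (Ex v b p) (env M) \<and> wit n m arr (Ex v b p) (env M') \<or>
      M' 4 = 0 \<and> \<not> sat n m arr (Ex v b p) (env M))) ?M os"
  proof (rule wp_loop[where I = I and N = B and t = "cost N p + 5"], goal_cases)
    case 1
    show ?case by (auto simp: I_def agree_def W_def)
  next
    case (2 j M' os')
    then have I: "os' = os" "agree W M M'" "M' 4 = 0" "M' (24 + v) = j" "M' 6 = B - j"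
      "\<forall>i<j. \<not> sat n m arr p ((env M)(v := i))"
      by (auto simp: I_def)
    have jB: "j < B" using 2 I by simp
    have ctx': "ctx n m arr M'" using ctx_agree[OF Ex.prems(2) I(2) W] .
    have envM': "sat n m arr p (env M') = sat n m arr p ((env M)(v := j))"
    proof (rule sat_cong)
      fix x assume x: "x \<in> fv p"
      show "env M' x = ((env M)(v := j)) x"
      proof (cases "x = v")
        case False
        then have "x \<notin> W" using x wf_fv_bv[OF v(3)] by (auto simp: W_def)
        then show ?thesis using env_agree[OF I(2)] False by simp
      qed (use I(4) in \<open>simp add: env_def\<close>)
    qed
    show ?case
      unfolding wp_Seq
    proof (intro conjI jB, rule wp_mono[OF Ex.IH[OF v(3) ctx']], goal_cases)
      case (1 k M'' os'')
      have ag: "agree W M M''"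
        using agree_trans[OF I(2), of "bv p" M''] 1 by (auto simp: W_def insert_absorb)
      have vj: "M'' (24 + v) = j" "env M'' v = j"
        using 1 v(2) env_agree[of "bv p" M' M'' v] I(4) by (auto simp: env_def)
      have one: "M'' 3 = 1" using ctx_agree[OF Ex.prems(2) ag W] by (simp add: ctx_def)
      have less: "(\<forall>i<Suc j. \<not> sat n m arr p ((env M)(v := i)))" if "M'' 4 = 0"
        using 1 that I(6) envM' by (auto simp: less_Suc_eq)
      have ag2: "agree W M (M''(24 + v := Suc j, 6 := B - Suc j, 2 := 0))"
        "agree W M (M''(6 := 0, 2 := 0))"
        using ag by (auto simp: W_def intro!: agree_upd)
      show ?case
      proof (cases "M'' 4 = 0")
        case True
        then show ?thesis
          using 1 I(1) jB ag2 less vj one br_ne br[OF ag] by (auto simp: I_def env_upd_low)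
      next
        case False
        then show ?thesis
          using 1 I(1) jB ag2 vj envM' by (auto simp: I_def env_upd_low)
      qed
    qed
  next
    case (3 j k M' os')
    have "k \<le> N * (cost N p + 8) + 1"
    proof -
      have "B * (cost N p + 5 + 3) \<le> N * (cost N p + 8)"
        using BN by (intro mult_le_mono) auto
      then show ?thesis using 3(4) by linarith
    qed
    then show ?case
      using 3 by (auto simp: I_def B_def)
  qed
  then show ?case
    using br[OF agree_refl] br_ne unfolding eval_fm.simps br_def[symmetric]
    by (simp add: W_def)
qed

section \<open>Partial assignments\<close>

text \<open>Status 0 is undecided, 1 selected and 2 discarded. Index $n$ is a dummy vertex, always discarded,
  which pads edges with fewer than three vertices.\<close>

type_synonym status = "nat \<Rightarrow> nat"

definition valid :: "nat \<Rightarrow> status \<Rightarrow> bool" where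
  "valid n s \<longleftrightarrow> (\<forall>i<n. s i \<le> 2) \<and> s n = 2"

definition level :: "nat \<Rightarrow> status \<Rightarrow> nat \<Rightarrow> nat set" where
  "level n s c = {i. i < n \<and> s i = c}"

definition resid :: "nat \<Rightarrow> nat set set \<Rightarrow> status \<Rightarrow> nat set set" where
  "resid n E s = red (level n s 1) (level n s 2) E"

definition Sol :: "nat \<Rightarrow> nat set set \<Rightarrow> status \<Rightarrow> nat set set" where
  "Sol n E s = {S. minimal_transversal {..<n} E S \<and> level n s 1 \<subseteq> S \<and> level n s 2 \<inter> S = {}}"

text \<open>Counting nodes needs a sum that drops by at least 1 whenever a node is expanded. Every
  branch decides a vertex, so the linear factor falls by at least 1. As \<open>pot\<close> is at
  least 40/67, the leading 2 makes this drop worth more than 1.\<close>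

definition Phi :: "nat \<Rightarrow> nat set set \<Rightarrow> status \<Rightarrow> real" where
  "Phi n E s = 2 * (real (card (level n s 0)) + 1) * pot (resid n E s)"

lemma level_cong: "(\<And>i. i < n \<Longrightarrow> s i = s' i) \<Longrightarrow> level n s c = level n s' c"
  by (auto simp: level_def)

lemma finite_level [simp]: "finite (level n s c)"
  by (auto simp: level_def)

lemma red_iff: "g \<in> red A B H \<longleftrightarrow> g \<noteq> {} \<and> (\<exists>f\<in>H. f \<inter> A = {} \<and> g = f - B)"
  by (auto simp: red_def)

text \<open>Decisions made in two stages compose. A vertex discarded in the first stage is invisible
  to the second, so it must not be selected there; this is the hypothesis.\<close>

lemma red_red:
  assumes "A \<inter> B0 = {}"
  shows "red A B (red A0 B0 E) = red (A0 \<union> A) (B0 \<union> B) E"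
proof (intro set_eqI iffI)
  fix g assume "g \<in> red A B (red A0 B0 E)"
  then obtain f where f: "g \<noteq> {}" "f \<in> red A0 B0 E" "f \<inter> A = {}" "g = f - B"
    by (metis red_iff)
  then obtain e where "e \<in> E" "e \<inter> A0 = {}" "f = e - B0" by (metis red_iff)
  then have "g \<noteq> {}" "e \<in> E" "e \<inter> A0 = {}" "(e - B0) \<inter> A = {}" "g = e - B0 - B"
    using f by simp_all
  moreover have "e - B0 - B = e - (B0 \<union> B)" by auto
  moreover have "e \<inter> (A0 \<union> A) = {}"
    using assms \<open>e \<inter> A0 = {}\<close> \<open>(e - B0) \<inter> A = {}\<close> by blast
  ultimately show "g \<in> red (A0 \<union> A) (B0 \<union> B) E" unfolding red_iff by metis
next
  fix g assume "g \<in> red (A0 \<union> A) (B0 \<union> B) E"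
  then obtain e where e: "g \<noteq> {}" "e \<in> E" "e \<inter> (A0 \<union> A) = {}" "g = e - (B0 \<union> B)"
    by (metis red_iff)
  then have "e - B0 \<in> red A0 B0 E" by (intro in_red[of e]) auto
  moreover have "(e - B0) \<inter> A = {}" "e - B0 - B = g" using e by auto
  ultimately show "g \<in> red A B (red A0 B0 E)" using e(1) by (rule in_red)
qed

lemma disjoint_if_Int_singleton:
  assumes "e \<inter> S = {v}" "T \<subseteq> S" "v \<notin> T"
  shows "e \<inter> T = {}"
proof -
  have "e \<inter> S \<subseteq> {v}" using assms(1) by simp
  then show ?thesis using assms(2,3) by blast
qed

lemma rank3_resid:
  assumes "hypergraph {..<n} E" "hg_rank_le E 3"
  shows "rank3 (resid n E s)"
proof -
  have fin: "finite E" "\<forall>e\<in>E. finite e"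
    using assms(1) by (auto simp: hypergraph_def intro: finite_subset rev_finite_subset)
  then have "finite {f - level n s 2 |f. f \<in> E \<and> f \<inter> level n s 1 = {}}" by simp
  moreover have "card (f - level n s 2) \<le> 3" if "f \<in> E" for f
    using card_mono[of f "f - level n s 2"] fin assms(2) that by (force simp: hg_rank_le_def)
  ultimately show ?thesis
    using fin by (auto simp: rank3_def resid_def red_def)
qed

lemma Union_resid:
  assumes "hypergraph {..<n} E" "valid n s"
  shows "\<Union>(resid n E s) \<subseteq> level n s 0"
proof
  fix x assume "x \<in> \<Union>(resid n E s)"
  then obtain e where "e \<in> E" "x \<in> e" "x \<notin> level n s 1" "x \<notin> level n s 2"
    by (auto simp: resid_def red_def)
  moreover from this have "x < n" "s x \<le> 2"
    using assms by (auto simp: hypergraph_def valid_def)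
  then have "x < n" "s x = 0 \<or> s x = 1 \<or> s x = 2" by auto
  ultimately show "x \<in> level n s 0" by (auto simp: level_def)
qed

section \<open>Minimality through private edges\<close>

lemma minimal_private:
  assumes "minimal_transversal V E S" "v \<in> S"
  shows "\<exists>e\<in>E. e \<inter> S = {v}"
proof -
  have "\<not> is_transversal E (S - {v})" using assms unfolding minimal_transversal_def by blast
  then obtain e where "e \<in> E" "(S - {v}) \<inter> e = {}" unfolding is_transversal_def by blast
  moreover have "S \<inter> e \<noteq> {}"
    using assms calculation unfolding minimal_transversal_def is_transversal_def by blast
  ultimately show ?thesis by blast
qed

lemma minimal_transversalI:
  assumes "S \<subseteq> V" "is_transversal E S" "\<And>v. v \<in> S \<Longrightarrow> \<exists>e\<in>E. e \<inter> S = {v}"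
  shows "minimal_transversal V E S"
  unfolding minimal_transversal_def
proof (intro conjI allI impI assms(1,2))
  fix T assume "T \<subset> S"
  then obtain v where "v \<in> S" "v \<notin> T" "T \<subseteq> S" by auto
  then obtain e where "e \<in> E" "e \<inter> S = {v}" using assms(3) by blast
  then have "T \<inter> e = {}" using disjoint_if_Int_singleton \<open>v \<notin> T\<close> \<open>T \<subseteq> S\<close> Int_commute by metis
  then show "\<not> is_transversal E T" using \<open>e \<in> E\<close> unfolding is_transversal_def by blast
qed

text \<open>A private edge of an undecided vertex contains no selected vertex, so it is not hit.
  Removing discarded vertices, which lie outside \<open>S\<close>, keeps it private.\<close>

lemma Sol_adm:
  assumes "S \<in> Sol n E s"
  shows "adm (resid n E s) S"
  unfolding adm_def
proof (intro conjI ballI)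
  have S: "minimal_transversal {..<n} E S" "level n s 1 \<subseteq> S" "level n s 2 \<inter> S = {}"
    using assms by (auto simp: Sol_def)
  show "f \<inter> S \<noteq> {}" if f: "f \<in> resid n E s" for f
  proof -
    obtain e where "e \<in> E" "f = e - level n s 2" using f by (auto simp: resid_def red_def)
    moreover have "S \<inter> e \<noteq> {}"
      using S(1) \<open>e \<in> E\<close> unfolding minimal_transversal_def is_transversal_def by blast
    ultimately show ?thesis using S(3) by blast
  qed
  fix v assume v: "v \<in> S \<inter> \<Union>(resid n E s)"
  then obtain e where e: "e \<in> E" "e \<inter> S = {v}" using minimal_private[OF S(1)] by blast
  have "v \<notin> level n s 1" using v Union_red[of "level n s 1"] by (auto simp: resid_def)
  then have "e \<inter> level n s 1 = {}" using disjoint_if_Int_singleton[OF e(2) S(2)] by simp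
  then have "e - level n s 2 \<in> resid n E s"
    unfolding resid_def using e S(3) by (intro in_red) auto
  moreover have "(e - level n s 2) \<inter> S = {v}" using e(2) S(3) by blast
  ultimately show "\<exists>f\<in>resid n E s. f \<inter> S = {v}" by blast
qed

text \<open>A vertex of a solution beyond the selected ones would have a private edge without
  selected vertices, and the rest of that edge would be residual. So the selected set is the only
  candidate. It must still be tested: an edge may have been emptied, and a selected vertex may lack
  a private edge.\<close>

lemma Sol_leaf:
  assumes "resid n E s = {}"
  shows "Sol n E s = (if minimal_transversal {..<n} E (level n s 1) then {level n s 1} else {})"
proof -
  have "S = level n s 1" if S: "S \<in> Sol n E s" for S
  proof (rule ccontr)
    assume "S \<noteq> level n s 1"
    then obtain v where v: "v \<in> S" "v \<notin> level n s 1" using S by (auto simp: Sol_def)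
    have S': "minimal_transversal {..<n} E S" "level n s 1 \<subseteq> S" "level n s 2 \<inter> S = {}"
      using S by (auto simp: Sol_def)
    obtain e where e: "e \<in> E" "e \<inter> S = {v}" using minimal_private[OF S'(1) v(1)] by blast
    have "e \<inter> level n s 1 = {}" using disjoint_if_Int_singleton[OF e(2) S'(2) v(2)] by simp
    moreover have "v \<in> e - level n s 2" using e S' by blast
    ultimately have "e - level n s 2 \<in> resid n E s"
      unfolding resid_def using e by (intro in_red) auto
    then show False using assms by simp
  qed
  moreover have "level n s 1 \<in> Sol n E s" if "minimal_transversal {..<n} E (level n s 1)"
    using that by (auto simp: Sol_def level_def)
  ultimately show ?thesis by (auto simp: Sol_def)
qed

section \<open>From branches to child nodes\<close>

fun assign :: "(nat \<times> nat) list \<Rightarrow> (nat \<Rightarrow> nat) \<Rightarrow> status \<Rightarrow> status" where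
  "assign [] e s = s"
| "assign ((v, c) # br) e s = assign br e (s(e v := c))"

definition lits :: "(nat \<Rightarrow> nat) \<Rightarrow> nat \<Rightarrow> (nat \<times> nat) list \<Rightarrow> nat set" where
  "lits e c br = {e v |v. (v, c) \<in> set br}"

definition branch :: "(nat \<Rightarrow> nat) \<Rightarrow> (nat \<times> nat) list \<Rightarrow> nat set \<times> nat set" where
  "branch e br = (lits e 1 br, lits e 2 br)"

definition expands :: "nat \<Rightarrow> nat set set \<Rightarrow> status \<Rightarrow> status list \<Rightarrow> bool" where
  "expands n E s cs \<longleftrightarrow> (\<forall>c\<in>set cs. valid n c) \<and> Sol n E s = (\<Union>c\<in>set cs. Sol n E c) \<and>
     sorted_wrt (\<lambda>c d. Sol n E c \<inter> Sol n E d = {}) cs \<and> (\<Sum>c\<leftarrow>cs. Phi n E c) + 1 \<le> Phi n E s"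

text \<open>As no vertex receives both values, the order of the assignments is immaterial.\<close>

lemma assign_eq:
  assumes "lits e 1 br \<inter> lits e 2 br = {}" "\<forall>(v, c)\<in>set br. c = 1 \<or> c = 2"
  shows "assign br e s = (\<lambda>i. if i \<in> lits e 1 br then 1 else if i \<in> lits e 2 br then 2 else s i)"
  using assms
proof (induction br arbitrary: s)
  case (Cons a br)
  obtain v c where a: "a = (v, c)" by fastforce
  have l: "lits e c' (a # br) = (if c = c' then insert (e v) (lits e c' br) else lits e c' br)" for c'
    by (auto simp: a lits_def)
  have c: "c = 1 \<or> c = 2" using Cons.prems(2) a by auto
  have "lits e 1 br \<inter> lits e 2 br = {}" using Cons.prems(1) l by (auto split: if_splits)
  then have "assign br e (s(e v := c)) =
    (\<lambda>i. if i \<in> lits e 1 br then 1 else if i \<in> lits e 2 br then 2 else (s(e v := c)) i)"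
    using Cons by auto
  then show ?case using Cons.prems(1) c unfolding l by (auto simp: a fun_eq_iff split: if_splits)
qed (simp add: lits_def)

lemma assign_child:
  assumes E: "hypergraph {..<n} E" and s: "valid n s"
    and br: "\<forall>(v, c)\<in>set br. c = 1 \<or> c = 2" "lits e 1 br \<inter> lits e 2 br = {}"
    "lits e 1 br \<union> lits e 2 br \<subseteq> level n s 0"
  shows "valid n (assign br e s)"
    and "level n (assign br e s) 0 = level n s 0 - (lits e 1 br \<union> lits e 2 br)"
    and "resid n E (assign br e s) = red (lits e 1 br) (lits e 2 br) (resid n E s)"
    and "Sol n E (assign br e s) = {S \<in> Sol n E s. lits e 1 br \<subseteq> S \<and> lits e 2 br \<inter> S = {}}"
proof -
  note eq = assign_eq[OF br(2,1)]
  show "valid n (assign br e s)"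
    using s br(3) by (auto simp: eq valid_def level_def)
  show "level n (assign br e s) 0 = level n s 0 - (lits e 1 br \<union> lits e 2 br)"
    by (auto simp: eq level_def)
  have l1: "level n (assign br e s) 1 = level n s 1 \<union> lits e 1 br"
    using br(2,3) by (auto simp: eq level_def)
  have l2: "level n (assign br e s) 2 = level n s 2 \<union> lits e 2 br"
    using br(2,3) by (auto simp: eq level_def)
  have "lits e 1 br \<inter> level n s 2 = {}" using br(3) by (auto simp: level_def)
  then show "resid n E (assign br e s) = red (lits e 1 br) (lits e 2 br) (resid n E s)"
    unfolding resid_def l1 l2 by (rule red_red[symmetric])
  show "Sol n E (assign br e s) = {S \<in> Sol n E s. lits e 1 br \<subseteq> S \<and> lits e 2 br \<inter> S = {}}"
    unfolding Sol_def l1 l2 by blast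
qed

text \<open>Carries a rule from abstract residual families to search nodes. Coverage of the
  solutions comes from \<open>Sol_adm\<close>, and their disjointness from a vertex that one branch
  selects and the other discards.\<close>

lemma good_expands:
  assumes E: "hypergraph {..<n} E" and s: "valid n s"
    and br: "\<forall>br\<in>set brs. \<forall>(v, c)\<in>set br. c = 1 \<or> c = 2"
    and good: "good (resid n E s) (map (branch e) brs)"
  shows "expands n E s (map (\<lambda>br. assign br e s) brs)"
proof -
  let ?H = "resid n E s" and ?c = "\<lambda>br. assign br e s" and ?u = "real (card (level n s 0))"
  have b: "lits e 1 br \<union> lits e 2 br \<subseteq> \<Union>?H" "lits e 1 br \<inter> lits e 2 br = {}"
    "lits e 1 br \<union> lits e 2 br \<noteq> {}" if "br \<in> set brs" for br
    using good that by (auto simp: good_def branch_def)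
  have b0: "lits e 1 br \<union> lits e 2 br \<subseteq> level n s 0" if "br \<in> set brs" for br
    using b(1)[OF that] Union_resid[OF E s] by blast
  have br': "\<forall>(v, c)\<in>set br. c = 1 \<or> c = 2" if "br \<in> set brs" for br using br that by blast
  note ch = assign_child[OF E s br' b(2) b0]
  have Phi: "Phi n E (?c br) \<le> 2 * ?u * pot (red (lits e 1 br) (lits e 2 br) ?H)" if "br \<in> set brs" for br
  proof -
    have "level n (?c br) 0 \<subset> level n s 0" using ch(2)[OF that that that] b(3)[OF that] b0[OF that] by blast
    then have "card (level n (?c br) 0) < card (level n s 0)" by (intro psubset_card_mono) auto
    then have "real (card (level n (?c br) 0)) + 1 \<le> ?u" by simp
    then show ?thesis
      unfolding Phi_def ch(3)[OF that that that] using pot_pos[of "red (lits e 1 br) (lits e 2 br) ?H"]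
      by (intro mult_right_mono) auto
  qed
  have "(\<Sum>br\<leftarrow>brs. Phi n E (?c br)) \<le> (\<Sum>br\<leftarrow>brs. 2 * ?u * pot (red (lits e 1 br) (lits e 2 br) ?H))"
    by (rule sum_list_mono) (rule Phi)
  also have "\<dots> = 2 * ?u * (\<Sum>(A, B)\<leftarrow>map (branch e) brs. pot (red A B ?H))"
    by (simp add: sum_list_const_mult comp_def branch_def)
  also have "\<dots> \<le> 2 * ?u * pot ?H"
    using good by (intro mult_left_mono) (auto simp: good_def)
  \<comment> \<open>The difference is 2 * \<open>pot ?H\<close>, at least 80/67, and it pays for the
    visit of the node itself.\<close>
  also have "\<dots> \<le> Phi n E s - 1"
    using pot_ge[of ?H] by (simp add: Phi_def algebra_simps)
  finally have pot: "(\<Sum>c\<leftarrow>map ?c brs. Phi n E c) + 1 \<le> Phi n E s" by (simp add: comp_def)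
  have "S \<in> (\<Union>c\<in>set (map ?c brs). Sol n E c)" if S: "S \<in> Sol n E s" for S
  proof -
    have "adm ?H S" using S by (rule Sol_adm)
    moreover have "\<forall>S. adm ?H S \<longrightarrow> (\<exists>(A, B)\<in>set (map (branch e) brs). A \<subseteq> S \<and> B \<inter> S = {})"
      using good unfolding good_def by (elim conjE)
    ultimately obtain br where "br \<in> set brs" "lits e 1 br \<subseteq> S" "lits e 2 br \<inter> S = {}"
      by (auto simp: branch_def)
    then show ?thesis using S ch(4) by auto
  qed
  moreover have "Sol n E (?c br) \<subseteq> Sol n E s" if "br \<in> set brs" for br
    using ch(4)[OF that that that] by auto
  ultimately have Sol: "Sol n E s = (\<Union>c\<in>set (map ?c brs). Sol n E c)" by auto
  have "sorted_wrt (\<lambda>(A, B) (A', B'). A \<inter> B' \<union> B \<inter> A' \<noteq> {}) (map (branch e) brs)"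
    using good by (simp add: good_def)
  then have "sorted_wrt (\<lambda>br br'. Sol n E (?c br) \<inter> Sol n E (?c br') = {}) brs"
    unfolding sorted_wrt_map
  proof (rule sorted_wrt_mono_rel[rotated], goal_cases)
    case (1 br br')
    then show ?case using ch(4)[OF 1(1,1,1)] ch(4)[OF 1(2,2,2)] by (auto simp: branch_def)
  qed
  then show ?thesis using ch(1) Sol pot unfolding expands_def by (auto simp: sorted_wrt_map)
qed

section \<open>Depth-first search on the RAM\<close>

text \<open>Register 12 is the index and register 15 the number of rounds left. The body may read
  the index but must leave it unchanged.\<close>

definition forc :: "nat \<Rightarrow> com \<Rightarrow> com" where
  "forc b c = Ins (Const 12 0) ;; Ins (Sub 15 b 12) ;;
     While 15 (c ;; Ins (Add 12 12 3) ;; Ins (Sub 15 b 12))"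

lemma wp_forc:
  assumes P0: "P 0 M os"
    and upd: "\<And>j M os r x. P j M os \<Longrightarrow> r \<in> {2, 12, 15} \<Longrightarrow> P j (M(r := x)) os"
    and reg: "\<And>j M os. P j M os \<Longrightarrow> M b = B \<and> M 3 = 1"
    and body: "\<And>j M os. P j M os \<Longrightarrow> j < B \<Longrightarrow> M 12 = j \<Longrightarrow>
      wp c (\<lambda>k M' os'. k \<le> t \<and> P (Suc j) M' os' \<and> M' 12 = j) M os"
    and b: "b \<notin> {2, 12, 15}"
    and post: "\<And>k M os. P B M os \<Longrightarrow> k \<le> B * (t + 5) + 3 \<Longrightarrow> Q k M os"
  shows "wp (forc b c) Q M os"
proof -
  define I where "I = (\<lambda>j M os. P j M os \<and> j \<le> B \<and> M 12 = j \<and> M 15 = B - j)"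
  have "wp (While 15 (c ;; Ins (Add 12 12 3) ;; Ins (Sub 15 b 12))) (\<lambda>k. Q (2 + k))
      (M(12 := 0, 15 := B)) os"
  proof (rule wp_loop[where I = I and N = B and t = "t + 2"], goal_cases)
    case 1
    show ?case using P0 by (simp add: I_def upd)
  next
    case (2 j M os)
    then have I: "P j M os" "M 12 = j" "j < B" by (auto simp: I_def)
    show ?case
      unfolding wp_Seq
    proof (intro conjI I(3), rule wp_mono[OF body[OF I(1,3,2)]], goal_cases)
      case (1 k M' os')
      then have P: "P (Suc j) M' os'" by simp
      moreover have "M' b = B" "M' 3 = 1" using reg[OF P] by auto
      ultimately show ?case using 1 b I(3) by (auto simp: I_def upd)
    qed
  next
    case (3 j k M os)
    then have "j = B" by (simp add: I_def)
    then show ?case using 3 by (intro post) (auto simp: I_def algebra_simps)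
  qed
  moreover have "M b = B" using reg[OF P0] by simp
  ultimately show ?thesis using b by (simp add: forc_def)
qed

definition copyc :: "nat \<Rightarrow> nat \<Rightarrow> com" where
  "copyc a b = forc 8 (Ins (Add 13 a 12) ;; Ins (Load 14 13) ;; Ins (Add 13 b 12) ;; Ins (Store 13 14))"

lemma wp_copyc:
  assumes M: "M a = p" "M b = q" "M 8 = Suc n" "M 3 = 1"
    and ab: "a \<notin> {2, 12, 13, 14, 15}" "b \<notin> {2, 12, 13, 14, 15}" "a < 52" "b < 52"
    and q: "52 \<le> p" "52 \<le> q" and disj: "p + n < q \<or> q + n < p"
  shows "wp (copyc a b) (\<lambda>k M' os'. os' = os \<and> k \<le> Suc n * 9 + 3 \<and> (\<forall>i\<le>n. M' (q + i) = M (p + i)) \<and>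
    (\<forall>x. x \<notin> {2, 12, 13, 14, 15} \<longrightarrow> \<not> (q \<le> x \<and> x \<le> q + n) \<longrightarrow> M' x = M x)) M os"
proof -
  define P where "P = (\<lambda>j M' os'. os' = os \<and> (\<forall>i<j. M' (q + i) = M (p + i)) \<and>
    (\<forall>x. x \<notin> {2, 12, 13, 14, 15} \<longrightarrow> \<not> (q \<le> x \<and> x < q + j) \<longrightarrow> M' x = M x))"
  show ?thesis
    unfolding copyc_def
  proof (rule wp_forc[where P = P and B = "Suc n" and t = 4], goal_cases)
    case 1
    show ?case by (simp add: P_def)
  next
    case (2 j M' os' r x)
    then show ?case using q by (auto simp: P_def)
  next
    case (3 j M' os')
    then show ?case using M q by (auto simp: P_def)
  next
    case (4 j M' os')
    then have P: "os' = os" "\<And>i. i < j \<Longrightarrow> M' (q + i) = M (p + i)"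
      "\<And>x. x \<notin> {2, 12, 13, 14, 15} \<Longrightarrow> \<not> (q \<le> x \<and> x < q + j) \<Longrightarrow> M' x = M x"
      by (auto simp: P_def)
    have regs: "M' a = p" "M' b = q" using P(3)[of a] P(3)[of b] ab q M by auto
    have val: "M' (p + j) = M (p + j)" using q disj 4 by (intro P(3)) auto
    let ?M = "M'(13 := p + j, 14 := M (p + j), 13 := q + j, q + j := M (p + j))"
    have "?M (q + i) = M (p + i)" if "i < Suc j" for i
      using that P(2)[of i] q by (auto simp: less_Suc_eq)
    moreover have "?M x = M x" if "x \<notin> {2, 12, 13, 14, 15}" "\<not> (q \<le> x \<and> x < q + Suc j)" for x
      using that P(3)[of x] by auto
    ultimately have "P (Suc j) ?M os'" using P(1) by (simp add: P_def)
    then show ?case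
      using regs val ab q 4(3) by simp
  next
    case (6 k M' os')
    then show ?case by (auto simp: P_def less_Suc_eq_le)
  qed auto
qed

fun litsc :: "(nat \<times> nat) list \<Rightarrow> com" where
  "litsc [] = Skip"
| "litsc ((v, c) # br) = Ins (Add 13 9 (24 + v)) ;; Ins (Const 14 c) ;; Ins (Store 13 14) ;; litsc br"

lemma assign_cong: "(\<And>v c. (v, c) \<in> set br \<Longrightarrow> e v = e' v) \<Longrightarrow> assign br e s = assign br e' s"
  by (induction br e s rule: assign.induct) (auto, metis)

lemma assign_cong_state:
  "(\<And>i. i \<le> n \<Longrightarrow> s i = s' i) \<Longrightarrow> i \<le> n \<Longrightarrow> assign br e s i = assign br e s' i"
proof (induction br e s arbitrary: s' rule: assign.induct)
  case (2 v c br e s)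
  show ?case unfolding assign.simps by (rule "2.IH") (use "2.prems" in auto)
qed simp

lemma wp_litsc:
  assumes "M 9 = q" "52 \<le> q" "\<forall>(v, c)\<in>set br. v < 28 \<and> env M v \<le> n"
  shows "wp (litsc br) (\<lambda>k M' os'. os' = os \<and> k \<le> 3 * length br \<and>
    (\<forall>x. x \<notin> {13, 14} \<longrightarrow> \<not> (q \<le> x \<and> x \<le> q + n) \<longrightarrow> M' x = M x) \<and>
    (\<lambda>i. M' (q + i)) = assign br (env M) (\<lambda>i. M (q + i))) M os"
  using assms
proof (induction br arbitrary: M os)
  case (Cons l br)
  obtain v c where l: "l = (v, c)" by fastforce
  let ?M = "M(13 := q + env M v, 14 := c, q + env M v := c)"
  have v: "v < 28" "env M v \<le> n" using Cons.prems l by auto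
  have env: "env ?M w = env M w" if "w < 28" for w
    using that Cons.prems(2) by (auto simp: env_def)
  have "wp (litsc br) (\<lambda>k M' os'. os' = os \<and> k \<le> 3 * length br \<and>
    (\<forall>x. x \<notin> {13, 14} \<longrightarrow> \<not> (q \<le> x \<and> x \<le> q + n) \<longrightarrow> M' x = ?M x) \<and>
    (\<lambda>i. M' (q + i)) = assign br (env ?M) (\<lambda>i. ?M (q + i))) ?M os"
  proof (rule Cons.IH)
    show "?M 9 = q" using Cons.prems(1,2) by simp
    show "\<forall>(v, c)\<in>set br. v < 28 \<and> env ?M v \<le> n"
    proof (clarify, intro conjI)
      fix a b assume ab: "(a, b) \<in> set br"
      then show "a < 28" using Cons.prems(3) by auto
      moreover have "env M a \<le> n" using ab Cons.prems(3) by auto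
      ultimately show "env ?M a \<le> n" by (simp only: env)
    qed
  qed (rule Cons.prems(2))
  moreover have "(\<lambda>i. ?M (q + i)) = (\<lambda>i. M (q + i))(env M v := c)"
    using Cons.prems(2) by auto
  moreover have "assign br (env ?M) s = assign br (env M) s" for s
  proof (rule assign_cong)
    fix a b assume "(a, b) \<in> set br"
    then have "a < 28" using Cons.prems(3) by auto
    then show "env ?M a = env M a" by (rule env)
  qed
  ultimately have w: "wp (litsc br) (\<lambda>k M' os'. os' = os \<and> k \<le> 3 * length br \<and>
    (\<forall>x. x \<notin> {13, 14} \<longrightarrow> \<not> (q \<le> x \<and> x \<le> q + n) \<longrightarrow> M' x = ?M x) \<and>
    (\<lambda>i. M' (q + i)) = assign br (env M) ((\<lambda>i. M (q + i))(env M v := c))) ?M os"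
    by (simp only:)
  have M9: "M 9 = q" "q \<noteq> 13" "13 \<noteq> q" using Cons.prems by auto
  show ?case
    unfolding l litsc.simps wp_Seq wp_instr
    using M9 Cons.prems(2) v
    apply (simp add: env_def[symmetric])
    apply (rule wp_mono[OF w])
    apply (auto simp: env_def)
    done
qed simp

text \<open>A child is a full copy of the current status with the decided vertices overwritten.
  Storing whole nodes of n + 1 cells means that nothing has to be undone on backtracking.\<close>

definition push :: "(nat \<times> nat) list \<Rightarrow> com" where
  "push br = copyc 23 9 ;; litsc br ;; Ins (Add 9 9 8)"

fun pushes :: "(nat \<times> nat) list list \<Rightarrow> com" where
  "pushes [] = Skip"
| "pushes (br # brs) = push br ;; pushes brs"

definition testc :: com where
  "testc = Ins (Add 13 23 12) ;; Ins (Load 7 13) ;; Ins (Sub 5 7 3) ;; Ins (Sub 6 3 7) ;; Ins (Add 5 5 6)"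

text \<open>The output format puts the size before the elements, so one pass counts the selected
  vertices and a second one prints them.\<close>

definition outputc :: com where
  "outputc = Ins (Const 14 0) ;; forc 0 (testc ;; If 5 Skip (Ins (Add 14 14 3))) ;; Ins (Out 14) ;;
     forc 0 (testc ;; If 5 Skip (Ins (Out 12)))"

text \<open>A rule is a formula together with its branches; a branch lists pairs of a formula variable,
  evaluated at the witness of the leading quantifiers, and the status it assigns.\<close>

type_synonym rules = "(fm \<times> (nat \<times> nat) list list) list"

fun rulesc :: "fm \<Rightarrow> rules \<Rightarrow> com" where
  "rulesc lf [] = eval_fm lf ;; If 4 outputc Skip"
| "rulesc lf ((p, brs) # rs) = eval_fm p ;; If 4 (pushes brs) (rulesc lf rs)"

text \<open>The stack occupies the cells from the address in register 10 up to that in register 9. A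
  node is copied into the status array before its rules are tried, so its children may overwrite the
  block it came from.\<close>

definition searchc :: "fm \<Rightarrow> rules \<Rightarrow> com" where
  "searchc lf rs = Ins (Sub 16 9 10) ;;
     While 16 (Ins (Sub 9 9 8) ;; copyc 9 23 ;; rulesc lf rs ;; Ins (Sub 16 9 10))"

definition push_cost :: "nat \<Rightarrow> (nat \<times> nat) list \<Rightarrow> nat" where
  "push_cost N br = Suc N * 9 + 4 + 3 * length br"

fun rules_cost :: "nat \<Rightarrow> fm \<Rightarrow> rules \<Rightarrow> nat" where
  "rules_cost N lf [] = cost N lf + 2 * (N * 14 + 3) + 5"
| "rules_cost N lf ((p, brs) # rs) = cost N p + 3 + sum_list (map (push_cost N) brs) + rules_cost N lf rs"

definition wf_rules :: "rules \<Rightarrow> bool" where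
  "wf_rules rs \<longleftrightarrow> (\<forall>(p, brs)\<in>set rs. wf_fm p \<and> fv p = {} \<and>
     (\<forall>br\<in>set brs. \<forall>(v, c)\<in>set br. v < 28 \<and> (c = 1 \<or> c = 2)))"

text \<open>The first applicable rule is used with whichever witness the loops find, so every
  witness must give a correct expansion. If no rule applies, the residual family must be empty, as
  the leaf test relies on it.\<close>

fun rules_spec :: "nat \<Rightarrow> nat \<Rightarrow> nat set set \<Rightarrow> (nat \<Rightarrow> nat \<Rightarrow> nat) \<Rightarrow> rules \<Rightarrow> bool" where
  "rules_spec n m E arr [] = (resid n E (arr 3) = {})"
| "rules_spec n m E arr ((p, brs) # rs) =
    (if sat n m arr p (\<lambda>_. 0)
     then \<forall>e. wit n m arr p e \<longrightarrow> expands n E (arr 3) (map (\<lambda>br. assign br e (arr 3)) brs) \<and>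
       (\<forall>br\<in>set brs. \<forall>(v, c)\<in>set br. e v < n)
     else rules_spec n m E arr rs)"

text \<open>A common postcondition for leaves and inner nodes: the outputs and the solutions below
  the children partition the solutions of \<open>s\<close>. The summand 1 is the budget that the
  visit consumes.\<close>

definition processed :: "nat \<Rightarrow> nat set set \<Rightarrow> status \<Rightarrow> status list \<Rightarrow> nat list list \<Rightarrow> bool" where
  "processed n E s cs ts \<longleftrightarrow> (\<forall>c\<in>set cs. valid n c) \<and> distinct (map set ts) \<and>
     set (map set ts) \<union> (\<Union>c\<in>set cs. Sol n E c) = Sol n E s \<and>
     set (map set ts) \<inter> (\<Union>c\<in>set cs. Sol n E c) = {} \<and>
     sorted_wrt (\<lambda>c d. Sol n E c \<inter> Sol n E d = {}) cs \<and> (\<Sum>c\<leftarrow>cs. Phi n E c) + 1 \<le> Phi n E s"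

lemma Phi_ge_1: "1 \<le> Phi n E s"
proof -
  have "1 \<le> (2 * (0 + 1)) * (40/67::real)" by simp
  also have "\<dots> \<le> Phi n E s"
    unfolding Phi_def using pot_ge by (intro mult_mono) auto
  finally show ?thesis .
qed

text \<open>The layout above the 52 registers: three edge arrays of m cells with fixed contents
  \<open>X\<close>, the status array of n + 1 cells, and the stack from \<open>sb\<close> on, which
  may grow without limit.\<close>

locale ram =
  fixes n m :: nat and ba :: "nat \<Rightarrow> nat" and sb :: nat and X :: "nat \<Rightarrow> nat \<Rightarrow> nat"
  assumes ba: "a < 4 \<Longrightarrow> 52 \<le> ba a" "a < 3 \<Longrightarrow> ba a + m \<le> ba 3" and sb: "ba 3 + n < sb"
begin

definition core :: "memory \<Rightarrow> bool" where
  "core M \<longleftrightarrow> M 0 = n \<and> M 18 = m \<and> M 3 = 1 \<and> M 8 = Suc n \<and> M 10 = sb \<and>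
     (\<forall>a<4. M (20 + a) = ba a) \<and> (\<forall>a<3. \<forall>j<m. M (ba a + j) = X a j)"

definition stat :: "memory \<Rightarrow> status \<Rightarrow> bool" where
  "stat M s \<longleftrightarrow> (\<forall>i\<le>n. M (ba 3 + i) = s i)"

definition stack :: "status list \<Rightarrow> memory \<Rightarrow> bool" where
  "stack ss M \<longleftrightarrow> M 9 = sb + length ss * Suc n \<and>
     (\<forall>k<length ss. \<forall>i\<le>n. M (sb + k * Suc n + i) = (ss ! k) i)"

definition scratch :: "nat set" where
  "scratch = {2, 4, 5, 6, 7, 9, 12, 13, 14, 15, 16} \<union> {24..<52}"

text \<open>\<open>core\<close> mentions only cells below the status array, so no write to that
  array or to the stack can disturb it.\<close>

lemma core_frame:
  assumes "core M" "\<And>x. x \<notin> scratch \<Longrightarrow> x < ba 3 \<Longrightarrow> M' x = M x"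
  shows "core M'"
proof -
  have b: "52 \<le> ba 3" using ba by simp
  have "M' x = M x" if "x \<in> {0, 3, 8, 10, 18}" for x
    using that b by (intro assms(2)) (auto simp: scratch_def)
  moreover have "M' (20 + a) = M (20 + a)" if "a < 4" for a
    using that b by (intro assms(2)) (auto simp: scratch_def)
  moreover have "M' (ba a + j) = M (ba a + j)" if "a < 3" "j < m" for a j
    using that ba[of a] by (intro assms(2)) (auto simp: scratch_def)
  ultimately show ?thesis using assms(1) by (simp add: core_def)
qed

lemma stack_frame:
  assumes "stack ss M" "M' 9 = M 9"
    and "\<And>x. sb \<le> x \<Longrightarrow> x < sb + length ss * Suc n \<Longrightarrow> M' x = M x"
  shows "stack ss M'"
proof -
  have "M' (sb + k * Suc n + i) = M (sb + k * Suc n + i)" if "k < length ss" "i \<le> n" for k i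
  proof (rule assms(3))
    have "Suc k * Suc n \<le> length ss * Suc n" using that by (intro mult_le_mono1) auto
    then show "sb + k * Suc n + i < sb + length ss * Suc n" using that by simp
  qed auto
  then show ?thesis using assms(1,2) by (auto simp: stack_def)
qed

lemma stat_frame:
  assumes "stat M s" "\<And>x. ba 3 \<le> x \<Longrightarrow> x \<le> ba 3 + n \<Longrightarrow> M' x = M x"
  shows "stat M' s"
  using assms by (auto simp: stat_def)

lemma ctx_core: "core M \<Longrightarrow> (\<And>a i. a < 4 \<Longrightarrow> arr a i = M (ba a + i)) \<Longrightarrow> ctx n m arr M"
  using ba(1) by (auto simp: core_def ctx_def)

lemma agree_same:
  assumes "agree W M M'" "W \<subseteq> {..<28}" "x \<notin> scratch \<or> 52 \<le> x \<or> x = 9"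
  shows "M' x = M x"
proof -
  have x: "x \<notin> {2, 4, 5, 6}" "24 \<le> x \<Longrightarrow> 28 \<le> x - 24" using assms(3) by (auto simp: scratch_def)
  then have "24 \<le> x \<longrightarrow> x - 24 \<notin> W" using assms(2) by force
  then show ?thesis using assms(1) x(1) unfolding agree_def by blast
qed

lemma wp_push:
  assumes "core M" "stat M s" "stack ss M" "\<forall>(v, c)\<in>set br. v < 28 \<and> env M v \<le> n" "n \<le> N"
  shows "wp (push br) (\<lambda>k M' os'. os' = os \<and> k \<le> push_cost N br \<and> core M' \<and> stat M' s \<and>
    stack (ss @ [assign br (env M) s]) M' \<and> (\<forall>v<28. env M' v = env M v)) M os"
proof -
  let ?q = "sb + length ss * Suc n"
  have b52: "52 \<le> ba 3" using ba by simp
  have q: "M 9 = ?q" "52 \<le> ?q" "ba 3 + n < ?q" using assms(3) sb b52 by (auto simp: stack_def)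
  have r: "M 23 = ba 3" "M 8 = Suc n" "M 3 = 1"
  proof -
    have "\<forall>a<4. M (20 + a) = ba a" using assms(1) by (simp add: core_def)
    from this[rule_format, of 3] show "M 23 = ba 3" by simp
  qed (use assms(1) in \<open>auto simp: core_def\<close>)
  show ?thesis
    unfolding push_def wp_Seq
  proof (rule wp_mono[OF wp_copyc[OF r(1) q(1) r(2,3)]], goal_cases)
    case (8 k1 M1 os1)
    have M1: "M1 x = M x" if "x \<notin> {2, 12, 13, 14, 15}" "\<not> (?q \<le> x \<and> x \<le> ?q + n)" for x
      using 8 that by blast
    have M1q: "M1 (?q + i) = s i" if "i \<le> n" for i
      using 8 that assms(2) by (auto simp: stat_def)
    have env1: "env M1 v = env M v" if "v < 28" for v
      unfolding env_def using that q(2) by (intro M1) auto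
    have q1: "M1 9 = ?q" using M1[of 9] q by auto
    show ?case
    proof (rule wp_mono[OF wp_litsc[where M = M1 and q = ?q and n = n, OF q1 q(2)]], goal_cases)
      case 1
      then show ?case using assms(4) env1 by auto
    next
      case (2 k2 M2 os2)
      have M2: "M2 x = M x" if "x \<notin> {2, 12, 13, 14, 15}" "\<not> (?q \<le> x \<and> x \<le> ?q + n)" for x
        using 2 that M1[OF that] by auto
      let ?M = "M2(9 := M2 9 + M2 8)"
      have q2: "M2 9 = ?q" "M2 8 = Suc n" using M2[of 9] M2[of 8] q r by auto
      have q3: "?M 9 = sb + Suc (length ss) * Suc n" using q2 by simp
      have "assign br (env M1) (\<lambda>i. M1 (?q + i)) = assign br (env M) (\<lambda>i. M1 (?q + i))"
        by (rule assign_cong) (use assms(4) env1 in auto)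
      then have M2q: "M2 (?q + i) = assign br (env M) s i" if "i \<le> n" for i
      proof -
        have "M2 (?q + i) = assign br (env M1) (\<lambda>i. M1 (?q + i)) i" using 2 by metis
        also have "\<dots> = assign br (env M) (\<lambda>i. M1 (?q + i)) i"
          using \<open>assign br (env M1) (\<lambda>i. M1 (?q + i)) = _\<close> by simp
        also have "\<dots> = assign br (env M) s i"
          by (rule assign_cong_state[OF _ that]) (use M1q in auto)
        finally show ?thesis .
      qed
      have "core ?M"
        by (rule core_frame[OF assms(1)]) (use M2 q in \<open>auto simp: scratch_def\<close>)
      moreover have "stat ?M s"
        by (rule stat_frame[OF assms(2)]) (use M2 q b52 in auto)
      moreover have "stack (ss @ [assign br (env M) s]) ?M"
      proof -
        have "?M (sb + k * Suc n + i) = ((ss @ [assign br (env M) s]) ! k) i"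
          if "k < Suc (length ss)" "i \<le> n" for k i
        proof (cases "k = length ss")
          case True
          then show ?thesis using M2q[OF that(2)] q(2) by (auto simp: nth_append)
        next
          case False
          then have k: "k < length ss" using that by simp
          have "Suc k * Suc n \<le> length ss * Suc n" using k by (intro mult_le_mono1) auto
          then have "sb + k * Suc n + i < ?q" using that by simp
          then have "?M (sb + k * Suc n + i) = M (sb + k * Suc n + i)"
            using M2[of "sb + k * Suc n + i"] sb b52 by auto
          then show ?thesis using assms(3) k that by (auto simp: stack_def nth_append)
        qed
        moreover have "length (ss @ [assign br (env M) s]) = Suc (length ss)" by simp
        ultimately show ?thesis using q3 unfolding stack_def by presburger
      qed
      moreover have "env ?M v = env M v" if "v < 28" for v
        unfolding env_def using that q(2) M2[of "24 + v"] by auto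
      moreover have "k1 + (k2 + 1) \<le> push_cost N br"
        using 2 8 assms(5) by (auto simp: push_cost_def)
      ultimately show ?case using 2 8 by (auto simp: add.assoc)
    qed
  qed (use b52 q in auto)
qed

lemma wp_pushes:
  assumes "core M" "stat M s" "stack ss M" "\<forall>br\<in>set brs. \<forall>(v, c)\<in>set br. v < 28 \<and> env M v \<le> n" "n \<le> N"
  shows "wp (pushes brs) (\<lambda>k M' os'. os' = os \<and> k \<le> sum_list (map (push_cost N) brs) \<and> core M' \<and>
    stack (ss @ map (\<lambda>br. assign br (env M) s) brs) M') M os"
  using assms
proof (induction brs arbitrary: M os ss)
  case (Cons br brs)
  show ?case
    unfolding pushes.simps wp_Seq
  proof (rule wp_mono[OF wp_push[OF Cons.prems(1-3), where N = N]], goal_cases)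
    case (3 k1 M1 os1)
    have eq': "assign br' (env M1) s = assign br' (env M) s" if "br' \<in> set brs" for br'
    proof (rule assign_cong)
      fix v c assume "(v, c) \<in> set br'"
      then have "v < 28" using Cons.prems(4) that by auto
      then show "env M1 v = env M v" using 3 by blast
    qed
    have lits: "\<forall>br'\<in>set brs. \<forall>(v, c)\<in>set br'. v < 28 \<and> env M1 v \<le> n"
    proof (clarify, intro conjI)
      fix br' v c assume vc: "br' \<in> set brs" "(v, c) \<in> set br'"
      then show "v < 28" using Cons.prems(4) by auto
      then have "env M1 v = env M v" using 3 by blast
      then show "env M1 v \<le> n" using vc Cons.prems(4) by auto
    qed
    have eq: "map (\<lambda>br. assign br (env M1) s) brs = map (\<lambda>br. assign br (env M) s) brs"
      using eq' by auto
    show ?case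
    proof (rule wp_mono[OF Cons.IH[where ss = "ss @ [assign br (env M) s]"]], goal_cases)
      case (6 k2 M2 os2)
      then show ?case using 3 eq by auto
    qed (use 3 lits Cons.prems in auto)
  qed (use Cons.prems in auto)
qed simp


definition ones :: "status \<Rightarrow> nat \<Rightarrow> nat list" where
  "ones s j = filter (\<lambda>i. s i = 1) [0..<j]"

lemma core_regs:
  assumes "core M"
  shows "M 0 = n" "M 3 = 1" "M 8 = Suc n" "M 10 = sb" "M 23 = ba 3"
proof -
  have "\<forall>a<4. M (20 + a) = ba a" using assms by (simp add: core_def)
  from this[rule_format, of 3] show "M 23 = ba 3" by simp
qed (use assms in \<open>auto simp: core_def\<close>)

lemma wp_testc:
  assumes "M 3 = 1" "M 23 = ba 3" "M 12 = j"
    and Q: "\<And>M'. (\<And>x. x \<notin> {5, 6, 7, 13} \<Longrightarrow> M' x = M x) \<Longrightarrow> M' 5 = 0 \<longleftrightarrow> M (ba 3 + j) = 1 \<Longrightarrow> Q (1 + (1 + (1 + (1 + 1)))) M' os"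
  shows "wp testc Q M os"
proof -
  have "ba 3 + j \<noteq> 13" using ba(1)[of 3] by simp
  then show ?thesis
    unfolding testc_def wp_Seq wp_instr
    by (intro Q) (use assms(1-3) ba(1)[of 3] in auto)
qed

lemma wp_outputc:
  assumes "core M" "stat M s"
  shows "wp outputc (\<lambda>k M' os'. k \<le> 2 * (n * 14 + 3) + 2 \<and> os' = os @ encode_sets [ones s n] \<and>
    (\<forall>x. x \<notin> {2, 5, 6, 7, 12, 13, 14, 15} \<longrightarrow> M' x = M x)) M os"
proof -
  define F where "F = (\<lambda>M'. \<forall>x. x \<notin> {2, 5, 6, 7, 12, 13, 14, 15} \<longrightarrow> M' x = M x)"
  note r = core_regs[OF assms(1)]
  have F: "M' 0 = n" "M' 3 = 1" "M' 23 = ba 3" "j < n \<Longrightarrow> M' (ba 3 + j) = s j" if "F M'" for M' j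
    using that r assms(2) ba(1)[of 3] by (auto simp: F_def stat_def)
  have F_upd: "F M' \<Longrightarrow> x \<in> {2, 5, 6, 7, 12, 13, 14, 15} \<Longrightarrow> F (M'(x := y))" for M' x y
    by (auto simp: F_def)
  have F_trans: "F M' \<Longrightarrow> (\<And>x. x \<notin> {5, 6, 7, 13} \<Longrightarrow> M'' x = M' x) \<Longrightarrow> F M''" for M' M''
    by (auto simp: F_def)
  define P1 where "P1 = (\<lambda>j M' os'. os' = os \<and> F M' \<and> M' 14 = length (ones s j))"
  define P2 where "P2 = (\<lambda>j M' os'. os' = os @ [length (ones s n)] @ ones s j \<and> F M')"
  have ones_Suc: "ones s (Suc j) = (if s j = 1 then ones s j @ [j] else ones s j)" for j
    by (simp add: ones_def)
  have second: "wp (forc 0 (testc ;; If 5 Skip (Ins (Out 12)))) (\<lambda>k M' os'. k \<le> n * 14 + 3 \<and> P2 n M' os') M' os'"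
    if "P2 0 M' os'" for M' os'
  proof (rule wp_forc[where P = P2 and B = n and t = 9, OF that], goal_cases)
    case (1 j M os r x)
    then show ?case using F_upd by (auto simp: P2_def)
  next
    case (2 j M os)
    then show ?case using F by (auto simp: P2_def)
  next
    case (3 j M os)
    then have "F M" by (simp add: P2_def)
    show ?case
      unfolding wp_Seq
      apply (rule wp_testc[OF F(2)[OF \<open>F M\<close>] F(3)[OF \<open>F M\<close>] 3(3)])
      using 3 F(4)[OF \<open>F M\<close>] F_trans[OF \<open>F M\<close>] F_upd by (auto simp: P2_def ones_Suc)
  qed auto
  have first: "wp (forc 0 (testc ;; If 5 Skip (Ins (Add 14 14 3)))) (\<lambda>k M' os'. k \<le> n * 14 + 3 \<and> P1 n M' os') M' os'"
    if "P1 0 M' os'" for M' os'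
  proof (rule wp_forc[where P = P1 and B = n and t = 9, OF that], goal_cases)
    case (1 j M os r x)
    then show ?case using F_upd by (auto simp: P1_def)
  next
    case (2 j M os)
    then show ?case using F by (auto simp: P1_def)
  next
    case (3 j M os)
    then have "F M" by (simp add: P1_def)
    show ?case
      unfolding wp_Seq
      apply (rule wp_testc[OF F(2)[OF \<open>F M\<close>] F(3)[OF \<open>F M\<close>] 3(3)])
      using 3 F(2,4)[OF \<open>F M\<close>] F_trans[OF \<open>F M\<close>] F_upd by (auto simp: P1_def ones_Suc)
  qed auto
  have P10: "P1 0 (M(14 := 0)) os" by (auto simp: P1_def F_def ones_def)
  show ?thesis
    unfolding outputc_def wp_Seq wp_instr
  proof (rule wp_mono[OF first[OF P10]], goal_cases)
    case (1 k1 M1 os1)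
    then have "P2 0 M1 (os1 @ [M1 14])" by (auto simp: P1_def P2_def ones_def)
    then show ?case
      by (rule wp_mono[OF second]) (use 1 in \<open>auto simp: P2_def F_def encode_sets_def\<close>)
  qed
qed

lemma set_ones: "set (ones s n) = level n s 1"
  by (auto simp: ones_def level_def)

lemma processed_leaf:
  assumes "resid n E s = {}"
  shows "processed n E s [] (if minimal_transversal {..<n} E (level n s 1) then [ones s n] else [])"
  using Sol_leaf[OF assms] Phi_ge_1[of n E s] by (auto simp: processed_def set_ones)

lemma processed_expands: "expands n E s cs \<Longrightarrow> processed n E s cs []"
  by (auto simp: processed_def expands_def)

lemma wp_rulesc:
  assumes "core M" "stack ss M" "wf_rules rs" "wf_fm lf" "fv lf = {}" "n \<le> N" "m \<le> N"
    and "\<And>a i. a < 4 \<Longrightarrow> arr a i = M (ba a + i)"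
    and "sat n m arr lf (\<lambda>_. 0) \<longleftrightarrow> minimal_transversal {..<n} E (level n (arr 3) 1)"
    and "rules_spec n m E arr rs"
  shows "wp (rulesc lf rs) (\<lambda>k M' os'. k \<le> rules_cost N lf rs \<and> core M' \<and>
    (\<exists>cs ts. stack (ss @ cs) M' \<and> os' = os @ encode_sets ts \<and> processed n E (arr 3) cs ts)) M os"
  using assms(1-3,8,10)
proof (induction rs arbitrary: M os)
  case Nil
  have ctx: "ctx n m arr M" by (rule ctx_core) (use Nil.prems(1,4) in auto)
  show ?case
    unfolding rulesc.simps wp_Seq
  proof (rule wp_mono[OF eval_fm_correct[OF assms(4) ctx assms(6,7)]], goal_cases)
    case (1 k M1 os1)
    have same: "M1 x = M x" if "x \<notin> scratch \<or> 52 \<le> x \<or> x = 9" for x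
      using 1 that wf_vars[OF assms(4)] agree_same by blast
    have core1: "core M1" by (rule core_frame[OF Nil.prems(1)]) (use same in auto)
    have b52: "52 \<le> ba 3" using ba by simp
    have stack1: "stack ss M1" by (rule stack_frame[OF Nil.prems(2)]) (use same sb b52 in auto)
    have stat1: "stat M1 (arr 3)" using Nil.prems(4)[of 3] same b52 by (simp add: stat_def)
    have sat: "sat n m arr lf (env M) = sat n m arr lf (\<lambda>_. 0)"
      by (rule sat_cong) (simp add: assms(5))
    have p: "processed n E (arr 3) [] (if sat n m arr lf (\<lambda>_. 0) then [ones (arr 3) n] else [])"
      using processed_leaf[of E "arr 3"] Nil.prems(5) assms(9) by simp
    show ?case
    proof (cases "M1 4 = 0")
      case True
      then have "\<not> sat n m arr lf (\<lambda>_. 0)" using 1 sat by auto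
      then have "processed n E (arr 3) [] []" using p by simp
      moreover have "os1 = os @ encode_sets []" using 1 by (simp add: encode_sets_def)
      moreover have "stack (ss @ []) M1" using stack1 by simp
      moreover have "k + 1 \<le> rules_cost N lf []" using 1 by simp
      ultimately show ?thesis using True core1 unfolding wp_If wp_Skip
        by (simp only: refl not_True_eq_False if_False add_0) blast
    next
      case False
      then have "sat n m arr lf (\<lambda>_. 0)" using 1 sat by auto
      then have p: "processed n E (arr 3) [] [ones (arr 3) n]" using p by simp
      show ?thesis using False unfolding wp_If
        apply simp
      proof (rule wp_mono[OF wp_outputc[OF core1 stat1]], goal_cases)
        case (1 k2 M2 os2)
        have same2: "(M2(2 := 0)) x = M1 x" if "x \<notin> scratch \<or> 52 \<le> x \<or> x = 9" for x
          using 1 that unfolding scratch_def by auto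
        have "core (M2(2 := 0))" by (rule core_frame[OF core1], rule same2) simp
        moreover have "stack (ss @ []) (M2(2 := 0))"
          unfolding append_Nil2 by (rule stack_frame[OF stack1]; rule same2) (use sb b52 in auto)
        moreover have "k + k2 \<le> 8 + (cost N lf + 28 * N)"
          using 1 \<open>os1 = os \<and> k \<le> cost N lf \<and> _\<close> mult_le_mono1[OF assms(6), of 14] by simp
        moreover have "os2 = os @ encode_sets [ones (arr 3) n]"
          using 1 \<open>os1 = os \<and> k \<le> cost N lf \<and> _\<close> by simp
        ultimately show ?case using p by blast
      qed
    qed
  qed
next
  case (Cons r rs)
  obtain p brs where r: "r = (p, brs)" by fastforce
  have wf: "wf_fm p" "fv p = {}" "\<forall>br\<in>set brs. \<forall>(v, c)\<in>set br. v < 28 \<and> (c = 1 \<or> c = 2)" "wf_rules rs"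
    using Cons.prems(3) by (auto simp: wf_rules_def r)
  have ctx: "ctx n m arr M" by (rule ctx_core) (use Cons.prems(1,4) in auto)
  show ?case
    unfolding r rulesc.simps wp_Seq
  proof (rule wp_mono[OF eval_fm_correct[OF wf(1) ctx assms(6,7)]], goal_cases)
    case (1 k M1 os1)
    note ev = this
    have same: "M1 x = M x" if "x \<notin> scratch \<or> 52 \<le> x \<or> x = 9" for x
      using 1 that wf_vars[OF wf(1)] agree_same by blast
    have core1: "core M1" by (rule core_frame[OF Cons.prems(1)]) (use same in auto)
    have b52: "52 \<le> ba a" if "a < 4" for a using ba that by simp
    have stack1: "stack ss M1" by (rule stack_frame[OF Cons.prems(2)]) (use same sb b52[of 3] in auto)
    have stat1: "stat M1 (arr 3)" using Cons.prems(4)[of 3] same b52[of 3] by (simp add: stat_def)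
    have sat: "sat n m arr p (env M) = sat n m arr p (\<lambda>_. 0)"
      by (rule sat_cong) (simp add: wf(2))
    show ?case
    proof (cases "M1 4 = 0")
      case True
      then have not: "\<not> sat n m arr p (\<lambda>_. 0)" using 1 sat by auto
      have arr1: "arr a i = M1 (ba a + i)" if "a < 4" for a i
        using Cons.prems(4)[OF that] same b52[OF that] by simp
      have ih: "wp (rulesc lf rs) (\<lambda>k M' os'. k \<le> rules_cost N lf rs \<and> core M' \<and>
        (\<exists>cs ts. stack (ss @ cs) M' \<and> os' = os1 @ encode_sets ts \<and> processed n E (arr 3) cs ts)) M1 os1"
        by (rule Cons.IH[OF core1 stack1 wf(4) arr1]) (use Cons.prems(5) not r in auto)
      show ?thesis
        using True apply simp
        by (rule wp_mono[OF ih]) (use 1 in auto)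
    next
      case False
      then have sat1: "sat n m arr p (\<lambda>_. 0)" and wit: "wit n m arr p (env M1)"
        using 1 sat by auto
      then have ex: "expands n E (arr 3) (map (\<lambda>br. assign br (env M1) (arr 3)) brs)"
        and lt: "\<forall>br\<in>set brs. \<forall>(v, c)\<in>set br. env M1 v < n"
        using Cons.prems(5) by (auto simp: r)
      have lits: "\<forall>br\<in>set brs. \<forall>(v, c)\<in>set br. v < 28 \<and> env M1 v \<le> n"
        using wf(3) lt by fastforce
      show ?thesis
        using False apply simp
      proof (rule wp_mono[OF wp_pushes[OF core1 stat1 stack1 lits assms(6)]], goal_cases)
        case (1 k2 M2 os2)
        have same2: "(M2(2 := 0)) x = M2 x" if "x \<notin> scratch \<or> 52 \<le> x \<or> x = 9" for x
          using that unfolding scratch_def by auto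
        have c2: "core M2" and st2: "stack (ss @ map (\<lambda>br. assign br (env M1) (arr 3)) brs) M2"
          using 1 by simp_all
        have "core (M2(2 := 0))" by (rule core_frame[OF c2], rule same2) simp
        moreover have "stack (ss @ map (\<lambda>br. assign br (env M1) (arr 3)) brs) (M2(2 := 0))"
          by (rule stack_frame[OF st2]; rule same2) (use sb b52[of 3] in auto)
        moreover have "os2 = os @ encode_sets []" using 1 ev by (simp add: encode_sets_def)
        moreover have "k + k2 \<le> cost N p + (sum_list (map (push_cost N) brs) + rules_cost N lf rs)"
          using 1 ev by simp
        ultimately show ?case using processed_expands[OF ex] by blast
      qed
    qed
  qed
qed

end

lemma encode_sets_append: "encode_sets (xs @ ys) = encode_sets xs @ encode_sets ys"
  by (simp add: encode_sets_def)

lemma processed_cong: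
  assumes "\<And>i. i < n \<Longrightarrow> s i = s' i" "processed n E s cs ts"
  shows "processed n E s' cs ts"
proof -
  have "level n s = level n s'" by (rule ext, rule level_cong) (use assms in auto)
  then have "Sol n E s = Sol n E s'" "Phi n E s = Phi n E s'"
    by (simp_all add: Sol_def Phi_def resid_def)
  then show ?thesis using assms(2) by (simp add: processed_def)
qed

text \<open>Quantifying over every array content with the given edges and any valid status lets one
  proof serve all nodes. Cells past the ends of the arrays stay arbitrary, because
  \<open>arr\<close> mirrors raw memory.\<close>

definition rules_ok :: "nat \<Rightarrow> nat \<Rightarrow> nat set set \<Rightarrow> (nat \<Rightarrow> nat \<Rightarrow> nat) \<Rightarrow> fm \<Rightarrow> rules \<Rightarrow> bool" where
  "rules_ok n m E X lf rs \<longleftrightarrow> (\<forall>arr. (\<forall>a<3. \<forall>j<m. arr a j = X a j) \<longrightarrow> valid n (arr 3) \<longrightarrow>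
     rules_spec n m E arr rs \<and>
     (sat n m arr lf (\<lambda>_. 0) \<longleftrightarrow> minimal_transversal {..<n} E (level n (arr 3) 1)))"

definition iteration_cost :: "nat \<Rightarrow> fm \<Rightarrow> rules \<Rightarrow> nat" where
  "iteration_cost N lf rs = Suc N * 9 + rules_cost N lf rs + 5"

context ram
begin

lemma wp_iteration:
  assumes "core M" "stack (ss @ [s]) M" "valid n s" "wf_rules rs" "wf_fm lf" "fv lf = {}" "n \<le> N" "m \<le> N"
    and ok: "rules_ok n m E X lf rs"
  shows "wp (Ins (Sub 9 9 8) ;; copyc 9 23 ;; rulesc lf rs ;; Ins (Sub 16 9 10))
    (\<lambda>k M' os'. k \<le> iteration_cost N lf rs \<and> core M' \<and> M' 16 = M' 9 - sb \<and>
      (\<exists>cs ts. stack (ss @ cs) M' \<and> os' = os @ encode_sets ts \<and> processed n E s cs ts)) M os"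
proof -
  let ?q = "sb + length ss * Suc n"
  let ?M = "M(9 := ?q)"
  note r = core_regs[OF assms(1)]
  have b52: "52 \<le> ba a" if "a < 4" for a using ba that by simp
  have M9: "M 9 - M 8 = ?q" using assms(2) r by (simp add: stack_def)
  have blk: "M (?q + i) = s i" if "i \<le> n" for i
    using assms(2) that unfolding stack_def by (auto dest!: spec[of _ "length ss"] simp: nth_append)
  have core1: "core ?M" by (rule core_frame[OF assms(1)]) (auto simp: scratch_def)
  have stack1: "stack ss ?M"
  proof -
    have "M (sb + k * Suc n + i) = (ss ! k) i" if "k < length ss" "i \<le> n" for k i
    proof -
      have "M (sb + k * Suc n + i) = ((ss @ [s]) ! k) i"
        using assms(2) that unfolding stack_def by simp
      then show ?thesis using that by (simp add: nth_append)
    qed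
    moreover have "sb + k * Suc n + i \<noteq> 9" for k i using sb b52[of 3] by simp
    ultimately show ?thesis unfolding stack_def by simp
  qed
  have "wp (copyc 9 23 ;; rulesc lf rs ;; Ins (Sub 16 9 10))
    (\<lambda>k M' os'. 1 + k \<le> iteration_cost N lf rs \<and> core M' \<and> M' 16 = M' 9 - sb \<and>
      (\<exists>cs ts. stack (ss @ cs) M' \<and> os' = os @ encode_sets ts \<and> processed n E s cs ts)) ?M os"
    unfolding wp_Seq
  proof (rule wp_mono[OF wp_copyc[where n = n and p = ?q and q = "ba 3"]], goal_cases)
    case (12 k1 M1 os1)
    have M1: "M1 x = ?M x" if "x \<notin> {2, 12, 13, 14, 15}" "\<not> (ba 3 \<le> x \<and> x \<le> ba 3 + n)" for x
      using 12 that by blast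
    have core2: "core M1"
      by (rule core_frame[OF core1]) (use M1 in \<open>auto simp: scratch_def\<close>)
    have stack2: "stack ss M1"
      by (rule stack_frame[OF stack1]) (use M1 sb b52[of 3] in auto)
    have s: "M1 (ba 3 + i) = s i" if "i \<le> n" for i
      using 12 that blk[OF that] sb b52[of 3] by auto
    define arr where "arr = (\<lambda>a i. M1 (ba a + i))"
    have "valid n (arr 3)" using assms(3) s by (auto simp: valid_def arr_def)
    moreover have "\<forall>a<3. \<forall>j<m. arr a j = X a j" using core2 by (simp add: core_def arr_def)
    ultimately have spec: "sat n m arr lf (\<lambda>_. 0) \<longleftrightarrow> minimal_transversal {..<n} E (level n (arr 3) 1)"
      "rules_spec n m E arr rs"
      using ok unfolding rules_ok_def by blast+
    have "wp (rulesc lf rs) (\<lambda>k M' os'. k \<le> rules_cost N lf rs \<and> core M' \<and>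
      (\<exists>cs ts. stack (ss @ cs) M' \<and> os' = os1 @ encode_sets ts \<and> processed n E (arr 3) cs ts)) M1 os1"
      by (rule wp_rulesc[OF core2 stack2 assms(4-8) _ spec]) (simp add: arr_def)
    then show ?case
    proof (rule wp_mono, goal_cases)
      case (1 k2 M2 os2)
      then obtain cs ts where ct: "stack (ss @ cs) M2" "os2 = os1 @ encode_sets ts"
        "processed n E (arr 3) cs ts" by blast
      have c2: "core M2" using 1 by simp
      have "core (M2(16 := M2 9 - M2 10))"
        by (rule core_frame[OF c2]) (auto simp: scratch_def)
      moreover have "stack (ss @ cs) (M2(16 := M2 9 - M2 10))"
        by (rule stack_frame[OF ct(1)]) (use sb b52[of 3] in auto)
      moreover have "processed n E s cs ts"
        by (rule processed_cong[OF _ ct(3)]) (use s in \<open>auto simp: arr_def\<close>)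
      moreover have "M2 10 = sb" using core_regs[OF c2] by simp
      moreover have "1 + (k1 + (k2 + 1)) \<le> iteration_cost N lf rs"
        using 1 12 assms(7) by (simp add: iteration_cost_def)
      ultimately show ?case using 12 ct(2) by (auto simp: add.assoc)
    qed
  qed (use r b52[of 3] sb in auto)
  then show ?thesis using M9 by simp
qed

text \<open>Induction on a budget \<open>K\<close> for the sum of \<open>Phi\<close> over the stack.
  A visit replaces a node by children of total value smaller by at least 1, and every node is worth
  at least 1, so the budget bounds the number of rounds.\<close>

lemma wp_search_loop:
  assumes "wf_rules rs" "wf_fm lf" "fv lf = {}" "n \<le> N" "m \<le> N" and ok: "rules_ok n m E X lf rs"
  shows "core M \<Longrightarrow> stack ss M \<Longrightarrow> M 16 = M 9 - sb \<Longrightarrow> \<forall>s\<in>set ss. valid n s \<Longrightarrow>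
    sorted_wrt (\<lambda>c d. Sol n E c \<inter> Sol n E d = {}) ss \<Longrightarrow> (\<Sum>s\<leftarrow>ss. Phi n E s) \<le> real K \<Longrightarrow>
    wp (While 16 (Ins (Sub 9 9 8) ;; copyc 9 23 ;; rulesc lf rs ;; Ins (Sub 16 9 10)))
      (\<lambda>k M' os'. k \<le> K * (iteration_cost N lf rs + 3) + 1 \<and> (\<exists>ts. os' = os @ encode_sets ts \<and>
        distinct (map set ts) \<and> set (map set ts) = (\<Union>s\<in>set ss. Sol n E s))) M os"
proof (induction K arbitrary: M os ss)
  case 0
  have "ss = []"
  proof (rule ccontr)
    assume "ss \<noteq> []"
    then obtain s ss' where "ss = s # ss'" by (cases ss) auto
    moreover have "0 \<le> (\<Sum>s\<leftarrow>ss'. Phi n E s)"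
      by (rule sum_list_nonneg) (use Phi_ge_1[of n E] in \<open>auto intro: order_trans[of 0 1]\<close>)
    ultimately show False using 0(6) Phi_ge_1[of n E s] by simp
  qed
  then show ?case
    using 0 by (intro wp_While_False) (auto simp: stack_def encode_sets_def)
next
  case (Suc K)
  show ?case
  proof (cases "ss = []")
    case True
    then show ?thesis
      using Suc.prems by (intro wp_While_False) (auto simp: stack_def encode_sets_def)
  next
    case False
    then obtain ss' s where ss: "ss = ss' @ [s]" by (metis append_butlast_last_id)
    have M16: "M 16 \<noteq> 0" using Suc.prems(2,3) ss by (simp add: stack_def)
    have v: "valid n s" "\<forall>s\<in>set ss'. valid n s" using Suc.prems(4) ss by auto
    have disj: "sorted_wrt (\<lambda>c d. Sol n E c \<inter> Sol n E d = {}) ss'"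
      "\<And>c. c \<in> set ss' \<Longrightarrow> Sol n E c \<inter> Sol n E s = {}"
      using Suc.prems(5) ss by (auto simp: sorted_wrt_append)
    show ?thesis
    proof (rule wp_While_True[where r = 16 and M = M and os = os, OF M16],
        rule wp_mono[OF wp_iteration[OF Suc.prems(1) Suc.prems(2)[unfolded ss] v(1) assms]], goal_cases)
      case (1 k1 M1 os1)
      then obtain cs ts where ct: "stack (ss' @ cs) M1" "os1 = os @ encode_sets ts"
        "processed n E s cs ts" by blast
      note p = ct(3)[unfolded processed_def]
      have b52: "52 \<le> ba 3" using ba by simp
      have core1: "core (M1(2 := 0))"
      proof (rule core_frame)
        show "core M1" using 1 by simp
      qed (auto simp: scratch_def)
      have stack1: "stack (ss' @ cs) (M1(2 := 0))"
        by (rule stack_frame[OF ct(1)]) (use sb b52 in auto)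
      have Phi: "(\<Sum>s\<leftarrow>ss' @ cs. Phi n E s) \<le> real K"
        using Suc.prems(6) ss p by simp
      have sub: "Sol n E c \<subseteq> Sol n E s" if "c \<in> set cs" for c using p that by blast
      have sorted: "sorted_wrt (\<lambda>c d. Sol n E c \<inter> Sol n E d = {}) (ss' @ cs)"
      proof -
        have "Sol n E c \<inter> Sol n E d = {}" if "c \<in> set ss'" "d \<in> set cs" for c d
          using disj(2)[OF that(1)] sub[OF that(2)] by blast
        then show ?thesis using disj(1) p by (simp add: sorted_wrt_append)
      qed
      have v': "\<forall>s\<in>set (ss' @ cs). valid n s" using v p by auto
      have m16: "(M1(2 := 0)) 16 = (M1(2 := 0)) 9 - sb" using 1 by simp
      show ?case
      proof (rule wp_mono[OF Suc.IH[OF core1 stack1 m16 v' sorted Phi, of os1]], goal_cases)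
        case (1 k2 M2 os2)
        then obtain us where us: "os2 = os1 @ encode_sets us" "distinct (map set us)"
          "set (map set us) = (\<Union>s\<in>set (ss' @ cs). Sol n E s)" by blast
        have "os2 = os @ encode_sets (ts @ us)" using us(1) ct(2) by (simp add: encode_sets_append)
        \<comment> \<open>The outputs of this visit are solutions of \<open>s\<close>, and the nodes
          below it on the stack have solutions disjoint from those. Hence nothing is printed
          twice.\<close>
        moreover have "set (map set ts) \<subseteq> Sol n E s" using p by blast
        then have "set (map set ts) \<inter> (\<Union>s\<in>set (ss' @ cs). Sol n E s) = {}"
          using disj(2) p by fastforce
        then have "distinct (map set (ts @ us))" using us(2,3) p by auto
        moreover have "set (map set (ts @ us)) = (\<Union>s\<in>set ss. Sol n E s)"
        proof -
          have "set (map set (ts @ us)) = set (map set ts) \<union> ((\<Union>s\<in>set ss'. Sol n E s) \<union> (\<Union>s\<in>set cs. Sol n E s))"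
            using us(3) by simp
          also have "\<dots> = (\<Union>s\<in>set ss'. Sol n E s) \<union> (set (map set ts) \<union> (\<Union>s\<in>set cs. Sol n E s))"
            by blast
          also have "set (map set ts) \<union> (\<Union>s\<in>set cs. Sol n E s) = Sol n E s" using p by blast
          finally show ?thesis using ss by auto
        qed
        moreover have "k1 + k2 + 3 \<le> Suc K * (iteration_cost N lf rs + 3) + 1"
          using 1 \<open>k1 \<le> iteration_cost N lf rs \<and> _\<close> by simp
        ultimately show ?case by blast
      qed
    qed
  qed
qed

end

section \<open>Branching rules as formulas\<close>

definition repr :: "nat \<Rightarrow> nat \<Rightarrow> nat set set \<Rightarrow> (nat \<Rightarrow> nat \<Rightarrow> nat) \<Rightarrow> bool" where
  "repr n m E arr \<longleftrightarrow> (\<forall>a<3. \<forall>j<m. arr a j \<le> n) \<and>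
     E = (\<lambda>j. {arr 0 j, arr 1 j, arr 2 j} - {n}) ` {..<m}"

definition or_fm :: "fm \<Rightarrow> fm \<Rightarrow> fm" where
  "or_fm p q = Neg (And (Neg p) (Neg q))"

text \<open>Variables 20 to 26 are reserved for quantification over edges: the index of the edge, then each of
  its three entries followed by the status of that entry.\<close>

definition edge_fm :: "fm \<Rightarrow> fm" where
  "edge_fm p = Ex 20 1 (Let 21 0 20 (Let 22 3 21 (Let 23 1 20 (Let 24 3 23 (Let 25 2 20 (Let 26 3 25 p))))))"

definition unhit_fm :: fm where
  "unhit_fm = And (Neg (EqC 22 1)) (And (Neg (EqC 24 1)) (Neg (EqC 26 1)))"

definition within_fm :: "nat \<Rightarrow> nat \<Rightarrow> nat \<Rightarrow> nat \<Rightarrow> nat \<Rightarrow> fm" where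
  "within_fm x s a b c = or_fm (Neg (EqC s 0)) (or_fm (EqV x a) (or_fm (EqV x b) (EqV x c)))"

definition has_fm :: "nat \<Rightarrow> fm" where
  "has_fm a = or_fm (And (EqV 21 a) (EqC 22 0)) (or_fm (And (EqV 23 a) (EqC 24 0)) (And (EqV 25 a) (EqC 26 0)))"

text \<open>Mutual inclusion between the undecided entries of an unhit edge and the three given
  values. Repeated arguments express pairs and singletons; an edge without undecided entries never
  qualifies, in accordance with the removal of {} in \<open>red\<close>.\<close>

definition res_fm :: "nat \<Rightarrow> nat \<Rightarrow> nat \<Rightarrow> fm" where
  "res_fm a b c = edge_fm (And unhit_fm (And (within_fm 21 22 a b c) (And (within_fm 23 24 a b c)
     (And (within_fm 25 26 a b c) (And (has_fm a) (And (has_fm b) (has_fm c)))))))"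

fun conj_fm :: "fm list \<Rightarrow> fm" where
  "conj_fm [] = EqV 0 0"
| "conj_fm (p # ps) = And p (conj_fm ps)"

definition neq_fm :: "nat \<Rightarrow> nat \<Rightarrow> fm" where
  "neq_fm a b = Neg (EqV a b)"

definition npair_fm :: "nat \<Rightarrow> nat \<Rightarrow> nat \<Rightarrow> nat \<Rightarrow> fm" where
  "npair_fm a b c d = Neg (or_fm (And (EqV a c) (EqV b d)) (And (EqV a d) (EqV b c)))"

definition E2_fm :: "nat \<Rightarrow> nat \<Rightarrow> fm" where
  "E2_fm a b = And (res_fm a b b) (neq_fm a b)"

definition E3_fm :: "nat \<Rightarrow> nat \<Rightarrow> nat \<Rightarrow> fm" where
  "E3_fm a b c = And (res_fm a b c) (And (neq_fm a b) (And (neq_fm a c) (neq_fm b c)))"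

definition P3_fm :: "nat \<Rightarrow> nat \<Rightarrow> nat \<Rightarrow> fm" where
  "P3_fm a b c = And (E3_fm a b c) (And (Neg (res_fm a b b)) (And (Neg (res_fm b c c)) (Neg (res_fm a c c))))"

fun exs :: "nat list \<Rightarrow> fm \<Rightarrow> fm" where
  "exs [] p = p"
| "exs (v # vs) p = Ex v 0 (exs vs p)"

text \<open>Its bound variables lie above those of the rules, so it can be negated inside a rule
  without overwriting the vertices found so far.\<close>

definition D3_fm :: fm where
  "D3_fm = exs [9, 10, 11, 12, 13, 14] (conj_fm [E3_fm 0 9 10, E3_fm 0 11 12, E3_fm 0 13 14,
     npair_fm 9 10 11 12, npair_fm 9 10 13 14, npair_fm 11 12 13 14])"

definition sing_rule_fm :: fm where
  "sing_rule_fm = exs [0] (conj_fm [res_fm 0 0 0])"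

definition star4_rule_fm :: fm where
  "star4_rule_fm = exs [0, 1, 2, 3, 4] (conj_fm [E2_fm 0 1, E2_fm 0 2, E2_fm 0 3, E2_fm 0 4, neq_fm 1 2, neq_fm 1 3, neq_fm 1 4, neq_fm 2 3, neq_fm 2 4, neq_fm 3 4])"

definition star3_rule_fm :: fm where
  "star3_rule_fm = exs [0, 1, 2, 3] (conj_fm [E2_fm 0 1, E2_fm 0 2, E2_fm 0 3, neq_fm 1 2, neq_fm 1 3, neq_fm 2 3])"

definition path_P3_rule_fm :: fm where
  "path_P3_rule_fm = exs [0, 1, 2, 3, 4] (conj_fm [E2_fm 0 1, E2_fm 0 2, neq_fm 1 2, P3_fm 0 3 4])"

definition path_rule_fm :: fm where
  "path_rule_fm = exs [0, 1, 2] (conj_fm [E2_fm 0 1, E2_fm 0 2, neq_fm 1 2])"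

definition edge_P3_P3_rule_fm :: fm where
  "edge_P3_P3_rule_fm = exs [0, 1, 2, 3, 4, 5] (conj_fm [E2_fm 0 1, P3_fm 0 2 3, P3_fm 0 4 5, npair_fm 2 3 4 5])"

definition edge_P3_rule_fm :: fm where
  "edge_P3_rule_fm = exs [0, 1, 2, 3] (conj_fm [E2_fm 0 1, P3_fm 0 2 3])"

definition edge_rule_fm :: fm where
  "edge_rule_fm = exs [0, 1] (conj_fm [E2_fm 0 1])"

definition degree2_disjoint_rule_fm :: fm where
  "degree2_disjoint_rule_fm = exs [0, 1, 2, 3, 4] (conj_fm [E3_fm 0 1 2, E3_fm 0 3 4, neq_fm 1 3, neq_fm 1 4, neq_fm 2 3, neq_fm 2 4, Neg D3_fm])"

definition degree2_overlap_rule_fm :: fm where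
  "degree2_overlap_rule_fm = exs [0, 1, 2, 3] (conj_fm [E3_fm 0 1 2, E3_fm 0 1 3, neq_fm 2 3, Neg D3_fm])"

definition degree1_rule_fm :: fm where
  "degree1_rule_fm = exs [0, 1, 2] (conj_fm [E3_fm 0 1 2, Neg D3_fm])"

definition degree4_rule_fm :: fm where
  "degree4_rule_fm = exs [0, 1, 2, 3, 4, 5, 6, 7, 8] (conj_fm [E3_fm 0 1 2, E3_fm 0 3 4, E3_fm 0 5 6, E3_fm 0 7 8, npair_fm 1 2 3 4, npair_fm 1 2 5 6, npair_fm 1 2 7 8, npair_fm 3 4 5 6, npair_fm 3 4 7 8, npair_fm 5 6 7 8])"

text \<open>When this formula is reached the family is 3-regular, so the mere existence of a triple
  suffices.\<close>

definition degree3_rule_fm :: fm where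
  "degree3_rule_fm = exs [0, 1, 2] (conj_fm [E3_fm 0 1 2])"

text \<open>The order matters, because a rule may rely on the failure of earlier ones. Singletons
  are eliminated, then pairs from stars down to a matching, then low-degree vertices of 3-uniform
  families, then those of degree at least four; the 3-regular case is last.\<close>

definition the_rules :: rules where
  "the_rules =
    [(sing_rule_fm, [[(0, 1)]]),
     (star4_rule_fm, [[(0, 1)], [(1, 1), (2, 1), (3, 1), (4, 1), (0, 2)]]),
     (star3_rule_fm, [[(0, 1)], [(1, 1), (2, 1), (3, 1), (0, 2)]]),
     (path_P3_rule_fm, [[(0, 1)], [(1, 1), (2, 1), (0, 2)]]),
     (path_rule_fm, [[(0, 1), (1, 2)], [(0, 1), (1, 1), (2, 2)], [(1, 1), (2, 1), (0, 2)]]),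
     (edge_P3_P3_rule_fm, [[(0, 1)], [(1, 1), (0, 2)]]),
     (edge_P3_rule_fm, [[(0, 1), (1, 2)], [(0, 1), (1, 1), (2, 2), (3, 2)], [(1, 1), (0, 2)]]),
     (edge_rule_fm, [[(0, 1), (1, 2)], [(1, 1), (0, 2)]]),
     (degree2_disjoint_rule_fm, [[(0, 1), (1, 2), (2, 2)], [(0, 1), (1, 1), (3, 2), (4, 2)], [(0, 1), (2, 1), (1, 2), (3, 2), (4, 2)], [(0, 2)]]),
     (degree2_overlap_rule_fm, [[(0, 1), (1, 2), (2, 2)], [(0, 1), (2, 1), (1, 2), (3, 2)], [(0, 2)]]),
     (degree1_rule_fm, [[(0, 1), (1, 2), (2, 2)], [(0, 2)]]),
     (degree4_rule_fm, [[(0, 1)], [(0, 2)]]),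
     (degree3_rule_fm, [[(0, 1)], [(0, 2)]])]"

lemmas rule_fm_defs = sing_rule_fm_def star4_rule_fm_def star3_rule_fm_def path_P3_rule_fm_def path_rule_fm_def edge_P3_P3_rule_fm_def edge_P3_rule_fm_def edge_rule_fm_def degree2_disjoint_rule_fm_def degree2_overlap_rule_fm_def degree1_rule_fm_def degree4_rule_fm_def degree3_rule_fm_def

definition single_fm :: "nat \<Rightarrow> nat \<Rightarrow> fm" where
  "single_fm x s = Neg (And (Neg (EqV x 0)) (EqC s 1))"

text \<open>Minimality is tested through private edges, which avoids any quantification over
  subsets. The first conjunct rejects the nodes at which some edge was emptied.\<close>

definition leaf_fm :: fm where
  "leaf_fm = And (Neg (edge_fm unhit_fm)) (Neg (Ex 0 0 (Let 1 3 0 (And (EqC 1 1)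
     (Neg (edge_fm (And (or_fm (EqV 21 0) (or_fm (EqV 23 0) (EqV 25 0)))
       (And (single_fm 21 22) (And (single_fm 23 24) (single_fm 25 26))))))))))"

lemmas fm_defs = or_fm_def edge_fm_def unhit_fm_def within_fm_def has_fm_def res_fm_def neq_fm_def
  npair_fm_def E2_fm_def E3_fm_def P3_fm_def single_fm_def

section \<open>Variables and semantics of the formulas\<close>

lemma fv_edge: "fv (edge_fm p) = fv p - {20..26}"
proof -
  have "{20..26} = {20, 21, 22, 23, 24, 25, 26::nat}" by (auto simp: atLeastAtMost_iff)
  then show ?thesis by (auto simp: edge_fm_def)
qed

lemma fv_res [simp]: "a < 20 \<Longrightarrow> b < 20 \<Longrightarrow> c < 20 \<Longrightarrow> fv (res_fm a b c) = {a, b, c}"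
  unfolding res_fm_def fv_edge by (simp add: unhit_fm_def within_fm_def has_fm_def or_fm_def insert_Diff_if) blast

lemma bv_res [simp]: "bv (res_fm a b c) = {20..26}"
  by (auto simp: fm_defs)

lemma wf_res [simp]: "a < 20 \<Longrightarrow> b < 20 \<Longrightarrow> c < 20 \<Longrightarrow> wf_fm (res_fm a b c)"
  by (auto simp: fm_defs)

lemma fm_vars [simp]:
  "fv (neq_fm a b) = {a, b}" "bv (neq_fm a b) = {}"
  "fv (npair_fm a b c d) = {a, b, c, d}" "bv (npair_fm a b c d) = {}"
  "a < 20 \<Longrightarrow> b < 20 \<Longrightarrow> fv (E2_fm a b) = {a, b}" "bv (E2_fm a b) = {20..26}"
  "a < 20 \<Longrightarrow> b < 20 \<Longrightarrow> c < 20 \<Longrightarrow> fv (E3_fm a b c) = {a, b, c}" "bv (E3_fm a b c) = {20..26}"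
  "a < 20 \<Longrightarrow> b < 20 \<Longrightarrow> c < 20 \<Longrightarrow> fv (P3_fm a b c) = {a, b, c}" "bv (P3_fm a b c) = {20..26}"
  by (auto simp: neq_fm_def npair_fm_def or_fm_def E2_fm_def E3_fm_def P3_fm_def)

lemma fm_wf [simp]:
  "a < 20 \<Longrightarrow> b < 20 \<Longrightarrow> wf_fm (neq_fm a b)"
  "a < 20 \<Longrightarrow> b < 20 \<Longrightarrow> c < 20 \<Longrightarrow> d < 20 \<Longrightarrow> wf_fm (npair_fm a b c d)"
  "a < 20 \<Longrightarrow> b < 20 \<Longrightarrow> wf_fm (E2_fm a b)"
  "a < 20 \<Longrightarrow> b < 20 \<Longrightarrow> c < 20 \<Longrightarrow> wf_fm (E3_fm a b c)"
  "a < 20 \<Longrightarrow> b < 20 \<Longrightarrow> c < 20 \<Longrightarrow> wf_fm (P3_fm a b c)"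
  by (auto simp: neq_fm_def npair_fm_def or_fm_def E2_fm_def E3_fm_def P3_fm_def)

lemma D3_vars [simp]: "fv D3_fm = {0}" "bv D3_fm = {9..14} \<union> {20..26}" "wf_fm D3_fm"
  by (auto simp: D3_fm_def)

lemma wf_the_rules: "wf_rules the_rules"
  unfolding wf_rules_def the_rules_def rule_fm_defs by (simp, auto)

lemma wf_leaf: "wf_fm leaf_fm" "fv leaf_fm = {}"
  by (auto simp: leaf_fm_def edge_fm_def unhit_fm_def or_fm_def single_fm_def)

lemma sat_or [simp]: "sat n m arr (or_fm p q) e = (sat n m arr p e \<or> sat n m arr q e)"
  by (simp add: or_fm_def)

lemma sat_neq [simp]: "sat n m arr (neq_fm a b) e = (e a \<noteq> e b)"
  by (simp add: neq_fm_def)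

lemma sat_npair [simp]: "sat n m arr (npair_fm a b c d) e = ({e a, e b} \<noteq> {e c, e d})"
  by (simp add: npair_fm_def doubleton_eq_iff)

lemma sat_edge [simp]: "sat n m arr (edge_fm p) e = (\<exists>j<m. sat n m arr p
    (e(20 := j, 21 := arr 0 j, 22 := arr 3 (arr 0 j), 23 := arr 1 j, 24 := arr 3 (arr 1 j),
       25 := arr 2 j, 26 := arr 3 (arr 2 j))))"
  by (simp add: edge_fm_def)

lemma sat_conj [simp]: "sat n m arr (conj_fm ps) e = (\<forall>p\<in>set ps. sat n m arr p e)"
  by (induction ps) auto

lemma sat_exs_aux: "sat n m arr (exs vs p) e \<longleftrightarrow>
    (\<exists>f. (\<forall>v\<in>set vs. f v < n) \<and> (\<forall>v. v \<notin> set vs \<longrightarrow> f v = e v) \<and> sat n m arr p f)"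
proof (induction vs arbitrary: e)
  case Nil
  have "f = e" if "\<forall>v. f v = e v" for f using that by (auto simp: fun_eq_iff)
  then show ?case by auto
next
  case (Cons w vs)
  show ?case
  proof
    assume "sat n m arr (exs (w # vs) p) e"
    then obtain x f where "x < n" "\<forall>v\<in>set vs. f v < n" "\<forall>v. v \<notin> set vs \<longrightarrow> f v = (e(w := x)) v"
      "sat n m arr p f"
      using Cons by auto
    then show "\<exists>f. (\<forall>v\<in>set (w # vs). f v < n) \<and> (\<forall>v. v \<notin> set (w # vs) \<longrightarrow> f v = e v) \<and> sat n m arr p f"
      by (intro exI[of _ f]) (cases "w \<in> set vs"; auto)
  next
    assume "\<exists>f. (\<forall>v\<in>set (w # vs). f v < n) \<and> (\<forall>v. v \<notin> set (w # vs) \<longrightarrow> f v = e v) \<and> sat n m arr p f"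
    then obtain f where f: "\<forall>v\<in>set (w # vs). f v < n" "\<forall>v. v \<notin> set (w # vs) \<longrightarrow> f v = e v" "sat n m arr p f"
      by blast
    then have "sat n m arr (exs vs p) (e(w := f w))"
      unfolding Cons by (intro exI[of _ f]) auto
    then show "sat n m arr (exs (w # vs) p) e" using f(1) by auto
  qed
qed

lemma sat_exs:
  assumes "fv p \<subseteq> set vs"
  shows "sat n m arr (exs vs p) e \<longleftrightarrow> (\<exists>f. (\<forall>v\<in>set vs. f v < n) \<and> sat n m arr p f)"
proof -
  have "sat n m arr p (\<lambda>v. if v \<in> set vs then f v else e v) = sat n m arr p f" for f
    by (rule sat_cong) (use assms in auto)
  note eq = this
  show ?thesis
    unfolding sat_exs_aux
  proof (intro iffI; elim exE)
    fix f assume "(\<forall>v\<in>set vs. f v < n) \<and> sat n m arr p f"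
    then show "\<exists>f. (\<forall>v\<in>set vs. f v < n) \<and> (\<forall>v. v \<notin> set vs \<longrightarrow> f v = e v) \<and> sat n m arr p f"
      using eq[of f] by (intro exI[of _ "\<lambda>v. if v \<in> set vs then f v else e v"]) simp
  qed blast
qed

text \<open>Writing the list as p # ps exposes the body as an \<open>And\<close>, at which
  \<open>wit\<close> falls back to \<open>sat\<close>.\<close>

lemma wit_exs: "wit n m arr (exs vs (conj_fm (p # ps))) e \<longleftrightarrow>
    (\<forall>v\<in>set vs. e v < n) \<and> sat n m arr (conj_fm (p # ps)) e"
  by (induction vs) auto

text \<open>The dummy n is discarded in every valid status, so it is neither selected nor undecided.
  Status tests on the three entries therefore see the same residual edge whether or not n has been
  removed.\<close>

lemma edge_residual:
  fixes s :: status
  assumes "valid n s" "x \<le> n" "y \<le> n" "z \<le> n"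
  defines "T \<equiv> {x, y, z}"
  shows "(T - {n}) \<inter> level n s 1 = {} \<longleftrightarrow> s x \<noteq> 1 \<and> s y \<noteq> 1 \<and> s z \<noteq> 1"
    and "s x \<noteq> 1 \<and> s y \<noteq> 1 \<and> s z \<noteq> 1 \<Longrightarrow> (T - {n}) - level n s 2 = {w \<in> T. s w = 0}"
proof -
  have n: "s n = 2" and le: "\<And>w. w < n \<Longrightarrow> s w = 0 \<or> s w = 1 \<or> s w = 2"
  proof -
    fix w assume "w < n"
    then have "s w \<le> 2" using assms(1) by (simp add: valid_def)
    then show "s w = 0 \<or> s w = 1 \<or> s w = 2" by linarith
  qed (use assms(1) in \<open>simp add: valid_def\<close>)
  have T: "w < n \<or> w = n" if "w \<in> T" for w using that assms(2-4) by (auto simp: T_def)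
  have iff: "w \<in> T - {n} \<and> w \<in> level n s c \<longleftrightarrow> w \<in> T \<and> w \<noteq> n \<and> s w = c" for w c
    using T[of w] by (auto simp: level_def)
  show "(T - {n}) \<inter> level n s 1 = {} \<longleftrightarrow> s x \<noteq> 1 \<and> s y \<noteq> 1 \<and> s z \<noteq> 1"
  proof -
    have "(T - {n}) \<inter> level n s 1 = {w \<in> T. w \<noteq> n \<and> s w = 1}" using iff by blast
    also have "\<dots> = {} \<longleftrightarrow> (\<forall>w\<in>T. s w \<noteq> 1)" using n by auto
    finally show ?thesis by (simp add: T_def)
  qed
  assume "s x \<noteq> 1 \<and> s y \<noteq> 1 \<and> s z \<noteq> 1"
  then have not1: "s w \<noteq> 1" if "w \<in> T" for w using that by (auto simp: T_def)
  show "(T - {n}) - level n s 2 = {w \<in> T. s w = 0}"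
  proof (intro set_eqI iffI)
    fix w assume w: "w \<in> (T - {n}) - level n s 2"
    then have "w < n" "s w \<noteq> 2" using T[of w] by (auto simp: level_def)
    then show "w \<in> {w \<in> T. s w = 0}" using le[of w] not1[of w] w by auto
  next
    fix w assume w: "w \<in> {w \<in> T. s w = 0}"
    then show "w \<in> (T - {n}) - level n s 2" using n by (auto simp: level_def)
  qed
qed

lemma sat_res:
  assumes "repr n m E arr" "valid n (arr 3)" "a < 20" "b < 20" "c < 20"
  shows "sat n m arr (res_fm a b c) e \<longleftrightarrow> {e a, e b, e c} \<in> resid n E (arr 3)"
proof -
  let ?s = "arr 3" and ?T = "\<lambda>j. {arr 0 j, arr 1 j, arr 2 j}"
  have le: "arr 0 j \<le> n" "arr 1 j \<le> n" "arr 2 j \<le> n" if "j < m" for j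
    using assms(1) that by (auto simp: repr_def)
  have set_eq: "{w \<in> {x, y, z}. f w = 0} = P \<longleftrightarrow>
    (f x = 0 \<longrightarrow> x \<in> P) \<and> (f y = 0 \<longrightarrow> y \<in> P) \<and> (f z = 0 \<longrightarrow> z \<in> P) \<and>
    (\<forall>w\<in>P. w \<in> {x, y, z} \<and> f w = 0)" for x y z :: nat and f :: "nat \<Rightarrow> nat" and P
    by auto
  have "{e a, e b, e c} \<in> resid n E ?s \<longleftrightarrow> (\<exists>j<m. (?T j - {n}) \<inter> level n ?s 1 = {} \<and>
      {e a, e b, e c} = (?T j - {n}) - level n ?s 2)"
    using assms(1) unfolding resid_def red_iff repr_def by auto
  also have "\<dots> \<longleftrightarrow> (\<exists>j<m. (?s (arr 0 j) \<noteq> 1 \<and> ?s (arr 1 j) \<noteq> 1 \<and> ?s (arr 2 j) \<noteq> 1) \<and>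
      {w \<in> ?T j. ?s w = 0} = {e a, e b, e c})"
  proof (intro ex_cong1 conj_cong refl)
    fix j assume "j < m"
    note res = edge_residual[OF assms(2) le[OF this]]
    show "(?T j - {n}) \<inter> level n ?s 1 = {} \<longleftrightarrow> ?s (arr 0 j) \<noteq> 1 \<and> ?s (arr 1 j) \<noteq> 1 \<and> ?s (arr 2 j) \<noteq> 1"
      by (rule res(1))
    assume "?s (arr 0 j) \<noteq> 1 \<and> ?s (arr 1 j) \<noteq> 1 \<and> ?s (arr 2 j) \<noteq> 1"
    from res(2)[OF this] show "({e a, e b, e c} = (?T j - {n}) - level n ?s 2) =
        ({w \<in> ?T j. ?s w = 0} = {e a, e b, e c})"
      by (metis (lifting))
  qed
  also have "\<dots> \<longleftrightarrow> sat n m arr (res_fm a b c) e"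
    unfolding set_eq res_fm_def sat_edge
  proof (intro ex_cong1 conj_cong refl)
    fix j
    let ?e = "e(20 := j, 21 := arr 0 j, 22 := arr 3 (arr 0 j), 23 := arr 1 j, 24 := arr 3 (arr 1 j),
       25 := arr 2 j, 26 := arr 3 (arr 2 j))"
    have has: "sat n m arr (has_fm v) ?e \<longleftrightarrow> e v \<in> ?T j \<and> ?s (e v) = 0" if "v < 20" for v
      using that by (auto simp: has_fm_def)
    have within: "sat n m arr (within_fm x y a b c) g \<longleftrightarrow> (g y = 0 \<longrightarrow> g x \<in> {g a, g b, g c})" for x y g
      by (auto simp: within_fm_def)
    have abc: "?e a = e a" "?e b = e b" "?e c = e c" using assms(3-5) by simp_all
    have vals: "?e 21 = arr 0 j" "?e 22 = ?s (arr 0 j)" "?e 23 = arr 1 j" "?e 24 = ?s (arr 1 j)"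
      "?e 25 = arr 2 j" "?e 26 = ?s (arr 2 j)"
      by simp_all
    have unhit: "sat n m arr unhit_fm ?e \<longleftrightarrow> ?s (arr 0 j) \<noteq> 1 \<and> ?s (arr 1 j) \<noteq> 1 \<and> ?s (arr 2 j) \<noteq> 1"
      by (simp add: unhit_fm_def)
    have ball3: "(\<forall>w\<in>{p, q, r}. P w) \<longleftrightarrow> P p \<and> P q \<and> P r" for p q r :: nat and P
      by simp
    show "((?s (arr 0 j) \<noteq> 1 \<and> ?s (arr 1 j) \<noteq> 1 \<and> ?s (arr 2 j) \<noteq> 1) \<and>
      (?s (arr 0 j) = 0 \<longrightarrow> arr 0 j \<in> {e a, e b, e c}) \<and> (?s (arr 1 j) = 0 \<longrightarrow> arr 1 j \<in> {e a, e b, e c}) \<and>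
      (?s (arr 2 j) = 0 \<longrightarrow> arr 2 j \<in> {e a, e b, e c}) \<and>
      (\<forall>w\<in>{e a, e b, e c}. w \<in> ?T j \<and> ?s w = 0)) \<longleftrightarrow>
      sat n m arr (And unhit_fm (And (within_fm 21 22 a b c) (And (within_fm 23 24 a b c)
        (And (within_fm 25 26 a b c) (And (has_fm a) (And (has_fm b) (has_fm c))))))) ?e"
      unfolding sat.simps unhit within abc vals ball3 has[OF assms(3)] has[OF assms(4)] has[OF assms(5)]
      by (simp only: conj_assoc)
  qed
  finally show ?thesis by simp
qed

section \<open>The rules at a fixed search node\<close>

context
  fixes n m :: nat and E :: "nat set set" and arr :: "nat \<Rightarrow> nat \<Rightarrow> nat" and H
  assumes E: "hypergraph {..<n} E" "hg_rank_le E 3" and repr: "repr n m E arr" and valid: "valid n (arr 3)"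
  defines "H \<equiv> resid n E (arr 3)"
begin

abbreviation "fails p \<equiv> \<not> sat n m arr p (\<lambda>_. 0)"

lemma sat_res' [simp]: "a < 20 \<Longrightarrow> b < 20 \<Longrightarrow> c < 20 \<Longrightarrow>
    sat n m arr (res_fm a b c) e \<longleftrightarrow> {e a, e b, e c} \<in> H"
  unfolding H_def by (rule sat_res[OF repr valid])

lemma sat_E2 [simp]: "a < 20 \<Longrightarrow> b < 20 \<Longrightarrow> sat n m arr (E2_fm a b) e \<longleftrightarrow> E2 H (e a) (e b)"
  by (simp add: E2_fm_def E2_def)

lemma sat_E3 [simp]: "a < 20 \<Longrightarrow> b < 20 \<Longrightarrow> c < 20 \<Longrightarrow>
    sat n m arr (E3_fm a b c) e \<longleftrightarrow> E3 H (e a) (e b) (e c)"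
  by (auto simp add: E3_fm_def E3_def)

lemma sat_P3 [simp]: "a < 20 \<Longrightarrow> b < 20 \<Longrightarrow> c < 20 \<Longrightarrow>
    sat n m arr (P3_fm a b c) e \<longleftrightarrow> P3 H (e a) (e b) (e c)"
  by (auto simp add: P3_fm_def P3_def)

lemma Union_H: "x \<in> \<Union>H \<Longrightarrow> x < n"
  using Union_resid[OF E(1) valid] by (auto simp: H_def level_def)

lemma E_lt: "{a} \<in> H \<Longrightarrow> a < n" "E2 H a b \<Longrightarrow> a < n \<and> b < n" "E3 H a b c \<Longrightarrow> a < n \<and> b < n \<and> c < n"
  "P3 H a b c \<Longrightarrow> a < n \<and> b < n \<and> c < n"
  using Union_H unfolding P3_def E3_def E2_def by blast+

text \<open>Witnesses are given as a list, whose positions are the variable numbers in the rule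
  formulas.\<close>

lemma exs_intro:
  assumes "fv p \<subseteq> {..<length xs}" "sat n m arr p (\<lambda>i. xs ! i)" "\<forall>x\<in>set xs. x < n" "vs = [0..<length xs]"
  shows "sat n m arr (exs vs p) e"
  unfolding assms(4)
  by (subst sat_exs) (use assms(1-3) in \<open>auto intro!: exI[of _ "\<lambda>i. xs ! i"]\<close>)

lemma sat_D3: "sat n m arr D3_fm e \<longleftrightarrow> D3 H (e 0)"
proof
  assume "sat n m arr D3_fm e"
  then obtain f where f: "\<forall>v. v \<notin> set [9, 10, 11, 12, 13, 14] \<longrightarrow> f v = e v"
    and "sat n m arr (conj_fm [E3_fm 0 9 10, E3_fm 0 11 12, E3_fm 0 13 14,
      npair_fm 9 10 11 12, npair_fm 9 10 13 14, npair_fm 11 12 13 14]) f"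
    unfolding D3_fm_def sat_exs_aux by blast
  moreover have "f 0 = e 0" using f by simp
  ultimately have "E3 H (e 0) (f 9) (f 10)" "E3 H (e 0) (f 11) (f 12)" "E3 H (e 0) (f 13) (f 14)"
    "{f 9, f 10} \<noteq> {f 11, f 12}" "{f 9, f 10} \<noteq> {f 13, f 14}" "{f 11, f 12} \<noteq> {f 13, f 14}"
    by simp_all
  then show "D3 H (e 0)" unfolding D3_def by (metis distinct3)
next
  assume "D3 H (e 0)"
  then obtain a b c d g h where D: "E3 H (e 0) a b" "E3 H (e 0) c d" "E3 H (e 0) g h"
    and dist: "distinct [{a, b}, {c, d}, {g, h}]"
    unfolding D3_def by (elim exE conjE) (rule that)
  have dist': "{a, b} \<noteq> {c, d}" "{a, b} \<noteq> {g, h}" "{c, d} \<noteq> {g, h}"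
    using dist unfolding distinct.simps list.set insert_iff empty_iff by metis+
  show "sat n m arr D3_fm e"
    unfolding D3_fm_def sat_exs_aux
    apply (rule exI[of _ "e(9 := a, 10 := b, 11 := c, 12 := d, 13 := g, 14 := h)"])
    using D[THEN E_lt(3)] D dist' by simp
qed


text \<open>A rule decides only vertices that occur in the residual family. They are below n, so the
  writes of the program stay inside the status block.\<close>

lemma apply_rule:
  assumes "good H (map (branch e) brs)" "\<forall>br\<in>set brs. \<forall>(v, c)\<in>set br. c = 1 \<or> c = 2"
  shows "expands n E (arr 3) (map (\<lambda>br. assign br e (arr 3)) brs) \<and>
    (\<forall>br\<in>set brs. \<forall>(v, c)\<in>set br. e v < n)"
proof
  show "expands n E (arr 3) (map (\<lambda>br. assign br e (arr 3)) brs)"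
    using good_expands[OF E(1) valid assms(2)] assms(1) by (simp add: H_def)
  have "e v < n" if "br \<in> set brs" "(v, c) \<in> set br" for br v c
  proof -
    have "lits e 1 br \<union> lits e 2 br \<subseteq> \<Union>H"
      using assms(1) that by (auto simp: good_def branch_def)
    moreover have "e v \<in> lits e 1 br \<union> lits e 2 br"
      using assms(2) that by (force simp: lits_def)
    ultimately show ?thesis using Union_H by blast
  qed
  then show "\<forall>br\<in>set brs. \<forall>(v, c)\<in>set br. e v < n" by blast
qed

lemma lits_simps [simp]:
  "lits e c [] = {}" "lits e c ((v, d) # br) = (if c = d then insert (e v) (lits e c br) else lits e c br)"
  by (auto simp: lits_def)

lemma rank3_H: "rank3 H"
  unfolding H_def by (rule rank3_resid[OF E])

lemma neg_distinct3: "distinct [b, c, d] \<longleftrightarrow> b \<noteq> c \<and> b \<noteq> d \<and> c \<noteq> d"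
  by auto

lemma neg_distinct4: "distinct [b, c, d, e] \<longleftrightarrow> b \<noteq> c \<and> b \<noteq> d \<and> b \<noteq> e \<and> c \<noteq> d \<and> c \<noteq> e \<and> d \<noteq> e"
  by auto

section \<open>Failed rules as hypotheses of later ones\<close>

lemma no_sing:
  "fails sing_rule_fm \<Longrightarrow> {a} \<notin> H"
  by (rule ccontr, erule notE, unfold sing_rule_fm_def,
      rule exs_intro[where xs = "[a]"])
     (use E_lt E3_neq[of H] sat_D3 in \<open>auto simp: neg_distinct3 neg_distinct4 numeral_eq_Suc\<close>)

lemma no_star4:
  "fails star4_rule_fm \<Longrightarrow> E2 H a b \<Longrightarrow> E2 H a c \<Longrightarrow> E2 H a d \<Longrightarrow> E2 H a g \<Longrightarrow> \<not> distinct [b, c, d, g]"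
  by (rule ccontr, erule notE, unfold star4_rule_fm_def,
      rule exs_intro[where xs = "[a, b, c, d, g]"])
     (use E_lt E3_neq[of H] sat_D3 in \<open>auto simp: neg_distinct3 neg_distinct4 numeral_eq_Suc\<close>)

lemma no_star3:
  "fails star3_rule_fm \<Longrightarrow> E2 H a b \<Longrightarrow> E2 H a c \<Longrightarrow> E2 H a d \<Longrightarrow> \<not> distinct [b, c, d]"
  by (rule ccontr, erule notE, unfold star3_rule_fm_def,
      rule exs_intro[where xs = "[a, b, c, d]"])
     (use E_lt E3_neq[of H] sat_D3 in \<open>auto simp: neg_distinct3 neg_distinct4 numeral_eq_Suc\<close>)

lemma no_path_P3:
  "fails path_P3_rule_fm \<Longrightarrow> E2 H a b \<Longrightarrow> E2 H a c \<Longrightarrow> b \<noteq> c \<Longrightarrow> \<not> P3 H a g f"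
  by (rule ccontr, erule notE, unfold path_P3_rule_fm_def,
      rule exs_intro[where xs = "[a, b, c, g, f]"])
     (use E_lt E3_neq[of H] sat_D3 in \<open>auto simp: neg_distinct3 neg_distinct4 numeral_eq_Suc\<close>)

lemma no_path:
  "fails path_rule_fm \<Longrightarrow> E2 H a b \<Longrightarrow> E2 H a c \<Longrightarrow> b = c"
  by (rule ccontr, erule notE, unfold path_rule_fm_def,
      rule exs_intro[where xs = "[a, b, c]"])
     (use E_lt E3_neq[of H] sat_D3 in \<open>auto simp: neg_distinct3 neg_distinct4 numeral_eq_Suc\<close>)

lemma no_edge_P3_P3:
  "fails edge_P3_P3_rule_fm \<Longrightarrow> E2 H a b \<Longrightarrow> P3 H a g f \<Longrightarrow> P3 H a g' f' \<Longrightarrow> {g, f} = {g', f'}"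
  by (rule ccontr, erule notE, unfold edge_P3_P3_rule_fm_def,
      rule exs_intro[where xs = "[a, b, g, f, g', f']"])
     (use E_lt E3_neq[of H] sat_D3 in \<open>auto simp: neg_distinct3 neg_distinct4 numeral_eq_Suc\<close>)

lemma no_edge_P3:
  "fails edge_P3_rule_fm \<Longrightarrow> E2 H a b \<Longrightarrow> \<not> P3 H a g f"
  by (rule ccontr, erule notE, unfold edge_P3_rule_fm_def,
      rule exs_intro[where xs = "[a, b, g, f]"])
     (use E_lt E3_neq[of H] sat_D3 in \<open>auto simp: neg_distinct3 neg_distinct4 numeral_eq_Suc\<close>)

lemma no_edge:
  "fails edge_rule_fm \<Longrightarrow> \<not> E2 H a b"
  by (rule ccontr, erule notE, unfold edge_rule_fm_def,
      rule exs_intro[where xs = "[a, b]"])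
     (use E_lt E3_neq[of H] sat_D3 in \<open>auto simp: neg_distinct3 neg_distinct4 numeral_eq_Suc\<close>)

lemma no_degree2_disjoint:
  "fails degree2_disjoint_rule_fm \<Longrightarrow> E3 H v a b \<Longrightarrow> E3 H v c d \<Longrightarrow> \<not> D3 H v \<Longrightarrow> \<not> distinct [a, b, c, d]"
  by (rule ccontr, erule notE, unfold degree2_disjoint_rule_fm_def,
      rule exs_intro[where xs = "[v, a, b, c, d]"])
     (use E_lt E3_neq[of H] sat_D3 in \<open>auto simp: neg_distinct3 neg_distinct4 numeral_eq_Suc\<close>)

lemma no_degree2_overlap:
  "fails degree2_overlap_rule_fm \<Longrightarrow> E3 H v a b \<Longrightarrow> E3 H v a d \<Longrightarrow> \<not> D3 H v \<Longrightarrow> b = d"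
  by (rule ccontr, erule notE, unfold degree2_overlap_rule_fm_def,
      rule exs_intro[where xs = "[v, a, b, d]"])
     (use E_lt E3_neq[of H] sat_D3 in \<open>auto simp: neg_distinct3 neg_distinct4 numeral_eq_Suc\<close>)

lemma no_degree1:
  "fails degree1_rule_fm \<Longrightarrow> E3 H v a b \<Longrightarrow> D3 H v"
  by (rule ccontr, erule notE, unfold degree1_rule_fm_def,
      rule exs_intro[where xs = "[v, a, b]"])
     (use E_lt E3_neq[of H] sat_D3 in \<open>auto simp: neg_distinct3 neg_distinct4 numeral_eq_Suc\<close>)

lemma no_degree4:
  "fails degree4_rule_fm \<Longrightarrow> E3 H v a1 b1 \<Longrightarrow> E3 H v a2 b2 \<Longrightarrow> E3 H v a3 b3 \<Longrightarrow> E3 H v a4 b4 \<Longrightarrow> \<not> distinct [{a1, b1}, {a2, b2}, {a3, b3}, {a4, b4}]"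
  by (rule ccontr, erule notE, unfold degree4_rule_fm_def,
      rule exs_intro[where xs = "[v, a1, b1, a2, b2, a3, b3, a4, b4]"])
     (use E_lt E3_neq[of H] sat_D3 in \<open>auto simp: neg_distinct3 neg_distinct4 numeral_eq_Suc\<close>)

lemma no_degree3:
  "fails degree3_rule_fm \<Longrightarrow> \<not> E3 H v a b"
  by (rule ccontr, erule notE, unfold degree3_rule_fm_def,
      rule exs_intro[where xs = "[v, a, b]"])
     (use E_lt E3_neq[of H] sat_D3 in \<open>auto simp: neg_distinct3 neg_distinct4 numeral_eq_Suc\<close>)

lemma rules_step:
  assumes "\<And>e. sat n m arr (conj_fm (p # ps)) e \<Longrightarrow> good H (map (branch e) brs)"
    and "\<forall>br\<in>set brs. \<forall>(v, c)\<in>set br. c = 1 \<or> c = 2"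
    and "\<not> sat n m arr (exs vs (conj_fm (p # ps))) (\<lambda>_. 0) \<Longrightarrow> rules_spec n m E arr rs"
  shows "rules_spec n m E arr ((exs vs (conj_fm (p # ps)), brs) # rs)"
  using assms(3) apply_rule[OF assms(1,2)] unfolding rules_spec.simps wit_exs by auto

lemma sing_step:
  assumes step: "fails sing_rule_fm \<Longrightarrow> rules_spec n m E arr rs"
  shows "rules_spec n m E arr ((sing_rule_fm, [[(0, 1)]]) # rs)"
  unfolding sing_rule_fm_def
proof (rule rules_step, goal_cases)
  case (1 e)
  then have "{e 0} \<in> H"
    by (simp_all add: sat_D3)
  from sing_rule[OF rank3_H this]
  show ?case by (simp add: branch_def)
next
  case 3
  then show ?case by (rule step[unfolded sing_rule_fm_def])
qed simp

lemma star4_step: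
  assumes n1: "fails sing_rule_fm"
    and step: "fails star4_rule_fm \<Longrightarrow> rules_spec n m E arr rs"
  shows "rules_spec n m E arr ((star4_rule_fm, [[(0, 1)], [(1, 1), (2, 1), (3, 1), (4, 1), (0, 2)]]) # rs)"
  unfolding star4_rule_fm_def
proof (rule rules_step, goal_cases)
  case (1 e)
  then have "E2 H (e 0) (e 1)" "E2 H (e 0) (e 2)" "E2 H (e 0) (e 3)" "E2 H (e 0) (e 4)" "distinct [e 1, e 2, e 3, e 4]"
    by (simp_all add: sat_D3)
  from two_nbrs4_rule[OF rank3_H no_sing[OF n1] this]
  show ?case by (simp add: branch_def)
next
  case 3
  then show ?case by (rule step[unfolded star4_rule_fm_def])
qed simp

lemma star3_step:
  assumes n1: "fails sing_rule_fm"
    and n2: "fails star4_rule_fm"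
    and step: "fails star3_rule_fm \<Longrightarrow> rules_spec n m E arr rs"
  shows "rules_spec n m E arr ((star3_rule_fm, [[(0, 1)], [(1, 1), (2, 1), (3, 1), (0, 2)]]) # rs)"
  unfolding star3_rule_fm_def
proof (rule rules_step, goal_cases)
  case (1 e)
  then have "E2 H (e 0) (e 1)" "E2 H (e 0) (e 2)" "E2 H (e 0) (e 3)" "distinct [e 1, e 2, e 3]"
    by (simp_all add: sat_D3)
  from two_nbrs3_rule[OF rank3_H no_sing[OF n1] this no_star4[OF n2]]
  show ?case by (simp add: branch_def)
next
  case 3
  then show ?case by (rule step[unfolded star3_rule_fm_def])
qed simp

lemma path_P3_step:
  assumes n1: "fails sing_rule_fm"
    and n2: "fails star3_rule_fm"
    and step: "fails path_P3_rule_fm \<Longrightarrow> rules_spec n m E arr rs"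
  shows "rules_spec n m E arr ((path_P3_rule_fm, [[(0, 1)], [(1, 1), (2, 1), (0, 2)]]) # rs)"
  unfolding path_P3_rule_fm_def
proof (rule rules_step, goal_cases)
  case (1 e)
  then have "E2 H (e 0) (e 1)" "E2 H (e 0) (e 2)" "e 1 \<noteq> e 2" "P3 H (e 0) (e 3) (e 4)"
    by (simp_all add: sat_D3)
  from path_P3_rule[OF rank3_H no_sing[OF n1] this no_star3[OF n2]]
  show ?case by (simp add: branch_def)
next
  case 3
  then show ?case by (rule step[unfolded path_P3_rule_fm_def])
qed simp

lemma path_step:
  assumes n1: "fails sing_rule_fm"
    and n2: "fails star3_rule_fm"
    and n3: "fails path_P3_rule_fm"
    and step: "fails path_rule_fm \<Longrightarrow> rules_spec n m E arr rs"
  shows "rules_spec n m E arr ((path_rule_fm, [[(0, 1), (1, 2)], [(0, 1), (1, 1), (2, 2)], [(1, 1), (2, 1), (0, 2)]]) # rs)"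
  unfolding path_rule_fm_def
proof (rule rules_step, goal_cases)
  case (1 e)
  then have "E2 H (e 0) (e 1)" "E2 H (e 0) (e 2)" "e 1 \<noteq> e 2"
    by (simp_all add: sat_D3)
  from path_rule[OF rank3_H no_sing[OF n1] this no_star3[OF n2] no_path_P3[OF n3]]
  show ?case by (simp add: branch_def)
next
  case 3
  then show ?case by (rule step[unfolded path_rule_fm_def])
qed simp

lemma edge_P3_P3_step:
  assumes n1: "fails sing_rule_fm"
    and n2: "fails path_rule_fm"
    and step: "fails edge_P3_P3_rule_fm \<Longrightarrow> rules_spec n m E arr rs"
  shows "rules_spec n m E arr ((edge_P3_P3_rule_fm, [[(0, 1)], [(1, 1), (0, 2)]]) # rs)"
  unfolding edge_P3_P3_rule_fm_def
proof (rule rules_step, goal_cases)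
  case (1 e)
  then have "E2 H (e 0) (e 1)" "P3 H (e 0) (e 2) (e 3)" "P3 H (e 0) (e 4) (e 5)" "{e 2, e 3} \<noteq> {e 4, e 5}"
    by (simp_all add: sat_D3)
  from matching_P3_P3_rule[OF rank3_H no_sing[OF n1] this no_path[OF n2]]
  show ?case by (simp add: branch_def)
next
  case 3
  then show ?case by (rule step[unfolded edge_P3_P3_rule_fm_def])
qed simp

lemma edge_P3_step:
  assumes n1: "fails sing_rule_fm"
    and n2: "fails path_rule_fm"
    and n3: "fails edge_P3_P3_rule_fm"
    and step: "fails edge_P3_rule_fm \<Longrightarrow> rules_spec n m E arr rs"
  shows "rules_spec n m E arr ((edge_P3_rule_fm, [[(0, 1), (1, 2)], [(0, 1), (1, 1), (2, 2), (3, 2)], [(1, 1), (0, 2)]]) # rs)"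
  unfolding edge_P3_rule_fm_def
proof (rule rules_step, goal_cases)
  case (1 e)
  then have "E2 H (e 0) (e 1)" "P3 H (e 0) (e 2) (e 3)"
    by (simp_all add: sat_D3)
  from matching_P3_rule[OF rank3_H no_sing[OF n1] this no_path[OF n2] no_edge_P3_P3[OF n3]]
  show ?case by (simp add: branch_def)
next
  case 3
  then show ?case by (rule step[unfolded edge_P3_rule_fm_def])
qed simp

lemma edge_step:
  assumes n1: "fails sing_rule_fm"
    and n2: "fails path_rule_fm"
    and n3: "fails edge_P3_rule_fm"
    and step: "fails edge_rule_fm \<Longrightarrow> rules_spec n m E arr rs"
  shows "rules_spec n m E arr ((edge_rule_fm, [[(0, 1), (1, 2)], [(1, 1), (0, 2)]]) # rs)"
  unfolding edge_rule_fm_def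
proof (rule rules_step, goal_cases)
  case (1 e)
  then have "E2 H (e 0) (e 1)"
    by (simp_all add: sat_D3)
  from matching_rule[OF rank3_H no_sing[OF n1] this no_path[OF n2] no_edge_P3[OF n3]]
  show ?case by (simp add: branch_def)
next
  case 3
  then show ?case by (rule step[unfolded edge_rule_fm_def])
qed simp

lemma degree2_disjoint_step:
  assumes n1: "fails sing_rule_fm"
    and n2: "fails edge_rule_fm"
    and step: "fails degree2_disjoint_rule_fm \<Longrightarrow> rules_spec n m E arr rs"
  shows "rules_spec n m E arr ((degree2_disjoint_rule_fm, [[(0, 1), (1, 2), (2, 2)], [(0, 1), (1, 1), (3, 2), (4, 2)],
      [(0, 1), (2, 1), (1, 2), (3, 2), (4, 2)], [(0, 2)]]) # rs)"
  unfolding degree2_disjoint_rule_fm_def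
proof (rule rules_step, goal_cases)
  case (1 e)
  then have "E3 H (e 0) (e 1) (e 2)" "E3 H (e 0) (e 3) (e 4)" "distinct [e 1, e 2, e 3, e 4]" "\<not> D3 H (e 0)"
    by (auto simp: sat_D3 dest: E3_neq)
  from degree2_disjoint_rule[OF rank3_H no_sing[OF n1] no_edge[OF n2] this]
  show ?case by (simp add: branch_def)
next
  case 3
  then show ?case by (rule step[unfolded degree2_disjoint_rule_fm_def])
qed simp

lemma degree2_overlap_step:
  assumes n1: "fails sing_rule_fm"
    and n2: "fails edge_rule_fm"
    and step: "fails degree2_overlap_rule_fm \<Longrightarrow> rules_spec n m E arr rs"
  shows "rules_spec n m E arr ((degree2_overlap_rule_fm, [[(0, 1), (1, 2), (2, 2)], [(0, 1), (2, 1), (1, 2), (3, 2)], [(0, 2)]]) # rs)"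
  unfolding degree2_overlap_rule_fm_def
proof (rule rules_step, goal_cases)
  case (1 e)
  then have "E3 H (e 0) (e 1) (e 2)" "E3 H (e 0) (e 1) (e 3)" "e 2 \<noteq> e 3" "\<not> D3 H (e 0)"
    by (simp_all add: sat_D3)
  from degree2_overlap_rule[OF rank3_H no_sing[OF n1] no_edge[OF n2] this]
  show ?case by (simp add: branch_def)
next
  case 3
  then show ?case by (rule step[unfolded degree2_overlap_rule_fm_def])
qed simp

lemma degree1_step:
  assumes n1: "fails sing_rule_fm"
    and n2: "fails edge_rule_fm"
    and n3: "fails degree2_disjoint_rule_fm"
    and n4: "fails degree2_overlap_rule_fm"
    and step: "fails degree1_rule_fm \<Longrightarrow> rules_spec n m E arr rs"
  shows "rules_spec n m E arr ((degree1_rule_fm, [[(0, 1), (1, 2), (2, 2)], [(0, 2)]]) # rs)"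
  unfolding degree1_rule_fm_def
proof (rule rules_step, goal_cases)
  case (1 e)
  then have "E3 H (e 0) (e 1) (e 2)" "\<not> D3 H (e 0)"
    by (simp_all add: sat_D3)
  from degree1_rule[OF rank3_H no_sing[OF n1] no_edge[OF n2] this no_degree2_disjoint[OF n3 _ _ this(2)]
        no_degree2_overlap[OF n4 _ _ this(2)]]
  show ?case by (simp add: branch_def)
next
  case 3
  then show ?case by (rule step[unfolded degree1_rule_fm_def])
qed simp

lemma degree4_step:
  assumes n1: "fails sing_rule_fm"
    and n2: "fails edge_rule_fm"
    and n3: "fails degree1_rule_fm"
    and step: "fails degree4_rule_fm \<Longrightarrow> rules_spec n m E arr rs"
  shows "rules_spec n m E arr ((degree4_rule_fm, [[(0, 1)], [(0, 2)]]) # rs)"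
  unfolding degree4_rule_fm_def
proof (rule rules_step, goal_cases)
  case (1 e)
  then have "E3 H (e 0) (e 1) (e 2)" "E3 H (e 0) (e 3) (e 4)" "E3 H (e 0) (e 5) (e 6)" "E3 H (e 0) (e 7) (e 8)" "distinct [{e 1, e 2}, {e 3, e 4}, {e 5, e 6}, {e 7, e 8}]"
    by (simp_all add: sat_D3)
  from degree4_rule[OF rank3_H no_sing[OF n1] no_edge[OF n2] no_degree1[OF n3] this]
  show ?case by (simp add: branch_def)
next
  case 3
  then show ?case by (rule step[unfolded degree4_rule_fm_def])
qed simp

lemma degree3_step:
  assumes n1: "fails sing_rule_fm"
    and n2: "fails edge_rule_fm"
    and n3: "fails degree1_rule_fm"
    and n4: "fails degree4_rule_fm"
    and step: "fails degree3_rule_fm \<Longrightarrow> rules_spec n m E arr rs"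
  shows "rules_spec n m E arr ((degree3_rule_fm, [[(0, 1)], [(0, 2)]]) # rs)"
  unfolding degree3_rule_fm_def
proof (rule rules_step, goal_cases)
  case (1 e)
  then have "E3 H (e 0) (e 1) (e 2)"
    by (simp_all add: sat_D3)
  from degree3_rule[OF rank3_H no_sing[OF n1] no_edge[OF n2] no_degree1[OF n3] no_degree4[OF n4] this]
  show ?case by (simp add: branch_def)
next
  case 3
  then show ?case by (rule step[unfolded degree3_rule_fm_def])
qed simp

text \<open>If all formulas fail, no singleton and no pair is left, so any residual edge would be a
  triple. The failure of the last formula excludes that as well, and the node is a leaf.\<close>

lemma the_rules_spec: "rules_spec n m E arr the_rules"
  unfolding the_rules_def
  apply (rule sing_step)
  apply (rule star4_step, assumption)
  apply (rule star3_step, assumption, assumption)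
  apply (rule path_P3_step, assumption, assumption)
  apply (rule path_step, assumption, assumption, assumption)
  apply (rule edge_P3_P3_step, assumption, assumption)
  apply (rule edge_P3_step, assumption, assumption, assumption)
  apply (rule edge_step, assumption, assumption, assumption)
  apply (rule degree2_disjoint_step, assumption, assumption)
  apply (rule degree2_overlap_step, assumption, assumption)
  apply (rule degree1_step, assumption, assumption, assumption, assumption)
  apply (rule degree4_step, assumption, assumption, assumption)
  apply (rule degree3_step, assumption, assumption, assumption, assumption)
proof -
  assume n: "fails sing_rule_fm" "fails edge_rule_fm" "fails degree3_rule_fm"
  have "H = {}"
  proof (rule ccontr)
    assume "H \<noteq> {}"
    then obtain f where "f \<in> H" by blast
    moreover from this have "card f = 3"
      by (rule uniform3[OF rank3_H no_sing[OF n(1)] no_edge[OF n(2)]])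
    moreover from this obtain v a b where "f = {v, a, b}" "v \<noteq> a" "v \<noteq> b" "a \<noteq> b"
      by (auto simp: card_3_iff)
    ultimately show False using no_degree3[OF n(3)] by (auto simp: E3_def)
  qed
  then show "rules_spec n m E arr []" by (simp add: H_def)
qed

lemma leaf_spec: "sat n m arr leaf_fm (\<lambda>_. 0) \<longleftrightarrow> minimal_transversal {..<n} E (level n (arr 3) 1)"
proof -
  let ?s = "arr 3" and ?T = "\<lambda>j. {arr 0 j, arr 1 j, arr 2 j}"
  let ?I = "level n ?s 1"
  have le: "arr 0 j \<le> n" "arr 1 j \<le> n" "arr 2 j \<le> n" if "j < m" for j
    using repr that by (auto simp: repr_def)
  have E_eq: "E = (\<lambda>j. ?T j - {n}) ` {..<m}" using repr by (simp add: repr_def)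
  have sn: "?s n = 2" using valid by (simp add: valid_def)
  have "is_transversal E ?I \<longleftrightarrow> \<not> (\<exists>j<m. (?T j - {n}) \<inter> ?I = {})"
    unfolding is_transversal_def E_eq by (auto simp: Int_commute)
  also have "\<dots> \<longleftrightarrow> \<not> (\<exists>j<m. ?s (arr 0 j) \<noteq> 1 \<and> ?s (arr 1 j) \<noteq> 1 \<and> ?s (arr 2 j) \<noteq> 1)"
    using edge_residual(1)[OF valid le] by (metis (no_types, lifting))
  finally have trans: "is_transversal E ?I \<longleftrightarrow> sat n m arr (Neg (edge_fm unhit_fm)) (\<lambda>_. 0)"
    by (simp add: unhit_fm_def)
  have single: "(?T j - {n}) \<inter> ?I = {v} \<longleftrightarrow> v \<in> ?T j \<and> (\<forall>w\<in>?T j. ?s w = 1 \<longrightarrow> w = v)"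
    if "j < m" "v \<in> ?I" for j v
  proof -
    have "(?T j - {n}) \<inter> ?I = {w \<in> ?T j. ?s w = 1}"
    proof (intro set_eqI iffI)
      fix w assume w: "w \<in> {w \<in> ?T j. ?s w = 1}"
      then have "w \<le> n" "w \<noteq> n" using le[OF that(1)] sn by auto
      then show "w \<in> (?T j - {n}) \<inter> ?I" using w by (simp add: level_def)
    qed (simp add: level_def)
    moreover have "?s v = 1" using that(2) by (simp add: level_def)
    ultimately show ?thesis by (simp only:) blast
  qed
  have "(\<forall>v\<in>?I. \<exists>e\<in>E. e \<inter> ?I = {v}) \<longleftrightarrow>
      (\<forall>v\<in>?I. \<exists>j<m. v \<in> ?T j \<and> (\<forall>w\<in>?T j. ?s w = 1 \<longrightarrow> w = v))"
    unfolding E_eq using single by auto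
  also have "\<dots> \<longleftrightarrow> sat n m arr (Neg (Ex 0 0 (Let 1 3 0 (And (EqC 1 1)
     (Neg (edge_fm (And (or_fm (EqV 21 0) (or_fm (EqV 23 0) (EqV 25 0)))
       (And (single_fm 21 22) (And (single_fm 23 24) (single_fm 25 26)))))))))) (\<lambda>_. 0)"
    by (auto simp: single_fm_def level_def)
  finally have priv: "(\<forall>v\<in>?I. \<exists>e\<in>E. e \<inter> ?I = {v}) \<longleftrightarrow> sat n m arr (Neg (Ex 0 0 (Let 1 3 0 (And (EqC 1 1)
     (Neg (edge_fm (And (or_fm (EqV 21 0) (or_fm (EqV 23 0) (EqV 25 0)))
       (And (single_fm 21 22) (And (single_fm 23 24) (single_fm 25 26)))))))))) (\<lambda>_. 0)" .
  have "minimal_transversal {..<n} E ?I \<longleftrightarrow> is_transversal E ?I \<and> (\<forall>v\<in>?I. \<exists>e\<in>E. e \<inter> ?I = {v})"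
  proof (intro iffI conjI ballI)
    assume "minimal_transversal {..<n} E ?I"
    then show "is_transversal E ?I" unfolding minimal_transversal_def by blast
  next
    fix v assume "minimal_transversal {..<n} E ?I" "v \<in> ?I"
    then show "\<exists>e\<in>E. e \<inter> ?I = {v}" by (rule minimal_private)
  next
    assume "is_transversal E ?I \<and> (\<forall>v\<in>?I. \<exists>e\<in>E. e \<inter> ?I = {v})"
    then show "minimal_transversal {..<n} E ?I"
      by (intro minimal_transversalI) (auto simp: level_def)
  qed
  then show ?thesis unfolding trans priv leaf_fm_def by simp
qed

end

section \<open>Reading the input\<close>

text \<open>Initially no register is free, since the input starts at address 0. With $m$ edges of size at most
  three it ends before address $128m$, so multiplying the edge count in place yields an address from
  which on the low cells can be saved.\<close>

fun movesc :: "nat list \<Rightarrow> com" where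
  "movesc [] = Skip"
| "movesc (i # is) = Ins (Add 1 1 2) ;; Ins (Store 1 i) ;; movesc is"

lemma wp_movesc:
  assumes "M 1 = q" "M 2 = 1" "3 \<le> a" "a \<le> b" "b \<le> 52" "52 \<le> q"
  shows "wp (movesc [a..<b]) (\<lambda>k M' os'. os' = os \<and> k \<le> 2 * (b - a) \<and> M' 1 = q + (b - a) \<and>
    (\<forall>i. a \<le> i \<longrightarrow> i < b \<longrightarrow> M' (q + 1 + (i - a)) = M i) \<and>
    (\<forall>x. x \<noteq> 1 \<longrightarrow> \<not> (q < x \<and> x \<le> q + (b - a)) \<longrightarrow> M' x = M x)) M os"
  using assms
proof (induction "b - a" arbitrary: a q M os)
  case 0
  then show ?case by simp
next
  case (Suc d)
  then have ab: "a < b" by simp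
  let ?M = "M(1 := q + 1, q + 1 := M a)"
  have "wp (movesc [Suc a..<b]) (\<lambda>k M' os'. os' = os \<and> k \<le> 2 * (b - Suc a) \<and> M' 1 = (q + 1) + (b - Suc a) \<and>
    (\<forall>i. Suc a \<le> i \<longrightarrow> i < b \<longrightarrow> M' ((q + 1) + 1 + (i - Suc a)) = ?M i) \<and>
    (\<forall>x. x \<noteq> 1 \<longrightarrow> \<not> (q + 1 < x \<and> x \<le> (q + 1) + (b - Suc a)) \<longrightarrow> M' x = ?M x)) ?M os"
    by (rule Suc.hyps(1)) (use Suc in auto)
  note ih = this
  have mem: "(M(1 := M 1 + M 2))((M(1 := M 1 + M 2)) 1 := (M(1 := M 1 + M 2)) a) = ?M"
    using Suc.prems by simp
  show ?case
    unfolding upt_conv_Cons[OF ab] movesc.simps wp_Seq wp_instr mem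
  proof (rule wp_mono[OF ih], goal_cases)
    case (1 k M' os')
    then have h: "\<And>i. Suc a \<le> i \<Longrightarrow> i < b \<Longrightarrow> M' ((q + 1) + 1 + (i - Suc a)) = ?M i"
      "\<And>x. x \<noteq> 1 \<Longrightarrow> \<not> (q + 1 < x \<and> x \<le> (q + 1) + (b - Suc a)) \<Longrightarrow> M' x = ?M x"
      by blast+
    have "M' (q + 1 + (i - a)) = M i" if "a \<le> i" "i < b" for i
    proof (cases "i = a")
      case True
      then show ?thesis using h(2)[of "q + 1"] Suc.prems by simp
    next
      case False
      then have "i - a = Suc (i - Suc a)" using that by simp
      then show ?thesis using h(1)[of i] False that Suc.prems by simp
    qed
    moreover have "M' x = M x" if "x \<noteq> 1" "\<not> (q < x \<and> x \<le> q + (b - a))" for x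
    proof -
      have "x \<noteq> q + 1" "\<not> (q + 1 < x \<and> x \<le> (q + 1) + (b - Suc a))" using that ab by auto
      then show ?thesis using h(2)[of x] that(1) by simp
    qed
    moreover have "1 + (1 + k) \<le> 2 * (b - a)" "M' 1 = q + (b - a)" "os' = os" using 1 ab by auto
    ultimately show ?case by blast
  qed
qed

fun doublec :: "nat \<Rightarrow> nat \<Rightarrow> com" where
  "doublec r 0 = Skip"
| "doublec r (Suc k) = Ins (Add r r r) ;; doublec r k"

lemma wp_doublec: "wp (doublec r k) Q M os = Q k (M(r := 2 ^ k * M r)) os"
  by (induction k arbitrary: Q M) (simp_all add: algebra_simps mult_2[symmetric])

text \<open>Cell 2 is saved first, at address 128m itself, since its register is needed for the
  increment 1. The pointer then advances by 49 for cells 3 to 51, and subtracting 49 recovers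
  128m.\<close>

definition savec :: com where
  "savec = doublec 1 7 ;; Ins (Store 1 2) ;; Ins (Const 2 1) ;;
     movesc [3..<52] ;; Ins (Const 3 1) ;; Ins (Const 5 49) ;; Ins (Sub 16 1 5)"

lemma wp_savec:
  assumes "M 1 = m" "0 < m"
  shows "wp savec (\<lambda>k M' os'. os' = os \<and> k \<le> 200 \<and> M' 0 = M 0 \<and> M' 3 = 1 \<and> M' 16 = 128 * m \<and>
    (\<forall>i. 2 \<le> i \<longrightarrow> i < 52 \<longrightarrow> M' (128 * m + i - 2) = M i) \<and>
    (\<forall>x. 52 \<le> x \<longrightarrow> x < 128 * m \<longrightarrow> M' x = M x)) M os"
proof -
  define q where "q = 128 * m"
  let ?M = "M(1 := q, q := M 2, 2 := 1)"
  have q: "128 \<le> q" using assms(2) by (simp add: q_def)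
  have moves: "wp (movesc [3..<52]) (\<lambda>k M' os'. os' = os \<and> k \<le> 2 * (52 - 3) \<and> M' 1 = q + (52 - 3) \<and>
    (\<forall>i. 3 \<le> i \<longrightarrow> i < 52 \<longrightarrow> M' (q + 1 + (i - 3)) = ?M i) \<and>
    (\<forall>x. x \<noteq> 1 \<longrightarrow> \<not> (q < x \<and> x \<le> q + (52 - 3)) \<longrightarrow> M' x = ?M x)) ?M os"
    by (rule wp_movesc) (use q in auto)
  have "2 ^ 7 * M 1 = q" using assms(1) by (simp add: q_def)
  then have mem: "(M(1 := 2 ^ 7 * M 1))((M(1 := 2 ^ 7 * M 1)) 1 := (M(1 := 2 ^ 7 * M 1)) 2, 2 := 1) = ?M"
    by simp
  show ?thesis
    unfolding savec_def wp_Seq wp_doublec wp_instr mem q_def[symmetric]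
  proof (rule wp_mono[OF moves], goal_cases)
    case (1 k M' os')
    let ?N = "M'(3 := 1, 5 := 49)"
    have low: "M' x = ?M x" if "x \<noteq> 1" "x \<le> q" for x using 1 that by auto
    have high: "M' (q + 1 + (i - 3)) = M i" if "3 \<le> i" "i < 52" for i
      using 1 that q by auto
    have "(?N(16 := ?N 1 - ?N 5)) (q + i - 2) = M i" if i: "2 \<le> i" "i < 52" for i
    proof (cases "i = 2")
      case True
      then show ?thesis using low[of q] q by simp
    next
      case False
      then have "q + i - 2 = q + 1 + (i - 3)" "3 \<le> i" using i by auto
      moreover have "q + i - 2 \<noteq> 3" "q + i - 2 \<noteq> 5" "q + i - 2 \<noteq> 16" using i q by auto
      then have "(?N(16 := ?N 1 - ?N 5)) (q + i - 2) = M' (q + i - 2)"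
        unfolding fun_upd_def by simp
      ultimately show ?thesis using high[of i] i by simp
    qed
    moreover have "(?N(16 := ?N 1 - ?N 5)) x = M x" if "52 \<le> x" "x < q" for x
      using low[of x] that by simp
    moreover have "(?N(16 := ?N 1 - ?N 5)) 0 = M 0" using low[of 0] q by simp
    moreover have "(?N(16 := ?N 1 - ?N 5)) 16 = q" using 1 by simp
    moreover have "(?N(16 := ?N 1 - ?N 5)) 3 = 1" by simp
    moreover have "7 + (1 + (1 + (k + (1 + (1 + 1))))) \<le> 200" using 1 by simp
    ultimately show ?case using 1 by blast
  qed
qed

text \<open>Appends the input from cell 52 on to the saved low cells, so that cell i ends up at q +
  i - 2. The length of the input is not known at this point, so q cells are copied, which is enough
  because the input fits below q.\<close>

definition copyinc :: com where
  "copyinc = forc 16 (Ins (Const 5 52) ;; Ins (Add 13 5 12) ;; Ins (Load 14 13) ;; Ins (Const 5 50) ;;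
     Ins (Add 13 5 12) ;; Ins (Add 13 13 16) ;; Ins (Store 13 14))"

lemma wp_copyinc:
  assumes M: "M 0 = n" "M 3 = 1" "M 16 = q" "128 \<le> q"
    and lo: "\<And>i. 2 \<le> i \<Longrightarrow> i < 52 \<Longrightarrow> M (q + i - 2) = f i"
    and hi: "\<And>i. 52 \<le> i \<Longrightarrow> i < q \<Longrightarrow> M i = f i"
    and l: "l \<le> q"
  shows "wp copyinc (\<lambda>k M' os'. os' = os \<and> k \<le> q * 12 + 3 \<and> M' 0 = n \<and> M' 3 = 1 \<and> M' 16 = q \<and>
    (\<forall>i. 2 \<le> i \<longrightarrow> i < l \<longrightarrow> M' (q + i - 2) = f i)) M os"
proof -
  define P where "P = (\<lambda>j M' os'. os' = os \<and> M' 0 = n \<and> M' 3 = 1 \<and> M' 16 = q \<and>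
    (\<forall>i. 2 \<le> i \<longrightarrow> i < 52 + j \<longrightarrow> i < l \<longrightarrow> M' (q + i - 2) = f i) \<and>
    (\<forall>i. 52 \<le> i \<longrightarrow> i < q \<longrightarrow> M' i = f i))"
  show ?thesis
    unfolding copyinc_def
  proof (rule wp_forc[where P = P and B = q and t = 7], goal_cases)
    case 1
    show ?case using M lo hi by (simp add: P_def)
  next
    case (2 j M' os' r x)
    have "q + i - 2 \<noteq> r" if "2 \<le> i" for i using that M(4) 2(2) by auto
    then show ?case using 2 by (auto simp: P_def)
  next
    case (3 j M' os')
    then show ?case by (simp add: P_def)
  next
    case (4 j M' os')
    let ?N = "M'(5 := 50, 13 := q + j + 50, 14 := M' (52 + j), q + j + 50 := M' (52 + j))"
    have P: "os' = os" "M' 0 = n" "M' 3 = 1" "M' 16 = q"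
      "\<And>i. 2 \<le> i \<Longrightarrow> i < 52 + j \<Longrightarrow> i < l \<Longrightarrow> M' (q + i - 2) = f i"
      "\<And>i. 52 \<le> i \<Longrightarrow> i < q \<Longrightarrow> M' i = f i"
      using 4(1) by (auto simp: P_def)
    have "?N (q + i - 2) = f i" if i: "2 \<le> i" "i < 52 + Suc j" "i < l" for i
    proof (cases "i = 52 + j")
      case True
      then have "q + i - 2 = q + j + 50" "M' (52 + j) = f i" using P(6)[of i] i l by auto
      then show ?thesis by simp
    next
      case False
      then have "q + i - 2 \<noteq> q + j + 50" "q + i - 2 \<notin> {5, 13, 14}" using i M(4) by auto
      then show ?thesis using P(5)[of i] False i by simp
    qed
    moreover have "?N i = f i" if "52 \<le> i" "i < q" for i using P(6) that by simp
    ultimately have "P (Suc j) ?N os'" using P M(4) by (simp add: P_def)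
    moreover have "M'(5 := 50, 14 := M' (52 + j), 13 := q + j + 50, q + j + 50 := M' (52 + j)) = ?N"
      by (auto simp: fun_eq_iff)
    ultimately show ?case using 4(3) P(4) M(4) by (simp add: ac_simps fun_upd_twist)
  next
    case (6 k M' os')
    then show ?case using l by (auto simp: P_def)
  qed auto
qed

section \<open>Parsing the edges into padded arrays\<close>

definition field :: "nat \<Rightarrow> nat list \<Rightarrow> nat \<Rightarrow> nat" where
  "field n e a = (if a < length e then e ! a else n)"

text \<open>Register 7 counts the vertices of the edge that are still unread. Once it is 0, the
  dummy n is copied from register 0; adding register 4, which is kept at 0, serves as a
  move.\<close>

definition fieldc :: "nat \<Rightarrow> com" where
  "fieldc t = If 7 (Ins (Load 14 17) ;; Ins (Add 17 17 3) ;; Ins (Sub 7 7 3)) (Ins (Add 14 0 4)) ;;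
     Ins (Add 13 t 18) ;; Ins (Store 13 14)"

lemma wp_fieldc:
  assumes M: "M 0 = n" "M 3 = 1" "M 4 = 0" "M t + M 18 = A" "t \<in> {20, 21, 22}" "52 \<le> A"
    and r: "M 7 = length r" "M 17 = p" "\<And>i. i < length r \<Longrightarrow> M (p + i) = r ! i"
  shows "wp (fieldc t) (\<lambda>k M' os'. os' = os \<and> k \<le> 8 \<and> M' 7 = length (tl r) \<and>
    M' 17 = p + (length r - length (tl r)) \<and> M' A = field n r 0 \<and>
    (\<forall>x. x \<notin> {2, 7, 13, 14, 17, A} \<longrightarrow> M' x = M x)) M os"
proof (cases r)
  case Nil
  then show ?thesis using M r(1,2) by (auto simp: fieldc_def field_def)
next
  case (Cons x xs)
  then have Mp: "M p = x" using r(3)[of 0] by simp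
  have t: "t \<noteq> 2" "t \<noteq> 7" "t \<noteq> 13" "t \<noteq> 14" "t \<noteq> 17" using M(5) by auto
  let ?N = "M(14 := x, 17 := p + 1, 7 := length xs, 2 := 0, 13 := A, A := x)"
  have N: "?N 7 = length (tl r)" "?N 17 = p + (length r - length (tl r))" "?N A = field n r 0"
    "\<forall>x. x \<notin> {2, 7, 13, 14, 17, A} \<longrightarrow> ?N x = M x"
    using Cons M(6) by (auto simp: field_def)
  have "wp (fieldc t) Q M os = Q 8 ?N os" for Q
    using M(2,4) r(1,2) Cons Mp t by (simp add: fieldc_def)
  then show ?thesis using N by (simp only:) simp
qed

lemma wp_edge:
  assumes M: "M 0 = n" "M 3 = 1" "M 4 = 0" "M 18 = j" "M 20 = b" "M 21 = b + s" "M 22 = b + 2 * s"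
    and e: "M 7 = length e" "length e \<le> 3" "M 17 = p" "\<And>i. i < length e \<Longrightarrow> M (p + i) = e ! i"
    and p: "52 \<le> p" "p + length e \<le> b" "j < s"
  shows "wp (fieldc 20 ;; fieldc 21 ;; fieldc 22) (\<lambda>k M' os'. os' = os \<and> k \<le> 24 \<and>
    M' 17 = p + length e \<and> M' (b + j) = field n e 0 \<and> M' (b + s + j) = field n e 1 \<and>
    M' (b + 2 * s + j) = field n e 2 \<and>
    (\<forall>x. x \<notin> {2, 7, 13, 14, 17, b + j, b + s + j, b + 2 * s + j} \<longrightarrow> M' x = M x)) M os"
proof -
  have b: "52 \<le> b" using p by linarith
  have f: "field n e 1 = field n (tl e) 0" "field n e 2 = field n (tl (tl e)) 0"
    by (auto simp: field_def nth_tl numeral_2_eq_2)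
  show ?thesis
    unfolding wp_Seq
  proof (rule wp_mono[OF wp_fieldc[where A = "b + j" and r = e and p = p and n = n]], goal_cases)
    case (10 k1 M1 os1)
    have M1: "M1 x = M x" if "x \<notin> {2, 7, 13, 14, 17, b + j}" for x using 10 that by blast
    let ?p1 = "p + (length e - length (tl e))"
    have r1: "M1 (?p1 + i) = tl e ! i" if "i < length (tl e)" for i
    proof -
      have "M1 (?p1 + i) = M (?p1 + i)" by (rule M1) (use that p b in auto)
      also have "?p1 + i = p + Suc i" using that by auto
      finally show ?thesis using e(4)[of "Suc i"] that by (simp add: nth_tl)
    qed
    show ?case
    proof (rule wp_mono[OF wp_fieldc[where A = "b + s + j" and r = "tl e" and p = ?p1 and n = n]], goal_cases)
      case (10 k2 M2 os2)
      have M2: "M2 x = M1 x" if "x \<notin> {2, 7, 13, 14, 17, b + s + j}" for x using 10 that by blast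
      let ?p2 = "?p1 + (length (tl e) - length (tl (tl e)))"
      have r2: "M2 (?p2 + i) = tl (tl e) ! i" if "i < length (tl (tl e))" for i
      proof -
        have "M2 (?p2 + i) = M1 (?p2 + i)" by (rule M2) (use that p b in auto)
        also have "?p2 + i = ?p1 + Suc i" using that by auto
        finally show ?thesis using r1[of "Suc i"] that by (simp add: nth_tl)
      qed
      show ?case
      proof (rule wp_mono[OF wp_fieldc[where A = "b + 2 * s + j" and r = "tl (tl e)" and p = ?p2 and n = n]], goal_cases)
        case (10 k3 M3 os3)
        have M3: "M3 x = M2 x" if "x \<notin> {2, 7, 13, 14, 17, b + 2 * s + j}" for x using 10 that by blast
        have "M3 (b + j) = field n e 0"
          using M3[of "b + j"] M2[of "b + j"] \<open>os1 = os \<and> _\<close> b p by auto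
        moreover have "M3 (b + s + j) = field n e 1"
          using M3[of "b + s + j"] \<open>os2 = os1 \<and> _\<close> b p f by auto
        moreover have "M3 (b + 2 * s + j) = field n e 2" using 10 f by auto
        moreover have "M3 x = M x" if "x \<notin> {2, 7, 13, 14, 17, b + j, b + s + j, b + 2 * s + j}" for x
          using M3[of x] M2[of x] M1[of x] that by auto
        moreover have "M3 17 = p + length e" using 10 e(2) by auto
        moreover have "k1 + (k2 + k3) \<le> 24" using 10 \<open>os1 = os \<and> _\<close> \<open>os2 = os1 \<and> _\<close> by auto
        moreover have "os3 = os" using 10 \<open>os1 = os \<and> _\<close> \<open>os2 = os1 \<and> _\<close> by simp
        ultimately show ?case by blast
      qed (use M M1 M2 b p 10 r2 in auto)
    qed (use M M1 b p 10 r1 in auto)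
  qed (use M e b in auto)
qed

text \<open>Register 1 no longer holds m, so the loop counts 128m down in steps of 128. Register 18
  counts upwards meanwhile and ends as m, the second quantifier bound.\<close>

definition parsec :: com where
  "parsec = While 19 (Ins (Load 7 17) ;; Ins (Add 17 17 3) ;; (fieldc 20 ;; fieldc 21 ;; fieldc 22) ;;
     Ins (Add 18 18 3) ;; Ins (Const 5 128) ;; Ins (Sub 19 19 5))"

abbreviation "enc_edges es \<equiv> concat (map (\<lambda>e. length e # e) es)"

lemma wp_parsec:
  assumes M: "M 0 = n" "M 3 = 1" "M 4 = 0" "M 18 = 0" "M 19 = 128 * m" "M 20 = b" "M 21 = b + s" "M 22 = b + 2 * s"
    and es: "length es = m" "\<forall>e\<in>set es. length e \<le> 3"
    and p: "M 17 = p" "52 \<le> p" "p + length (enc_edges es) \<le> b" "m \<le> s"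
    and enc: "\<And>i. i < length (enc_edges es) \<Longrightarrow> M (p + i) = enc_edges es ! i"
  shows "wp parsec (\<lambda>k M' os'. os' = os \<and> k \<le> m * 32 + 1 \<and> M' 18 = m \<and>
    (\<forall>a<3. \<forall>j<m. M' (b + a * s + j) = field n (es ! j) a) \<and>
    (\<forall>x. x < 52 \<longrightarrow> x \<notin> {2, 5, 7, 13, 14, 17, 18, 19} \<longrightarrow> M' x = M x)) M os"
proof -
  have b: "52 \<le> b" using p by linarith
  define I where "I = (\<lambda>j M' os'. os' = os \<and> j \<le> m \<and> M' 18 = j \<and> M' 19 = 128 * (m - j) \<and>
    52 \<le> M' 17 \<and> M' 17 + length (enc_edges (drop j es)) \<le> b \<and>
    (\<forall>i<length (enc_edges (drop j es)). M' (M' 17 + i) = enc_edges (drop j es) ! i) \<and>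
    (\<forall>i<j. M' (b + i) = field n (es ! i) 0 \<and> M' (b + s + i) = field n (es ! i) 1 \<and>
      M' (b + 2 * s + i) = field n (es ! i) 2) \<and>
    (\<forall>x. x < 52 \<longrightarrow> x \<notin> {2, 5, 7, 13, 14, 17, 18, 19} \<longrightarrow> M' x = M x))"
  show ?thesis
    unfolding parsec_def
  proof (rule wp_loop[where I = I and N = m and t = 29], goal_cases)
    case 1
    show ?case using M p enc by (simp add: I_def)
  next
    case (2 j M' os')
    then have j: "j < m" by (auto simp: I_def)
    let ?e = "es ! j" and ?p = "M' 17" and ?r = "enc_edges (drop (Suc j) es)"
    have dr: "enc_edges (drop j es) = length ?e # ?e @ ?r"
      using j es(1) by (simp add: Cons_nth_drop_Suc[symmetric])
    have I: "os' = os" "M' 18 = j" "M' 19 = 128 * (m - j)" "52 \<le> ?p"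
      "?p + Suc (length ?e + length ?r) \<le> b"
      "\<And>i. i < Suc (length ?e + length ?r) \<Longrightarrow> M' (?p + i) = (length ?e # ?e @ ?r) ! i"
      "\<And>i. i < j \<Longrightarrow> M' (b + i) = field n (es ! i) 0 \<and> M' (b + s + i) = field n (es ! i) 1 \<and>
        M' (b + 2 * s + i) = field n (es ! i) 2"
      "\<And>x. x < 52 \<Longrightarrow> x \<notin> {2, 5, 7, 13, 14, 17, 18, 19} \<Longrightarrow> M' x = M x"
      using 2(1) by (auto simp: I_def dr)
    have len: "M' ?p = length ?e" using I(6)[of 0] by simp
    let ?M1 = "M'(7 := length ?e, 17 := ?p + 1)"
    have fixed: "?M1 x = M x" if "x \<in> {0, 3, 4, 20, 21, 22}" for x
      using that I(8)[of x] by auto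
    have e: "?M1 ((?p + 1) + i) = ?e ! i" if "i < length ?e" for i
      using I(6)[of "Suc i"] that I(4) by (simp add: nth_append)
    have rest: "?M1 ((?p + 1 + length ?e) + i) = ?r ! i" if "i < length ?r" for i
      using I(6)[of "Suc (length ?e + i)"] that I(4) by (simp add: nth_append ac_simps)
    have edge: "wp (fieldc 20 ;; fieldc 21 ;; fieldc 22) (\<lambda>k M'' os''. os'' = os' \<and> k \<le> 24 \<and>
      M'' 17 = ?p + 1 + length ?e \<and> M'' (b + j) = field n ?e 0 \<and> M'' (b + s + j) = field n ?e 1 \<and>
      M'' (b + 2 * s + j) = field n ?e 2 \<and>
      (\<forall>x. x \<notin> {2, 7, 13, 14, 17, b + j, b + s + j, b + 2 * s + j} \<longrightarrow> M'' x = ?M1 x)) ?M1 os'"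
    proof (rule wp_edge)
      show "length ?e \<le> 3" using es j by simp
      show "?M1 18 = j" using I(2) by simp
      show "52 \<le> ?p + 1" "?p + 1 + length ?e \<le> b" using I(4,5) by auto
      show "j < s" using j p(4) by simp
    qed (use M fixed[of 0] fixed[of 3] fixed[of 4] fixed[of 20] fixed[of 21] fixed[of 22] e in simp_all)
    have mem: "(M'(7 := M' (M' 17)))(17 := (M'(7 := M' (M' 17))) 17 + (M'(7 := M' (M' 17))) 3) = ?M1"
      using len I(8)[of 3] M(2) by simp
    show ?case
      unfolding wp_Seq[of "Ins _"] wp_instr mem
    proof (intro conjI j, unfold wp_Seq[of "fieldc 20 ;; _"], rule wp_mono[OF edge], goal_cases)
      case (1 k M2 os2)
      have M2: "M2 x = ?M1 x" if "x \<notin> {2, 7, 13, 14, 17, b + j, b + s + j, b + 2 * s + j}" for x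
        using 1 that by blast
      have M2l: "M2 18 = j" "M2 19 = 128 * (m - j)" "M2 3 = 1" "M2 17 = ?p + 1 + length ?e"
        using M2[of 18] M2[of 19] M2[of 3] I(2,3) b fixed[of 3] M(2) 1 by auto
      let ?M3 = "M2(18 := Suc j, 5 := 128, 19 := 128 * (m - Suc j), 2 := 0)"
      have hi: "?M3 x = M2 x" if "52 \<le> x" for x using that by simp
      have "?M3 (?M3 17 + i) = ?r ! i" if "i < length ?r" for i
      proof -
        have lt: "52 \<le> ?p + 1 + length ?e + i" "?p + 1 + length ?e + i < b" using I(4,5) that by auto
        then have "?M3 (?M3 17 + i) = M2 (?p + 1 + length ?e + i)" using hi M2l(4) by simp
        also have "\<dots> = ?M1 (?p + 1 + length ?e + i)" by (rule M2) (use lt in auto)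
        finally show ?thesis using rest[OF that] by simp
      qed
      moreover have "?M3 (b + i) = field n (es ! i) 0 \<and> ?M3 (b + s + i) = field n (es ! i) 1 \<and>
        ?M3 (b + 2 * s + i) = field n (es ! i) 2" if "i < Suc j" for i
      proof (cases "i = j")
        case True
        then show ?thesis using 1 b by simp
      next
        case False
        then have ij: "i < j" using that by simp
        have "M2 (b + i) = M' (b + i)" "M2 (b + s + i) = M' (b + s + i)" "M2 (b + 2 * s + i) = M' (b + 2 * s + i)"
          using M2[of "b + i"] M2[of "b + s + i"] M2[of "b + 2 * s + i"] ij j p(4) b by auto
        then show ?thesis using I(7)[OF ij] b by simp
      qed
      moreover have "?M3 x = M x" if "x < 52" "x \<notin> {2, 5, 7, 13, 14, 17, 18, 19}" for x
        using M2[of x] I(8)[OF that] that b by simp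
      moreover have "?M3 17 + length ?r \<le> b" "52 \<le> ?M3 17" using M2l(4) I(4,5) by auto
      moreover have "os2 = os" "Suc j \<le> m" "?M3 18 = Suc j" "?M3 19 = 128 * (m - Suc j)"
        using 1 I(1) j by simp_all
      ultimately have "I (Suc j) ?M3 os2" unfolding I_def by blast
      moreover have "128 * (m - j) - 128 = 128 * (m - Suc j)" by (simp add: algebra_simps)
      ultimately show ?case using M2l 1 by simp
    qed
  next
    case (3 j k M' os')
    then have jm: "j = m" by (auto simp: I_def)
    have "M' (b + a * s + i) = field n (es ! i) a" if "a < 3" "i < m" for a i
    proof -
      have "a = 0 \<or> a = 1 \<or> a = 2" using that by linarith
      then show ?thesis using 3(1) that jm by (auto simp: I_def)
    qed
    then show ?case using 3 jm by (auto simp: I_def)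
  qed
qed

text \<open>The relocated edge list ends by address 2q, well below the first array at 8q.
  Consecutive arrays are q apart, and q is at least m.\<close>

definition setupc :: com where
  "setupc = Ins (Sub 4 4 4) ;; Ins (Add 5 16 4) ;; doublec 5 3 ;; Ins (Add 20 5 4) ;; Ins (Add 21 20 16) ;;
     Ins (Add 22 21 16) ;; Ins (Add 23 22 16) ;; Ins (Add 8 0 3) ;; Ins (Add 10 23 8) ;; Ins (Add 9 10 4) ;;
     Ins (Const 18 0) ;; Ins (Add 17 16 4) ;; Ins (Add 19 16 4)"

lemma wp_setupc:
  assumes "M 0 = n" "M 3 = 1" "M 16 = q"
  shows "wp setupc (\<lambda>k M' os'. os' = os \<and> k \<le> 15 \<and> M' 0 = n \<and> M' 3 = 1 \<and> M' 4 = 0 \<and> M' 8 = Suc n \<and>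
    M' 9 = 11 * q + Suc n \<and> M' 10 = 11 * q + Suc n \<and> M' 17 = q \<and> M' 18 = 0 \<and> M' 19 = q \<and>
    M' 20 = 8 * q \<and> M' 21 = 9 * q \<and> M' 22 = 10 * q \<and> M' 23 = 11 * q \<and>
    (\<forall>x. 52 \<le> x \<longrightarrow> M' x = M x)) M os"
  using assms by (simp add: setupc_def wp_doublec)

definition initc :: com where
  "initc = forc 0 (Ins (Add 13 9 12) ;; Ins (Const 4 0) ;; Ins (Store 13 4)) ;; Ins (Add 13 9 0) ;;
     Ins (Const 4 2) ;; Ins (Store 13 4) ;; Ins (Add 9 9 8)"

definition start :: "nat \<Rightarrow> status" where
  "start n i = (if i = n then 2 else 0)"

context ram
begin

lemma wp_initc:
  assumes "core M" "M 9 = sb"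
  shows "wp initc (\<lambda>k M' os'. os' = os \<and> k \<le> n * 8 + 7 \<and> core M' \<and> stack [start n] M') M os"
proof -
  note r = core_regs[OF assms(1)]
  have b52: "52 \<le> ba 3" using ba by simp
  define P where "P = (\<lambda>j M' os'. os' = os \<and> core M' \<and> M' 9 = sb \<and> (\<forall>i<j. M' (sb + i) = 0))"
  show ?thesis
    unfolding initc_def wp_Seq[of "forc _ _"]
  proof (rule wp_forc[where P = P and B = n and t = 3], goal_cases)
    case 1
    show ?case using assms by (simp add: P_def)
  next
    case (2 j M' os' r x)
    then have "core M'" by (simp add: P_def)
    then have "core (M'(r := x))" by (rule core_frame) (use 2(2) in \<open>auto simp: scratch_def\<close>)
    then show ?case using 2 sb b52 by (auto simp: P_def)
  next
    case (3 j M' os')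
    then show ?case using core_regs by (simp add: P_def)
  next
    case (4 j M' os')
    then have c: "core M'" by (simp add: P_def)
    have "core (M'(13 := sb + j, 4 := 0, sb + j := 0))"
      by (rule core_frame[OF c]) (use sb b52 in \<open>auto simp: scratch_def\<close>)
    then show ?case using 4 sb b52 by (auto simp: P_def less_Suc_eq)
  next
    case (6 k M' os')
    then have c: "core M'" "M' 9 = sb" "\<And>i. i < n \<Longrightarrow> M' (sb + i) = 0" "os' = os" by (auto simp: P_def)
    note r' = core_regs[OF c(1)]
    let ?N = "M'(13 := sb + n, 4 := 2, sb + n := 2, 9 := sb + Suc n)"
    have "core ?N"
      by (rule core_frame[OF c(1)]) (use sb b52 in \<open>auto simp: scratch_def\<close>)
    moreover have "stack [start n] ?N"
      using c(3) sb b52 by (auto simp: stack_def start_def)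
    ultimately show ?case using 6 c(2,4) r' sb b52 by (simp add: numeral_eq_Suc)
  qed auto
qed

lemma wp_searchc:
  assumes "core M" "stack ss M" "wf_rules rs" "wf_fm lf" "fv lf = {}" "n \<le> N" "m \<le> N" "rules_ok n m E X lf rs"
    and "\<forall>s\<in>set ss. valid n s" "sorted_wrt (\<lambda>c d. Sol n E c \<inter> Sol n E d = {}) ss"
    and "(\<Sum>s\<leftarrow>ss. Phi n E s) \<le> real K"
  shows "wp (searchc lf rs) (\<lambda>k M' os'. k \<le> K * (iteration_cost N lf rs + 3) + 2 \<and> (\<exists>ts. os' = os @ encode_sets ts \<and>
        distinct (map set ts) \<and> set (map set ts) = (\<Union>s\<in>set ss. Sol n E s))) M os"
proof -
  have b52: "52 \<le> ba 3" using ba by simp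
  let ?M = "M(16 := M 9 - M 10)"
  have "core ?M" by (rule core_frame[OF assms(1)]) (auto simp: scratch_def)
  moreover have "stack ss ?M" by (rule stack_frame[OF assms(2)]) (use sb b52 in auto)
  moreover have "?M 16 = ?M 9 - sb" using core_regs(4)[OF assms(1)] by simp
  ultimately show ?thesis
    unfolding searchc_def wp_Seq[of "Ins (Sub 16 9 10)"] wp_instr
    by (rule wp_mono[OF wp_search_loop[OF assms(3-8)]]) (use assms(9-11) in auto)
qed

end

text \<open>Without edges the address 128m would be 0, so this case is separate. The empty set is
  then the only minimal transversal; its encoding is the single number 0, which register 1
  contains.\<close>

definition program :: com where
  "program = If 1 (savec ;; copyinc ;; setupc ;; parsec ;; initc ;; searchc leaf_fm the_rules) (Ins (Out 1))"

lemma length_enc_edges: "\<forall>e\<in>set es. length e \<le> 3 \<Longrightarrow> length (enc_edges es) \<le> 4 * length es"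
  by (induction es) auto

lemma wp_program:
  assumes E: "hypergraph {..<n} E" "hg_rank_le E 3"
    and es: "\<forall>e\<in>set es. distinct e" "set (map set es) = E"
    and N: "n \<le> N" "length es \<le> N" and K: "Phi n E (start n) \<le> real K"
    and f: "f = mem (init_config (encode_hg n es))"
  shows "wp program (\<lambda>k M' os'. k \<le> 2000 * Suc N + K * (iteration_cost N leaf_fm the_rules + 3) \<and>
    (\<exists>ts. os' = encode_sets ts \<and> distinct (map set ts) \<and>
      set (map set ts) = {S. minimal_transversal {..<n} E S})) f []"
proof (cases "es = []")
  case True
  then have "E = {}" using es by simp
  have "minimal_transversal {..<n} E S \<longleftrightarrow> S = {}" for S
    unfolding minimal_transversal_def is_transversal_def \<open>E = {}\<close> by auto
  then have "{S. minimal_transversal {..<n} E S} = set (map set [[]])" by simp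
  moreover have f1: "f 1 = 0" using True f by (simp add: init_config_def encode_hg_def)
  moreover have "[] @ [f 1] = encode_sets [[]]" using f1 by (simp add: encode_sets_def)
  moreover have "distinct (map set [[]])" by simp
  moreover have "1 + 1 \<le> 2000 * Suc N + K * (iteration_cost N leaf_fm the_rules + 3)" by simp
  ultimately show ?thesis
    unfolding program_def wp_If wp_instr by metis
next
  case False
  define m where "m = length es"
  define q where "q = 128 * m"
  have m: "0 < m" "128 \<le> q" "m \<le> q" using False by (auto simp: m_def q_def Suc_le_eq)
  have len3: "\<forall>e\<in>set es. length e \<le> 3"
    using es E(2) by (auto simp: hg_rank_le_def distinct_card[symmetric])
  define l where "l = length (enc_edges es) + 2"
  have "l \<le> 4 * m + 2" using length_enc_edges[OF len3] by (simp add: l_def m_def)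
  then have l: "l \<le> q" using m(1) unfolding q_def by linarith
  have f01: "f 0 = n" "f 1 = m"
    by (simp_all add: f init_config_def encode_hg_def m_def)
  have f_edges: "f (i + 2) = enc_edges es ! i" if "i < length (enc_edges es)" for i
    using that by (simp add: f init_config_def encode_hg_def)
  define X where "X = (\<lambda>a j. field n (es ! j) a)"
  interpret ram n m "\<lambda>a. (8 + a) * q" "11 * q + Suc n" X
  proof
    show "52 \<le> (8 + a) * q" for a using m(2) by (simp add: algebra_simps)
    show "(8 + a) * q + m \<le> (8 + 3) * q" if "a < 3" for a
    proof -
      have "Suc (8 + a) * q \<le> (8 + 3) * q" using that by (intro mult_le_mono1) auto
      moreover have "Suc (8 + a) * q = q + (8 + a) * q" by (rule mult_Suc)
      ultimately show ?thesis using m(3) by linarith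
    qed
  qed simp
  have lt: "v < n" if "e \<in> set es" "v \<in> set e" for e v
    using that es(2) E(1) by (fastforce simp: hypergraph_def)
  have field_set: "{field n e 0, field n e 1, field n e 2} - {n} = set e" if "e \<in> set es" for e
  proof -
    have "length e \<le> 3" using that len3 by blast
    then consider "e = []" | a where "e = [a]" | a b where "e = [a, b]" | a b c where "e = [a, b, c]"
      by (cases e; cases "tl e"; cases "tl (tl e)"; cases "tl (tl (tl e))") auto
    then show ?thesis using lt[OF that] by cases (auto simp: field_def)
  qed
  have "rules_ok n m E X leaf_fm the_rules"
    unfolding rules_ok_def
  proof (intro allI impI)
    fix arr assume X: "\<forall>a<3. \<forall>j<m. arr a j = X a j" and v: "valid n (arr 3)"
    have r: "repr n m E arr"
      unfolding repr_def
    proof (intro conjI allI impI)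
      fix a j assume aj: "a < (3::nat)" "j < m"
      have "field n (es ! j) a \<le> n"
        using lt[of "es ! j" "es ! j ! a"] aj by (auto simp: field_def m_def)
      then show "arr a j \<le> n" using X aj by (simp add: X_def)
    next
      have "(\<lambda>j. {arr 0 j, arr 1 j, arr 2 j} - {n}) ` {..<m} = (\<lambda>j. set (es ! j)) ` {..<m}"
      proof (rule image_cong[OF refl])
        fix j assume "j \<in> {..<m}"
        then show "{arr 0 j, arr 1 j, arr 2 j} - {n} = set (es ! j)"
          using X field_set[of "es ! j"] by (simp add: X_def m_def)
      qed
      also have "\<dots> = set ` set es" unfolding m_def by (auto simp: set_conv_nth)
      finally show "E = (\<lambda>j. {arr 0 j, arr 1 j, arr 2 j} - {n}) ` {..<m}" using es(2) by simp
    qed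
    show "rules_spec n m E arr the_rules \<and>
      (sat n m arr leaf_fm (\<lambda>_. 0) \<longleftrightarrow> minimal_transversal {..<n} E (level n (arr 3) 1))"
      using the_rules_spec[OF E r v] leaf_spec[OF E r v] by blast
  qed
  note search = wp_searchc[OF _ _ wf_the_rules wf_leaf N(1) _ this]
  have Sol_start: "Sol n E (start n) = {S. minimal_transversal {..<n} E S}"
    by (auto simp: Sol_def start_def level_def)
  have valid_start: "valid n (start n)" by (simp add: valid_def start_def)
  have mN: "m \<le> N" using N by (simp add: m_def)
  have "f 1 \<noteq> 0" using m f01 by simp
  have main: "wp (savec ;; copyinc ;; setupc ;; parsec ;; initc ;; searchc leaf_fm the_rules)
    (\<lambda>k M' os'. k + 3 \<le> 2000 * Suc N + K * (iteration_cost N leaf_fm the_rules + 3) \<and>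
    (\<exists>ts. os' = encode_sets ts \<and> distinct (map set ts) \<and>
      set (map set ts) = {S. minimal_transversal {..<n} E S})) f []"
    unfolding wp_Seq
  proof (rule wp_mono[OF wp_savec[where M = f and m = m, OF f01(2) m(1)]], fold q_def, goal_cases)
    case (1 k1 M1 os1)
    note k1 = this
    show ?case
    proof (rule wp_mono[OF wp_copyinc[where n = n and q = q and f = f and l = l]], goal_cases)
      case (8 k2 M2 os2)
      note k2 = this
      show ?case
      proof (rule wp_mono[OF wp_setupc[where n = n and q = q]], goal_cases)
        case (4 k3 M3 os3)
        note k3 = this
        have M3: "M3 (q + i) = enc_edges es ! i" if "i < length (enc_edges es)" for i
        proof -
          have "M3 (q + i) = M2 (q + (i + 2) - 2)" using k3 m by simp
          also have "\<dots> = f (i + 2)"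
          proof -
            have "\<forall>i. 2 \<le> i \<longrightarrow> i < l \<longrightarrow> M2 (q + i - 2) = f i" using k2 by blast
            from this[rule_format, of "i + 2"] show ?thesis using that by (simp add: l_def)
          qed
          finally show ?thesis using f_edges[OF that] by simp
        qed
        have fit: "q + length (enc_edges es) \<le> 8 * q" "52 \<le> q" using l m unfolding l_def by simp_all
        show ?case
        proof (rule wp_mono[OF wp_parsec[where n = n and m = m and b = "8 * q" and s = q and p = q and es = es]], goal_cases)
          case (16 k4 M4 os4)
          note k4 = this
          have M4: "M4 x = M3 x" if "x < 52" "x \<notin> {2, 5, 7, 13, 14, 17, 18, 19}" for x
            using k4 that by blast
          have bases: "M4 (20 + a) = (8 + a) * q" if "a < 4" for a
          proof -
            have "a = 0 \<or> a = 1 \<or> a = 2 \<or> a = 3" using that by linarith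
            then show ?thesis using k3 M4[of "20 + a"] by auto
          qed
          have "M4 ((8 + a) * q + j) = X a j" if "a < 3" "j < m" for a j
            using k4 that by (simp add: X_def algebra_simps)
          then have core4: "core M4"
            unfolding core_def using k4 k3 bases M4[of 0] M4[of 3] M4[of 8] M4[of 10] by simp
          have M49: "M4 9 = 11 * q + Suc n" using M4[of 9] k3 by simp
          show ?case
          proof (rule wp_mono[OF wp_initc[OF core4 M49]], goal_cases)
            case (1 k5 M5 os5)
            note k5 = this
            show ?case
            proof (rule wp_mono[OF search[where K = K and ss = "[start n]"]], goal_cases)
              case (7 k6 M6 os6)
              define Z where "Z = K * (iteration_cost N leaf_fm the_rules + 3)"
              \<comment> \<open>1536 is 12 * 128, from copying q = 128m cells; together with 32 and
                8 it stays below 2000.\<close>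
              have "q * 12 \<le> 1536 * N" "m * 32 \<le> 32 * N" "n * 8 \<le> 8 * N"
                using mN N(1) by (simp_all add: q_def)
              moreover have "k1 \<le> 200" "k2 \<le> q * 12 + 3" "k3 \<le> 15" "k4 \<le> m * 32 + 1" "k5 \<le> n * 8 + 7"
                using k1 k2 k3 k4 k5 by blast+
              moreover have "k6 \<le> Z + 2" using 7 unfolding Z_def by blast
              ultimately have "k1 + (k2 + (k3 + (k4 + (k5 + k6)))) + 3 \<le> 2000 * N + 2000 + Z"
                by linarith
              also have "\<dots> = 2000 * Suc N + K * (iteration_cost N leaf_fm the_rules + 3)"
                by (simp add: Z_def)
              finally have "k1 + (k2 + (k3 + (k4 + (k5 + k6)))) + 3 \<le>
                2000 * Suc N + K * (iteration_cost N leaf_fm the_rules + 3)" .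
              then show ?case using 7 k1 k2 k3 k4 k5 Sol_start by simp
            qed (use k5 mN valid_start K in auto)
          qed
        qed (use k3 m M3 len3 fit m_def q_def in simp_all)
      qed (use k2 in auto)
    qed (use k1 m f01 l in auto)
  qed
  show ?thesis
    unfolding program_def wp_If using \<open>f 1 \<noteq> 0\<close> main by simp
qed

section \<open>The running time\<close>

text \<open>The degree is irrelevant: any polynomial is absorbed by the gap between 1.675 and
  1.6755.\<close>

definition poly_bounded :: "(nat \<Rightarrow> nat) \<Rightarrow> bool" where
  "poly_bounded f \<longleftrightarrow> (\<exists>a d. \<forall>N. f N \<le> a * Suc N ^ d)"

lemma poly_bounded_const: "poly_bounded (\<lambda>_. c)"
  unfolding poly_bounded_def by (intro exI[of _ c] exI[of _ 0]) simp

lemma poly_bounded_id: "poly_bounded (\<lambda>N. N)"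
  unfolding poly_bounded_def by (intro exI[of _ 1]) simp

lemma poly_bounded_mult:
  assumes "poly_bounded f" "poly_bounded g"
  shows "poly_bounded (\<lambda>N. f N * g N)"
proof -
  obtain a d b e where "\<And>N. f N \<le> a * Suc N ^ d" "\<And>N. g N \<le> b * Suc N ^ e"
    using assms unfolding poly_bounded_def by blast
  then have "f N * g N \<le> (a * Suc N ^ d) * (b * Suc N ^ e)" for N
    by (intro mult_le_mono)
  then have "f N * g N \<le> (a * b) * Suc N ^ (d + e)" for N
    by (simp only: power_add ac_simps)
  then show ?thesis unfolding poly_bounded_def by blast
qed

lemma poly_bounded_add:
  assumes "poly_bounded f" "poly_bounded g"
  shows "poly_bounded (\<lambda>N. f N + g N)"
proof -
  obtain a d b e where fg: "\<And>N. f N \<le> a * Suc N ^ d" "\<And>N. g N \<le> b * Suc N ^ e"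
    using assms unfolding poly_bounded_def by blast
  have "f N + g N \<le> (a + b) * Suc N ^ (d + e)" for N
  proof -
    have "Suc N ^ d \<le> Suc N ^ (d + e)" "Suc N ^ e \<le> Suc N ^ (d + e)"
      by (intro power_increasing; simp)+
    then have "a * Suc N ^ d \<le> a * Suc N ^ (d + e)" "b * Suc N ^ e \<le> b * Suc N ^ (d + e)"
      by (intro mult_le_mono2; simp)+
    then show ?thesis using fg[of N] unfolding add_mult_distrib by linarith
  qed
  then show ?thesis unfolding poly_bounded_def by blast
qed

lemma poly_bounded_Suc: "poly_bounded f \<Longrightarrow> poly_bounded (\<lambda>N. Suc (f N))"
  using poly_bounded_add[OF poly_bounded_const[of 1]] by simp

lemmas poly_bounded_intros = poly_bounded_const poly_bounded_id poly_bounded_mult poly_bounded_add poly_bounded_Suc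

lemma poly_bounded_cost: "poly_bounded (\<lambda>N. cost N p)"
  by (induction p) (auto intro!: poly_bounded_intros)

lemma poly_bounded_push_costs: "poly_bounded (\<lambda>N. sum_list (map (push_cost N) brs))"
  by (induction brs) (auto simp: push_cost_def intro!: poly_bounded_intros)

lemma poly_bounded_rules_cost: "poly_bounded (\<lambda>N. rules_cost N lf rs)"
  by (induction rs) (auto intro!: poly_bounded_intros poly_bounded_cost poly_bounded_push_costs)

lemma poly_bounded_iteration_cost: "poly_bounded (\<lambda>N. iteration_cost N lf rs)"
  unfolding iteration_cost_def by (intro poly_bounded_intros poly_bounded_rules_cost)

text \<open>With 1/s = 1 + t, the Bernoulli inequality bounds (1 + t)^n below by 1 + n t, so a
  linear factor times s^n stays bounded.\<close>

lemma linear_times_geometric_bounded: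
  fixes s :: real
  assumes "0 < s" "s < 1"
  shows "real (Suc n) * s ^ n \<le> 1 + s / (1 - s)"
proof -
  define t where "t = 1 / s - 1"
  have t: "0 < t" "s * (1 + t) = 1" "s / (1 - s) = 1 / t"
    using assms by (auto simp: t_def field_simps)
  have "1 + real n * t \<le> (1 + t) ^ n"
    by (rule Bernoulli_inequality) (use t in auto)
  then have "s ^ n * (1 + real n * t) \<le> s ^ n * (1 + t) ^ n"
    using assms by (intro mult_left_mono) auto
  also have "\<dots> = 1" using t by (simp add: power_mult_distrib[symmetric])
  finally have *: "s ^ n * (1 + real n * t) \<le> 1" .
  have "real (Suc n) \<le> (1 + 1 / t) * (1 + real n * t)"
    using t by (simp add: field_simps)
  then have "real (Suc n) * s ^ n \<le> (1 + 1 / t) * (1 + real n * t) * s ^ n"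
    using assms by (intro mult_right_mono) auto
  also have "\<dots> = (1 + 1 / t) * (s ^ n * (1 + real n * t))" by simp
  also have "\<dots> \<le> (1 + 1 / t) * 1" using t * by (intro mult_left_mono) auto
  finally show ?thesis using t by simp
qed

text \<open>q^n is split into two powers of sqrt q: one absorbs a linear factor, the other the
  remaining power by induction. Hence the generalisation over q.\<close>

lemma power_times_geometric_bounded:
  fixes q :: real
  assumes "0 < q" "q < 1"
  shows "\<exists>C. \<forall>n. real (Suc n) ^ d * q ^ n \<le> C"
  using assms
proof (induction d arbitrary: q)
  case 0
  then show ?case by (auto intro!: exI[of _ 1] power_le_one)
next
  case (Suc d)
  have s: "0 < sqrt q" "sqrt q < 1" using Suc.prems by auto
  obtain C where C: "\<And>n. real (Suc n) ^ d * sqrt q ^ n \<le> C" using Suc.IH[OF s] by blast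
  have "real (Suc n) ^ Suc d * q ^ n \<le> C * (1 + sqrt q / (1 - sqrt q))" for n
  proof -
    have "q ^ n = sqrt q ^ n * sqrt q ^ n"
      using Suc.prems by (simp add: power_mult_distrib[symmetric])
    then have "real (Suc n) ^ Suc d * q ^ n = (real (Suc n) ^ d * sqrt q ^ n) * (real (Suc n) * sqrt q ^ n)"
      by simp
    also have "\<dots> \<le> C * (1 + sqrt q / (1 - sqrt q))"
    proof (rule mult_mono[OF C linear_times_geometric_bounded[OF s]])
      have "0 \<le> real (Suc 0) ^ d * sqrt q ^ 0" by simp
      also have "\<dots> \<le> C" by (rule C)
      finally show "0 \<le> C" .
    qed (use s in simp)
    finally show ?thesis .
  qed
  then show ?case by blast
qed

text \<open>Padding with n maps triples over {..n} onto all possible edges. So m is polynomial in n,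
  and with it the cost of every loop over edges.\<close>

lemma card_rank3_le:
  assumes "hypergraph {..<n} E" "hg_rank_le E 3"
  shows "card E \<le> Suc n ^ 3"
proof -
  let ?f = "\<lambda>(x, y, z). {x, y, z} - {n}" and ?D = "{..n} \<times> {..n} \<times> {..n}"
  have "E \<subseteq> ?f ` ?D"
  proof
    fix e assume "e \<in> E"
    then have e: "e \<subseteq> {..<n}" "card e \<le> 3" using assms by (auto simp: hypergraph_def hg_rank_le_def)
    then have "finite e" using finite_subset by blast
    have "card e = 0 \<or> card e = 1 \<or> card e = 2 \<or> card e = 3" using e(2) by linarith
    then consider "e = {}" | x where "e = {x}" | x y where "e = {x, y}" | x y z where "e = {x, y, z}"
      using \<open>finite e\<close> by (auto simp: card_1_singleton_iff card_2_iff card_3_iff)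
    then obtain x y z where "e = {x, y, z} - {n}" "x \<le> n" "y \<le> n" "z \<le> n"
    proof cases
      case 1
      then show ?thesis using that[of n n n] by simp
    next
      case (2 x)
      then show ?thesis using that[of x n n] e(1) by auto
    next
      case (3 x y)
      then show ?thesis using that[of x y n] e(1) by auto
    next
      case (4 x y z)
      then show ?thesis using that[of x y z] e(1) by auto
    qed
    then show "e \<in> ?f ` ?D" by (intro image_eqI[of _ _ "(x, y, z)"]) auto
  qed
  then have "card E \<le> card ?D" using surj_card_le[of ?D E ?f] by simp
  also have "\<dots> = Suc n ^ 3" by (simp add: card_cartesian_product power3_eq_cube)
  finally show ?thesis .
qed

lemma Phi_start_le:
  assumes "hypergraph {..<n} E"
  shows "Phi n E (start n) \<le> 2 * real (Suc n) * (67/40) ^ n"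
proof -
  have "\<Union>(resid n E (start n)) \<subseteq> {..<n}"
    using Union_resid[OF assms, of "start n"] by (auto simp: valid_def start_def level_def)
  then have "card (\<Union>(resid n E (start n))) \<le> n"
    using card_mono[of "{..<n}"] by fastforce
  then have "(67/40::real) ^ card (\<Union>(resid n E (start n))) \<le> (67/40) ^ n"
    by (intro power_increasing) auto
  then have "pot (resid n E (start n)) \<le> (67/40) ^ n * 1"
    unfolding pot_def using rho_le_1 rho_ge[of "resid n E (start n)"] by (intro mult_mono) auto
  moreover have "level n (start n) 0 \<subseteq> {..<n}" by (auto simp: level_def)
  then have "card (level n (start n) 0) \<le> n" using card_mono[of "{..<n}"] by fastforce
  ultimately show ?thesis
    unfolding Phi_def using pot_pos[of "resid n E (start n)"] by (intro mult_mono) auto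
qed

lemma program_run:
  assumes "wp c Q (mem (init_config inp)) []"
  shows "\<exists>k. halted (compile 0 c) (run (compile 0 c) k (init_config inp)) \<and>
    (\<exists>M. Q k M (out (run (compile 0 c) k (init_config inp))))"
proof -
  obtain k M' os' where ex: "exec c (mem (init_config inp)) [] k M' os'" "Q k M' os'"
    using assms by (auto simp: wp_def)
  have "init_config inp = conf 0 (mem (init_config inp)) []" by (simp add: init_config_def)
  then have "run (compile 0 c) k (init_config inp) = conf (clen c) M' os'"
    using compile_correct[OF ex(1), of "compile 0 c" "[]" 0 "[]"] by simp
  then show ?thesis using ex(2) by (intro exI[of _ k]) (auto simp: halted_def)
qed

theorem theorem1:
  shows "\<exists>(P :: instr list) (C :: real). \<forall>(n :: nat) (E :: nat set set) (es :: nat list list).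
      hypergraph {..<n} E \<and> hg_rank_le E 3 \<and>
      (\<forall>e\<in>set es. distinct e) \<and> distinct (map set es) \<and> set (map set es) = E
      \<longrightarrow> (\<exists>k. real k \<le> C * 1.6755 ^ n \<and>
               halted P (run P k (init_config (encode_hg n es))) \<and>
               (\<exists>ts. out (run P k (init_config (encode_hg n es))) = encode_sets ts \<and>
                     distinct (map set ts) \<and>
                     set (map set ts) = {S. minimal_transversal {..<n} E S}))"
proof -
  have "poly_bounded (\<lambda>N. 2000 * Suc N + (iteration_cost N leaf_fm the_rules + 3))"
    by (intro poly_bounded_intros poly_bounded_iteration_cost)
  then obtain a d where ad: "\<And>N. 2000 * Suc N + (iteration_cost N leaf_fm the_rules + 3) \<le> a * Suc N ^ d"
    unfolding poly_bounded_def by blast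
  define q :: real where "q = (67/40) / 1.6755"
  \<comment> \<open>The exponent has 3d from the work per node, as \<open>N\<close> is cubic in n,
    and 1 from the linear factor in \<open>Phi\<close>.\<close>
  obtain C where C: "\<And>n. real (Suc n) ^ (3 * d + 1) * q ^ n \<le> C"
    using power_times_geometric_bounded[of q "3 * d + 1"] by (auto simp: q_def)
  let ?P = "compile 0 program"
  have "\<exists>k. real k \<le> (4 * a * 2 ^ d * C) * 1.6755 ^ n \<and> halted ?P (run ?P k (init_config (encode_hg n es))) \<and>
      (\<exists>ts. out (run ?P k (init_config (encode_hg n es))) = encode_sets ts \<and> distinct (map set ts) \<and>
        set (map set ts) = {S. minimal_transversal {..<n} E S})"
    if E: "hypergraph {..<n} E" "hg_rank_le E 3"
      and es: "\<forall>e\<in>set es. distinct e" "distinct (map set es)" "set (map set es) = E" for n E es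
  proof -
    define K where "K = nat \<lceil>Phi n E (start n)\<rceil>"
    define N where "N = n + Suc n ^ 3"
    have K: "Phi n E (start n) \<le> real K" by (simp add: K_def real_nat_ceiling_ge)
    \<comment> \<open>The edge list has no repetitions, which is what bounds the length of the input
      by a polynomial in n.\<close>
    have "length es = card E" using es by (metis distinct_card length_map)
    then have N: "n \<le> N" "length es \<le> N" using card_rank3_le[OF E] by (auto simp: N_def)
    from program_run[OF wp_program[OF E es(1,3) N K refl]]
    obtain k where k: "k \<le> 2000 * Suc N + K * (iteration_cost N leaf_fm the_rules + 3)"
      and halt: "halted ?P (run ?P k (init_config (encode_hg n es)))"
      and ts: "\<exists>ts. out (run ?P k (init_config (encode_hg n es))) = encode_sets ts \<and> distinct (map set ts) \<and>
        set (map set ts) = {S. minimal_transversal {..<n} E S}"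
      by blast
    have "real K \<le> 2 * real (Suc n) * (67/40) ^ n + 1"
      using Phi_start_le[OF E(1)] Phi_ge_1[of n E "start n"] unfolding K_def by linarith
    moreover have "1 * 1 \<le> real (Suc n) * (67/40) ^ n" by (intro mult_mono) auto
    ultimately have K_le: "real K + 1 \<le> 4 * (real (Suc n) * (67/40) ^ n)" by linarith
    have "Suc N ^ d \<le> (2 * Suc n ^ 3) ^ d"
    proof (rule power_mono)
      have "Suc n ^ 1 \<le> Suc n ^ 3" by (intro power_increasing) auto
      then show "Suc N \<le> 2 * Suc n ^ 3" by (simp add: N_def)
    qed simp
    have "k \<le> (K + 1) * (2000 * Suc N + (iteration_cost N leaf_fm the_rules + 3))"
      using k by (simp add: algebra_simps)
    also have "\<dots> \<le> (K + 1) * (a * Suc N ^ d)" by (intro mult_le_mono2 ad)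
    also have "\<dots> \<le> (K + 1) * (a * (2 * Suc n ^ 3) ^ d)" by (intro mult_le_mono2) fact
    finally have "k \<le> (K + 1) * (a * (2 * Suc n ^ 3) ^ d)" .
    then have "real k \<le> real ((K + 1) * (a * (2 * Suc n ^ 3) ^ d))" by (simp only: of_nat_le_iff)
    also have "\<dots> = (real K + 1) * (real a * (2 ^ d * real (Suc n) ^ (3 * d)))"
      by (simp add: power_mult_distrib power_mult distrib_right)
    also have "\<dots> \<le> (4 * (real (Suc n) * (67/40) ^ n)) * (real a * (2 ^ d * real (Suc n) ^ (3 * d)))"
      using K_le by (intro mult_right_mono) auto
    also have "(67/40) ^ n = q ^ n * 1.6755 ^ n" by (simp add: q_def power_mult_distrib[symmetric])
    also have "4 * (real (Suc n) * (q ^ n * 1.6755 ^ n)) * (real a * (2 ^ d * real (Suc n) ^ (3 * d))) =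
        (4 * a * 2 ^ d * 1.6755 ^ n) * (real (Suc n) ^ (3 * d + 1) * q ^ n)"
      by (simp add: algebra_simps)
    also have "\<dots> \<le> (4 * a * 2 ^ d * 1.6755 ^ n) * C"
      by (intro mult_left_mono C) auto
    finally have "real k \<le> (4 * a * 2 ^ d * C) * 1.6755 ^ n" by (simp add: mult_ac)
    then show ?thesis using halt ts by blast
  qed
  then show ?thesis by blast
qed

end
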